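(* Suppose a Heun equation $(\mathfrak H)$ has four singular points and is nontrivial ($\alpha\beta\neq0$ or $q\neq0$). Then the only reductions of its local Heun function $\mathit{Hl}$ to ${}_2F_1$ that can be performed by a rational transformation of the independent variable involve polynomial transformations of degrees $2,3,4,5$ and $6$. There are seven distinct types, each of which can exist only if $d$ lies on an appropriate cross-ratio orbit. The following list includes a representative reduction of each type (in each formula all upper signs or all lower signs are taken). The ones with real $d$ (and $\deg R=2,3,4$) include $$\mathit{Hl}\left(2,\alpha\beta;\alpha,\beta,\gamma,\alpha+\beta-2\gamma+1;t\right)={}_2F_1\left(\tfrac\alpha2,\tfrac\beta2;\gamma;t(2-t)\right),$$ $$\mathit{Hl}\left(4,\alpha\beta;\alpha,\beta,\tfrac12,\tfrac{2(\alpha+\beta)}3;t\right)={}_2F_1\left(\tfrac\alpha3,\tfrac\beta3;\tfrac12;1-(t-1)^2(1-t/4)\right),$$ $$\mathit{Hl}\left(2,\alpha\beta;\alpha,\beta,\tfrac{\alpha+\beta+2}4,\tfrac{\alpha+\beta}2;t\right)={}_2F_1\left(\tfrac\alpha4,\tfrac\beta4;\tfrac{\alpha+\beta+2}4;1-4\left[t(2-t)-\tfrac12\right]^2\right),$$ and the ones with non-real $d$ (and $\deg R=3,4,5,6$) include $$\mathit{Hl}\left(\tfrac12\pm\mathrm i\tfrac{\sqrt3}2,\ \alpha\beta(\tfrac12\pm\mathrm i\tfrac{\sqrt3}6);\alpha,\beta,\tfrac{\alpha+\beta+1}3,\tfrac{\alpha+\beta+1}3;t\right)={}_2F_1\left(\tfrac\alpha3,\tfrac\beta3;\tfrac{\alpha+\beta+1}3;1-\left[1-t/(\tfrac12\pm\mathrm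 i\tfrac{\sqrt3}6)\right]^3\right),$$ $$\mathit{Hl}\left(\tfrac12\pm\mathrm i\tfrac{5\sqrt2}4,\ \alpha(\tfrac23-\alpha)(\tfrac12\pm\mathrm i\tfrac{\sqrt2}4);\alpha,\tfrac23-\alpha,\tfrac12,\tfrac12;t\right)={}_2F_1\left(\tfrac\alpha4,\tfrac16-\tfrac\alpha4;\tfrac12;1-\left[1-t/(\tfrac12\pm\mathrm i\tfrac{5\sqrt2}4)\right]\left[1-t/(\tfrac12\pm\mathrm i\tfrac{\sqrt2}4)\right]^3\right),$$ $$\mathit{Hl}\left(\tfrac12\pm\mathrm i\tfrac{11\sqrt{15}}{90},\ \alpha(\tfrac56-\alpha)(\tfrac12\pm\mathrm i\tfrac{\sqrt{15}}{18});\alpha,\tfrac56-\alpha,\tfrac23,\tfrac23;t\right)={}_2F_1\left(\tfrac\alpha5,\tfrac16-\tfrac\alpha5;\tfrac23;\left(\mp\mathrm i\tfrac{2025\sqrt{15}}{64}\right)t(t-1)\left[t-(\tfrac12\pm\mathrm i\tfrac{\sqrt{15}}{18})\right]^3\right),$$ $$\mathit{Hl}\left(\tfrac12\pm\mathrm i\tfrac{\sqrt3}2,\ \alpha(1-\alpha)(\tfrac12\pm\mathrm i\tfrac{\sqrt3}6);\alpha,1-\alpha,\tfrac23,\tfrac23;t\right)={}_2F_1\left(\tfrac\alpha6,\tfrac16-\tfrac\alpha6;\tfrac23;1-4\left\{\left[1-t/(\tfrac12\pm\mathrm i\tfrac{\sqrt3}6)\right]^3-\tfrac12\right\}^2\right).$$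 In the preceding reductions $\alpha,\beta,\gamma$ are free parameters. Each of these equalities holds in a neighborhood of $t=0$ whenever the two sides are defined, e.g. whenever the fifth argument of $\mathit{Hl}$ and the third argument of ${}_2F_1$ are not equal to a nonpositive integer.
   Context: The hypergeometric equation $(\mathfrak h)$ with parameters $a,b,c\in\mathbb C$ is $$\frac{d^2y}{dz^2}+\left(\frac cz+\frac{a+b-c+1}{z-1}\right)\frac{dy}{dz}+\frac{ab}{z(z-1)}\,y=0 .$$ For $c$ not a nonpositive integer, ${}_2F_1(a,b;c;z)$ is its solution analytic at $z=0$ with value $1$ there. The Heun equation $(\mathfrak H)$ with parameters $d\in\mathbb C\setminus\{0,1\}$, $q,\alpha,\beta,\gamma,\delta,\epsilon\in\mathbb C$ subject to $\alpha+\beta-\gamma-\delta-\epsilon+1=0$ is $$\frac{d^2u}{dt^2}+\left(\frac\gamma t+\frac\delta{t-1}+\frac\epsilon{t-d}\right)\frac{du}{dt}+\frac{\alpha\beta t-q}{t(t-1)(t-d)}\,u=0 .$$ For $\gamma$ not a nonpositive integer, the local Heun function $\mathit{Hl}(d,q;\alpha,\beta,\gamma,\delta;t)$ is its solution analytic at $t=0$ with value $1$ there. The equation "has four singular points" if each of $0,1,d,\infty$ is genuinely a singular point, i.e. none of the following holds: $\gamma=0$ and $q=0$; $\delta=0$ and $q=\alpha\beta$; $\epsilon=0$ and $q=\alpha\beta d$; $\alpha\beta=0$, $\alpha+\beta=1$ and $q=0$. A reduction of $\mathit{Hl}$ to ${}_2F_1$ by a rational transformation $z=R(t)$ of the independent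 variable ($R$ nonconstant rational) means one induced by a reduction of the equations: substituting $z=R(t)$ in $(\mathfrak h)$ (for some $a,b,c$), without change of the dependent variable, yields exactly the Heun equation, and $R(0)=0$, so that $\mathit{Hl}(t)={}_2F_1(a,b;c;R(t))$ near $t=0$. The cross-ratio orbit of $D\in\mathbb C\setminus\{0,1\}$ is $\{D,1-D,1/D,1/(1-D),D/(D-1),(D-1)/D\}$. The type of a reduction: if a listed representative has singular point parameter $d=D$ and polynomial $R_0$, the reductions of the same type have $d$ on the cross-ratio orbit of $D$ and polynomial $A_2\circ R_0\circ A_1$, where $A_1$ is a complex affine map with $A_1(\{0,1,d\})=\{0,1,D\}$ and $A_2(z)=z$ or $1-z$, chosen so that $t=0$ is mapped to $z=0$. The appropriate cross-ratio orbit for each type is that of the value of $d$ in its representative. *)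

theory Defs
  imports "HOL-Analysis.Analysis" "HOL-Library.Nonpos_Ints"
begin

text \<open>A second order equation $y'' + p\,y' + q\,y = 0$ is represented by its coefficient
  functions $p$, $q$.\<close>

definition hyp_p :: "complex \<Rightarrow> complex \<Rightarrow> complex \<Rightarrow> complex \<Rightarrow> complex" where
  "hyp_p a b c z = c / z + (a + b - c + 1) / (z - 1)"

definition hyp_q :: "complex \<Rightarrow> complex \<Rightarrow> complex \<Rightarrow> complex" where
  "hyp_q a b z = a * b / (z * (z - 1))"

definition heun_p :: "complex \<Rightarrow> complex \<Rightarrow> complex \<Rightarrow> complex \<Rightarrow> complex \<Rightarrow> complex" where
  "heun_p d \<gamma> \<delta> \<epsilon> t = \<gamma> / t + \<delta> / (t - 1) + \<epsilon> / (t - d)"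

definition heun_q :: "complex \<Rightarrow> complex \<Rightarrow> complex \<Rightarrow> complex \<Rightarrow> complex \<Rightarrow> complex" where
  "heun_q d q \<alpha> \<beta> t = (\<alpha> * \<beta> * t - q) / (t * (t - 1) * (t - d))"

definition heun_parameters ::
  "complex \<Rightarrow> complex \<Rightarrow> complex \<Rightarrow> complex \<Rightarrow> complex \<Rightarrow> complex \<Rightarrow> bool" where
  "heun_parameters d \<alpha> \<beta> \<gamma> \<delta> \<epsilon> \<longleftrightarrow> d \<notin> {0, 1} \<and> \<alpha> + \<beta> - \<gamma> - \<delta> - \<epsilon> + 1 = 0"

definition four_singular_points ::
  "complex \<Rightarrow> complex \<Rightarrow> complex \<Rightarrow> complex \<Rightarrow> complex \<Rightarrow> complex \<Rightarrow> complex \<Rightarrow> bool" where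
  "four_singular_points d q \<alpha> \<beta> \<gamma> \<delta> \<epsilon> \<longleftrightarrow>
     \<not> (\<gamma> = 0 \<and> q = 0) \<and>
     \<not> (\<delta> = 0 \<and> q = \<alpha> * \<beta>) \<and>
     \<not> (\<epsilon> = 0 \<and> q = \<alpha> * \<beta> * d) \<and>
     \<not> (\<alpha> * \<beta> = 0 \<and> \<alpha> + \<beta> = 1 \<and> q = 0)"

definition nontrivial :: "complex \<Rightarrow> complex \<Rightarrow> complex \<Rightarrow> bool" where
  "nontrivial q \<alpha> \<beta> \<longleftrightarrow> \<alpha> * \<beta> \<noteq> 0 \<or> q \<noteq> 0"

text \<open>The germ at 0 of the solution that is analytic at 0 with value 1 there. The germ is
  identified with its convergent Taylor series, so the resulting function is meaningful inside
  the disk of convergence only. The equation is required on a punctured neighborhood of 0,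
  since 0 is a singular point of the coefficients.\<close>

definition analytic_solution ::
  "(complex \<Rightarrow> complex) \<Rightarrow> (complex \<Rightarrow> complex) \<Rightarrow> complex \<Rightarrow> complex" where
  "analytic_solution p q = eval_fps (THE F. fps_conv_radius F > 0 \<and> fps_nth F 0 = 1 \<and>
     (\<forall>\<^sub>F x in at 0. deriv (deriv (eval_fps F)) x + p x * deriv (eval_fps F) x
                      + q x * eval_fps F x = 0))"

text \<open>Used only for a third, respectively fifth, parameter that is not a nonpositive integer;
  otherwise existence or uniqueness of the solution may fail.\<close>

definition F21 :: "complex \<Rightarrow> complex \<Rightarrow> complex \<Rightarrow> complex \<Rightarrow> complex" where
  "F21 a b c = analytic_solution (hyp_p a b c) (hyp_q a b)"

definition Hl ::
  "complex \<Rightarrow> complex \<Rightarrow> complex \<Rightarrow> complex \<Rightarrow> complex \<Rightarrow> complex \<Rightarrow> complex \<Rightarrow> complex" where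
  "Hl d q \<alpha> \<beta> \<gamma> \<delta> =
     analytic_solution (heun_p d \<gamma> \<delta> (\<alpha> + \<beta> - \<gamma> - \<delta> + 1)) (heun_q d q \<alpha> \<beta>)"

text \<open>If $y'' + p\,y' + q\,y = 0$ and $u = y \circ R$, then $u' = (y' \circ R)\,R'$ and
  $u'' = (y'' \circ R)\,R'^2 + (y' \circ R)\,R''$, so
  $u'' + \bigl((p \circ R)\,R' - R''/R'\bigr)\,u' + (q \circ R)\,R'^2\,u = 0$.
  Two rational functions are equal iff they agree at all but finitely many points; this
  disregards the poles, where division yields junk values.\<close>

definition equation_reduction ::
  "complex \<Rightarrow> complex \<Rightarrow> complex \<Rightarrow> complex \<Rightarrow> complex \<Rightarrow> complex \<Rightarrow> complex \<Rightarrow>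
   complex \<Rightarrow> complex \<Rightarrow> complex \<Rightarrow> (complex \<Rightarrow> complex) \<Rightarrow> bool" where
  "equation_reduction d q \<alpha> \<beta> \<gamma> \<delta> \<epsilon> a b c R \<longleftrightarrow>
     (\<forall>\<^sub>F t in cofinite.
        hyp_p a b c (R t) * deriv R t - deriv (deriv R) t / deriv R t = heun_p d \<gamma> \<delta> \<epsilon> t \<and>
        hyp_q a b (R t) * (deriv R t)\<^sup>2 = heun_q d q \<alpha> \<beta> t)"

text \<open>Reduction of the local Heun function by the nonconstant rational function $P/Q$ in lowest
  terms. By coprimality the condition \<open>poly P 0 = 0\<close> says that $P/Q$ vanishes, rather than has a
  pole, at 0.\<close>

definition Hl_rational_reduction ::
  "complex \<Rightarrow> complex \<Rightarrow> complex \<Rightarrow> complex \<Rightarrow> complex \<Rightarrow> complex \<Rightarrow> complex \<Rightarrow>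
   complex \<Rightarrow> complex \<Rightarrow> complex \<Rightarrow> complex poly \<Rightarrow> complex poly \<Rightarrow> bool" where
  "Hl_rational_reduction d q \<alpha> \<beta> \<gamma> \<delta> \<epsilon> a b c P Q \<longleftrightarrow>
     \<gamma> \<notin> \<int>\<^sub>\<le>\<^sub>0 \<and> coprime P Q \<and> (degree P > 0 \<or> degree Q > 0) \<and>
     equation_reduction d q \<alpha> \<beta> \<gamma> \<delta> \<epsilon> a b c (\<lambda>t. poly P t / poly Q t) \<and> poly P 0 = 0"

datatype reduction_type =
  Real2 | Real3 | Real4 | Nonreal3 | Nonreal4 | Nonreal5 | Nonreal6

fun type_degree :: "reduction_type \<Rightarrow> nat" where
  "type_degree Real2 = 2"
| "type_degree Real3 = 3"
| "type_degree Real4 = 4"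
| "type_degree Nonreal3 = 3"
| "type_degree Nonreal4 = 4"
| "type_degree Nonreal5 = 5"
| "type_degree Nonreal6 = 6"

text \<open>Singular point parameter and polynomial of the representatives. The argument \<open>s\<close> is the
  sign, \<open>1\<close> for the upper and \<open>-1\<close> for the lower one; it is irrelevant for the types with
  real $d$.\<close>

fun rep_d :: "reduction_type \<Rightarrow> complex \<Rightarrow> complex" where
  "rep_d Real2 s = 2"
| "rep_d Real3 s = 4"
| "rep_d Real4 s = 2"
| "rep_d Nonreal3 s = 1/2 + s * \<i> * of_real (sqrt 3 / 2)"
| "rep_d Nonreal4 s = 1/2 + s * \<i> * of_real (5 * sqrt 2 / 4)"
| "rep_d Nonreal5 s = 1/2 + s * \<i> * of_real (11 * sqrt 15 / 90)"
| "rep_d Nonreal6 s = 1/2 + s * \<i> * of_real (sqrt 3 / 2)"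

fun rep_R :: "reduction_type \<Rightarrow> complex \<Rightarrow> complex \<Rightarrow> complex" where
  "rep_R Real2 s t = t * (2 - t)"
| "rep_R Real3 s t = 1 - (t - 1)^2 * (1 - t/4)"
| "rep_R Real4 s t = 1 - 4 * (t * (2 - t) - 1/2)^2"
| "rep_R Nonreal3 s t = 1 - (1 - t / (1/2 + s * \<i> * of_real (sqrt 3 / 6)))^3"
| "rep_R Nonreal4 s t = 1 - (1 - t / (1/2 + s * \<i> * of_real (5 * sqrt 2 / 4)))
                            * (1 - t / (1/2 + s * \<i> * of_real (sqrt 2 / 4)))^3"
| "rep_R Nonreal5 s t = (- s * \<i> * of_real (2025 * sqrt 15 / 64)) * t * (t - 1)
                            * (t - (1/2 + s * \<i> * of_real (sqrt 15 / 18)))^3"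
| "rep_R Nonreal6 s t = 1 - 4 * ((1 - t / (1/2 + s * \<i> * of_real (sqrt 3 / 6)))^3 - 1/2)^2"

definition cross_ratio_orbit :: "complex \<Rightarrow> complex set" where
  "cross_ratio_orbit D = {D, 1 - D, 1 / D, 1 / (1 - D), D / (D - 1), (D - 1) / D}"

definition complex_affine :: "(complex \<Rightarrow> complex) \<Rightarrow> bool" where
  "complex_affine A \<longleftrightarrow> (\<exists>m n. m \<noteq> 0 \<and> A = (\<lambda>z. m * z + n))"

definition same_type ::
  "complex \<Rightarrow> (complex \<Rightarrow> complex) \<Rightarrow> complex \<Rightarrow> (complex \<Rightarrow> complex) \<Rightarrow> bool" where
  "same_type D R0 d R \<longleftrightarrow> d \<in> cross_ratio_orbit D \<and> R 0 = 0 \<and>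
     (\<exists>A1 A2. complex_affine A1 \<and> A1 ` {0, 1, d} = {0, 1, D} \<and>
        (A2 = (\<lambda>z. z) \<or> A2 = (\<lambda>z. 1 - z)) \<and> R = A2 \<circ> R0 \<circ> A1)"

text \<open>The formula \<open>Hl d q \<alpha> \<beta> \<gamma> \<delta> t = F21 a b c (R t)\<close> is a representative reduction of type \<open>k\<close>:
  it is induced by a reduction of the equations, and holds near 0 whenever both sides are
  defined.\<close>

definition representative ::
  "reduction_type \<Rightarrow> complex \<Rightarrow> complex \<Rightarrow> complex \<Rightarrow> complex \<Rightarrow> complex \<Rightarrow> complex \<Rightarrow>
   complex \<Rightarrow> complex \<Rightarrow> complex \<Rightarrow> complex \<Rightarrow> (complex \<Rightarrow> complex) \<Rightarrow> bool" where
  "representative k s d q \<alpha> \<beta> \<gamma> \<delta> a b c R \<longleftrightarrow>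
     d = rep_d k s \<and> R = rep_R k s \<and> R 0 = 0 \<and>
     equation_reduction d q \<alpha> \<beta> \<gamma> \<delta> (\<alpha> + \<beta> - \<gamma> - \<delta> + 1) a b c R \<and>
     (\<gamma> \<notin> \<int>\<^sub>\<le>\<^sub>0 \<and> c \<notin> \<int>\<^sub>\<le>\<^sub>0 \<longrightarrow> (\<forall>\<^sub>F t in nhds 0. Hl d q \<alpha> \<beta> \<gamma> \<delta> t = F21 a b c (R t)))"

end

theory Submission
  imports Defs "HOL-Complex_Analysis.Complex_Analysis"
    "HOL-Computational_Algebra.Fundamental_Theorem_Algebra"
begin

text \<open>Comparing the coefficients of \<open>u\<close> in the pulled back hypergeometric equation and in the
  Heun equation gives $ab\,R'^2\,t(t-1)(t-d) = (\alpha\beta t - q)\,R(R-1)$. Orders of vanishing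
  exclude poles of $R$, and force the critical points of the polynomial $R$ to lie over $0$ and
  $1$. Let $\tau = q/(\alpha\beta)$, and let $S$ be the one of $R$, $1-R$ that vanishes at $\tau$.
  The roots of $S(S-1)$ that are singular points other than $\tau$ are simple and those that are
  neither singular nor $\tau$ are double; the order of $S$ at $\tau$ is $m = 2$ if $\tau$ is
  singular and $m = 3$ otherwise. The residues of the coefficients of \<open>u'\<close> show that $S$ has
  no double root besides $\tau$: it would force an exponent difference $1/2$ at $S = 0$,
  contradicting the residue at $\tau$. Hence $S = \kappa (t-\tau)^m a$ and
  $S - 1 = \kappa\, b\, v^2$ with monic $a$, $b$, $v$ of degrees $k$, $m-k$, $k$, where
  $0 \le k \le m$. For each of the seven pairs $(m,k)$ these two
  equations determine $S$ up to an affine change of variable; the representatives realize all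
  seven pairs.\<close>

section \<open>Analytic solutions at a regular singular point\<close>

text \<open>The constants of the list are dictated by residues. A point outside {0, 1, d} with
  multiplicity n over z = 0 or z = 1, where the exponent parameter is e, contributes n e - (n - 1),
  which has to vanish: a triple point forces e = 2/3, a double point e = 1/2. The two parameters c
  and a + b - c + 1 add up to a + b + 1. For (m,k) = (2,0) no such point exists and \<gamma> stays
  free; for (2,1), (2,2), (3,0) one parameter is forced; for (3,1), (3,2), (3,3) both are, so that a
  + b = 1/6, and \<alpha> + \<beta> = (m + k)/6 in the representatives, where \<alpha>, \<beta> are
  m + k times a, b. The degree m + k alone does not separate the types, since 3 and 4 arise twice.
  The reality of d does: it is constant on a cross-ratio orbit and holds exactly for m = 2. The
  local functions are definite descriptions, so a formula for them rests on uniqueness of the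
  analytic solution; this is where \<gamma> and c have to avoid the nonpositive integers.\<close>

lemma cofinite_imp_at:
  fixes x :: "'a :: t1_space"
  assumes "\<forall>\<^sub>F t in cofinite. P t"
  shows "\<forall>\<^sub>F t in at x. P t"
proof -
  have "open (- ({t. \<not> P t} - {x}))"
    using assms by (intro open_Compl finite_imp_closed) (simp add: eventually_cofinite)
  then show ?thesis
    unfolding eventually_at_topological by (intro exI[of _ "- ({t. \<not> P t} - {x})"]) auto
qed

lemma poly_nonzero_cofinite:
  fixes p :: "'a :: idom poly"
  assumes "p \<noteq> 0"
  shows "\<forall>\<^sub>F t in cofinite. poly p t \<noteq> 0"
  using poly_roots_finite[OF assms] by (simp add: eventually_cofinite)

lemma deriv_poly: "deriv (poly p) = poly (pderiv p)" for p :: "complex poly"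
  by (intro ext DERIV_imp_deriv poly_DERIV)

text \<open>The lowest coefficient $g_n$ of a nonzero solution, $n > 0$, satisfies the indicial equation
  $n(n - 1 + g) = 0$.\<close>

lemma regular_singular_fps_eq_0:
  fixes A B C :: "complex poly" and G :: "complex fps"
  assumes A: "coeff A 0 = 0" "coeff A 1 = a" "a \<noteq> 0"
    and B: "coeff B 0 = a * g" and g: "g \<notin> \<int>\<^sub>\<le>\<^sub>0" and G0: "fps_nth G 0 = 0"
    and eq: "fps_of_poly A * fps_deriv (fps_deriv G) + fps_of_poly B * fps_deriv G
               + fps_of_poly C * G = 0"
  shows "G = 0"
proof (rule ccontr)
  assume "G \<noteq> 0"
  define n where "n = subdegree G"
  have Gn: "fps_nth G n \<noteq> 0" using \<open>G \<noteq> 0\<close> by (simp add: n_def)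
  have low: "fps_nth G j = 0" if "j < n" for j
    using that unfolding n_def by (rule nth_less_subdegree_zero)
  \<comment> \<open>Coefficients are compared at index m = n - 1: \<open>A\<close> has no constant
    term, so A G'' and B G' both begin there, while C G begins only at index n.\<close>
  obtain m where m: "n = Suc m" using Gn G0 by (cases n) auto
  have "fps_nth (fps_of_poly A * fps_deriv (fps_deriv G)) m
      = (\<Sum>i=0..m. if i = 1 then a * (of_nat m * of_nat n * fps_nth G n) else 0)"
    unfolding fps_mult_nth
  proof (rule sum.cong)
    fix i assume "i \<in> {0..m}"
    show "fps_nth (fps_of_poly A) i * fps_nth (fps_deriv (fps_deriv G)) (m - i)
        = (if i = 1 then a * (of_nat m * of_nat n * fps_nth G n) else 0)"
    proof (cases "i \<le> 1")
      case True
      then consider "i = 0" | "i = 1" by linarith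
      then show ?thesis
      proof cases
        case 2
        with \<open>i \<in> {0..m}\<close> obtain k where "m = Suc k" by (cases m) auto
        with 2 show ?thesis using A m by (simp add: mult.assoc)
      qed (use A in simp)
    next
      case False
      then show ?thesis using \<open>i \<in> {0..m}\<close> by (simp add: low m)
    qed
  qed simp
  \<comment> \<open>For \<open>m = 0\<close> the index 1 lies outside the range of summation, and
    the factor \<open>of_nat m\<close> makes the right side vanish as well.\<close>
  also have "\<dots> = a * (of_nat m * of_nat n * fps_nth G n)"
    by (cases m) (auto simp: sum.delta)
  finally have 1: "fps_nth (fps_of_poly A * fps_deriv (fps_deriv G)) m
      = a * (of_nat m * of_nat n * fps_nth G n)" .
  have "fps_nth (fps_of_poly B * fps_deriv G) m
      = (\<Sum>i=0..m. if i = 0 then a * g * (of_nat n * fps_nth G n) else 0)"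
    unfolding fps_mult_nth
    by (intro sum.cong refl) (use B m low in auto)
  then have 2: "fps_nth (fps_of_poly B * fps_deriv G) m = a * g * (of_nat n * fps_nth G n)"
    by (simp add: sum.delta)
  have 3: "fps_nth (fps_of_poly C * G) m = 0"
    unfolding fps_mult_nth by (intro sum.neutral) (auto simp: low m)
  have "a * of_nat n * fps_nth G n * (of_nat m + g) = 0"
    using arg_cong[OF eq, of "\<lambda>f. fps_nth f m"] 1 2 3 by (simp add: algebra_simps)
  moreover have "of_nat n \<noteq> (0 :: complex)" unfolding m by (rule of_nat_neq_0)
  ultimately have "g = - of_nat m"
    using A Gn by (simp add: add_eq_0_iff)
  then show False using g by auto
qed

text \<open>After multiplication by \<open>A\<close> the left side of the equation is analytic at 0.
  It vanishes off 0, hence by continuity also at 0, and uniqueness of Taylor series turns this into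
  a formal identity, to which indicial arguments apply.\<close>

lemma punctured_solution_imp_fps_solution:
  fixes A B C :: "complex poly" and F :: "complex fps"
  assumes r: "fps_conv_radius F > 0"
    and sol: "\<forall>\<^sub>F x in at 0. deriv (deriv (eval_fps F)) x + p x * deriv (eval_fps F) x
                + q x * eval_fps F x = 0"
    and p: "\<forall>\<^sub>F x in at 0. poly A x * p x = poly B x"
    and q: "\<forall>\<^sub>F x in at 0. poly A x * q x = poly C x"
  shows "fps_of_poly A * fps_deriv (fps_deriv F) + fps_of_poly B * fps_deriv F
           + fps_of_poly C * F = 0" (is "?E = 0")
proof -
  define h where "h = (\<lambda>x. poly A x * deriv (deriv (eval_fps F)) x
    + poly B x * deriv (eval_fps F) x + poly C x * eval_fps F x)"
  have P: "poly X has_fps_expansion fps_of_poly X" for X :: "complex poly"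
    by (simp add: has_fps_expansion_def)
  have F: "eval_fps F has_fps_expansion F" using r by (rule eval_fps_has_fps_expansion)
  have h: "h has_fps_expansion ?E"
    unfolding h_def by (intro fps_expansion_intros P F)
  have h0: "\<forall>\<^sub>F x in at 0. h x = 0"
    using sol p q
  proof eventually_elim
    case (elim x)
    have "h x = poly A x * (deriv (deriv (eval_fps F)) x + p x * deriv (eval_fps F) x
                + q x * eval_fps F x)"
      unfolding h_def elim(2,3)[symmetric] by (simp add: algebra_simps)
    then show ?case using elim(1) by simp
  qed
  have "h \<midarrow>0\<rightarrow> h 0"
    using has_fps_expansion_imp_continuous[OF h, of UNIV] by (simp add: isCont_def)
  moreover have "h \<midarrow>0\<rightarrow> 0" by (rule tendsto_eventually) (rule h0)
  ultimately have "h 0 = 0" by (rule LIM_unique)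
  with h0 have "\<forall>\<^sub>F x in nhds 0. h x = 0"
    by (auto simp: eventually_at_filter elim: eventually_mono)
  then have "(\<lambda>_. 0) has_fps_expansion ?E"
    using h by (subst (asm) has_fps_expansion_cong) (auto elim: eventually_mono)
  then show ?thesis
    using fps_expansion_unique_complex has_fps_expansion_0 by blast
qed

text \<open>The difference of two candidates has constant term 0 and solves the same equation, so it
  vanishes by the indicial argument. Thus the definite description in
  \<open>analytic_solution\<close> is evaluated by exhibiting any one solution.\<close>

lemma analytic_solution_eqI:
  fixes A B C :: "complex poly" and F :: "complex fps"
  assumes A: "coeff A 0 = 0" "coeff A 1 = a" "a \<noteq> 0"
    and B: "coeff B 0 = a * g" and g: "g \<notin> \<int>\<^sub>\<le>\<^sub>0"
    and p: "\<forall>\<^sub>F x in at 0. poly A x * p x = poly B x"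
    and q: "\<forall>\<^sub>F x in at 0. poly A x * q x = poly C x"
    and F: "fps_conv_radius F > 0" "fps_nth F 0 = 1"
      "\<forall>\<^sub>F x in at 0. deriv (deriv (eval_fps F)) x + p x * deriv (eval_fps F) x
                + q x * eval_fps F x = 0"
  shows "analytic_solution p q = eval_fps F"
proof -
  have "G = F" if "fps_conv_radius G > 0" "fps_nth G 0 = 1"
      "\<forall>\<^sub>F x in at 0. deriv (deriv (eval_fps G)) x + p x * deriv (eval_fps G) x
                + q x * eval_fps G x = 0" for G
  proof -
    note eqs = punctured_solution_imp_fps_solution[OF F(1,3) p q]
      punctured_solution_imp_fps_solution[OF that(1,3) p q]
    have "G - F = 0"
    proof (rule regular_singular_fps_eq_0[OF A B g])
      show "fps_of_poly A * fps_deriv (fps_deriv (G - F)) + fps_of_poly B * fps_deriv (G - F)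
              + fps_of_poly C * (G - F) = 0"
        (is "?lhs = 0")
      proof -
        have "?lhs = (fps_of_poly A * fps_deriv (fps_deriv G) + fps_of_poly B * fps_deriv G
            + fps_of_poly C * G) - (fps_of_poly A * fps_deriv (fps_deriv F)
            + fps_of_poly B * fps_deriv F + fps_of_poly C * F)"
          by (simp only: fps_deriv_sub right_diff_distrib)
             (simp only: diff_conv_add_uminus minus_add_distrib add_ac)
        then show ?thesis using eqs by simp
      qed
    qed (simp add: F that)
    then show ?thesis by simp
  qed
  then show ?thesis
    unfolding analytic_solution_def
    by (intro arg_cong[of _ _ eval_fps] the_equality conjI F) blast
qed

section \<open>The Gauss series as the analytic solution of the hypergeometric equation\<close>

definition hypergeometric_fps :: "complex \<Rightarrow> complex \<Rightarrow> complex \<Rightarrow> complex fps" where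
  "hypergeometric_fps a b c =
     Abs_fps (\<lambda>n. pochhammer a n * pochhammer b n / (pochhammer c n * fact n))"

lemma hypergeometric_fps_recurrence:
  assumes "c \<notin> \<int>\<^sub>\<le>\<^sub>0"
  shows "(of_nat n + 1) * (c + of_nat n) * fps_nth (hypergeometric_fps a b c) (Suc n)
           = (a + of_nat n) * (b + of_nat n) * fps_nth (hypergeometric_fps a b c) n"
proof -
  have "pochhammer c n \<noteq> 0" "c + of_nat n \<noteq> 0"
    using assms by (auto simp: pochhammer_eq_0_iff add_eq_0_iff2)
  moreover have "1 + of_nat n \<noteq> (0 :: complex)" by (metis of_nat_Suc of_nat_neq_0)
  ultimately show ?thesis
    by (simp add: hypergeometric_fps_def pochhammer_Suc divide_simps)
qed

text \<open>The ratio of consecutive coefficients tends to 1, so it is eventually below 3/2, and at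
  the point 1/2 the terms shrink by the factor 3/4. The resulting lower bound 1/2 on the radius
  suffices, since only the germ at 0 matters.\<close>

lemma hypergeometric_fps_conv_radius:
  assumes c: "c \<notin> \<int>\<^sub>\<le>\<^sub>0"
  shows "fps_conv_radius (hypergeometric_fps a b c) > 0"
proof -
  define f where "f = fps_nth (hypergeometric_fps a b c)"
  define r where "r n = (a + of_nat n) * (b + of_nat n) / ((of_nat n + 1) * (c + of_nat n))"
    for n
  have ne: "c + of_nat n \<noteq> 0" "of_nat n + 1 \<noteq> (0::complex)" for n
    using c of_nat_neq_0[of n, where 'a = complex] by (auto simp: add_eq_0_iff2 add.commute)
  have f: "f (Suc n) = r n * f n" for n
    using hypergeometric_fps_recurrence[OF c, of n a b] ne[of n]
    by (simp add: f_def r_def divide_simps) (simp add: mult_ac)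
  have lim: "(\<lambda>n. (u + of_nat n) / (v + of_nat n)) \<longlonglongrightarrow> 1" for u v :: complex
  proof -
    have "(\<lambda>n. (u / of_nat n + 1) / (v / of_nat n + 1)) \<longlonglongrightarrow> (0 + 1) / (0 + 1)"
      by (intro tendsto_intros lim_const_over_n) simp
    moreover have "\<forall>\<^sub>F n in sequentially. (u / of_nat n + 1) / (v / of_nat n + 1)
        = (u + of_nat n) / (v + of_nat n)"
      using eventually_gt_at_top[of 0]
    proof eventually_elim
      case (elim n)
      then have "u / of_nat n + 1 = (u + of_nat n) / of_nat n"
        "v / of_nat n + 1 = (v + of_nat n) / of_nat n" by (simp_all add: add_divide_distrib)
      then show ?case using elim by simp
    qed
    ultimately show ?thesis by (auto intro: Lim_transform_eventually)
  qed
  have "(\<lambda>n. (a + of_nat n) / (1 + of_nat n) * ((b + of_nat n) / (c + of_nat n))) \<longlonglongrightarrow> 1 * 1"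
    by (intro tendsto_mult lim)
  then have "r \<longlonglongrightarrow> 1" by (simp add: r_def[abs_def] add.commute)
  then have "(\<lambda>n. norm (r n)) \<longlonglongrightarrow> 1" using tendsto_norm by fastforce
  then have "\<forall>\<^sub>F n in sequentially. norm (r n) < 3/2" by (rule order_tendstoD) simp
  then obtain N where N: "\<And>n. n \<ge> N \<Longrightarrow> norm (r n) < 3/2"
    unfolding eventually_sequentially by blast
  have "summable (\<lambda>n. f n * (1/2) ^ n)"
  proof (rule summable_ratio_test[of "3/4" N])
    fix n assume "N \<le> n"
    have "norm (r n) * (norm (f n) * (1/2)^n) \<le> 3/2 * (norm (f n) * (1/2)^n)"
      using N[OF \<open>N \<le> n\<close>] by (intro mult_right_mono) auto
    then show "norm (f (Suc n) * (1/2) ^ Suc n) \<le> 3/4 * norm (f n * (1/2) ^ n)"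
      by (simp add: f norm_mult norm_power norm_divide mult_ac)
  qed simp
  then have "conv_radius f \<ge> norm (1/2 :: complex)" by (rule conv_radius_geI)
  then show ?thesis unfolding fps_conv_radius_def f_def
    by (rule less_le_trans[rotated]) simp
qed

text \<open>This is the hypergeometric equation multiplied by z (z - 1); its coefficient at z^n is
  the two-term recurrence.\<close>

lemma hypergeometric_fps_solution:
  fixes a b c :: complex
  assumes c: "c \<notin> \<int>\<^sub>\<le>\<^sub>0"
  defines "F \<equiv> hypergeometric_fps a b c"
  shows "fps_of_poly [:0, -1, 1:] * fps_deriv (fps_deriv F)
           + fps_of_poly [:-c, a + b + 1:] * fps_deriv F + fps_of_poly [:a * b:] * F = 0"
proof (rule fps_ext)
  fix n
  have X2: "fps_of_poly [:p, q, r:] * G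
      = fps_const p * G + fps_X * (fps_const q * G + fps_X * (fps_const r * G))"
    and X1: "fps_of_poly [:p, q:] * G = fps_const p * G + fps_X * (fps_const q * G)"
    and X0: "fps_of_poly [:p:] * G = fps_const p * G"
    for G :: "complex fps" and p q r
    by (simp_all add: fps_of_poly_pCons algebra_simps)
  note X = X2[of 0 "-1" 1] X1[of "-c" "a + b + 1"] X0[of "a * b"]
  note R = hypergeometric_fps_recurrence[OF c, of _ a b, folded F_def]
  show "fps_nth (fps_of_poly [:0, -1, 1:] * fps_deriv (fps_deriv F)
      + fps_of_poly [:-c, a + b + 1:] * fps_deriv F + fps_of_poly [:a * b:] * F) n
      = fps_nth 0 n"
  proof -
    define x f g where "x = (of_nat n :: complex)" and "f = fps_nth F n" and "g = fps_nth F (Suc n)"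
    have 1: "fps_nth (fps_of_poly [:0, -1, 1:] * fps_deriv (fps_deriv F)) n
        = x * (x - 1) * f - x * (x + 1) * g"
    proof (cases n)
      case (Suc m)
      then show ?thesis
        unfolding X x_def f_def g_def
        by (cases m) simp_all
    qed (simp add: X x_def)
    have 2: "fps_nth (fps_of_poly [:-c, a + b + 1:] * fps_deriv F) n
        = (a + b + 1) * x * f - c * (x + 1) * g"
      unfolding X x_def f_def g_def by (cases n) simp_all
    have 3: "fps_nth (fps_of_poly [:a * b:] * F) n = a * b * f"
      unfolding X f_def by simp
    have "(x + 1) * (c + x) * g = (a + x) * (b + x) * f"
      using R[of n] unfolding x_def f_def g_def .
    then have "x * (x - 1) * f - x * (x + 1) * g + ((a + b + 1) * x * f - c * (x + 1) * g)
        + a * b * f = 0" by algebra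
    then show ?thesis by (simp add: 1 2 3)
  qed
qed

lemma F21_eq:
  fixes a b c :: complex
  assumes c: "c \<notin> \<int>\<^sub>\<le>\<^sub>0"
  defines "F \<equiv> hypergeometric_fps a b c"
  shows "F21 a b c = eval_fps F"
    and "\<forall>\<^sub>F x in at 0. deriv (deriv (eval_fps F)) x + hyp_p a b c x * deriv (eval_fps F) x
                + hyp_q a b x * eval_fps F x = 0"
proof -
  define A B C where "A = [:0, -1, 1 :: complex:]" and "B = [:-c, a + b + 1:]"
    and "C = [:a * b:]"
  have r: "fps_conv_radius F > 0" unfolding F_def by (rule hypergeometric_fps_conv_radius[OF c])
  have P: "poly X has_fps_expansion fps_of_poly X" for X :: "complex poly"
    by (simp add: has_fps_expansion_def)
  have F: "eval_fps F has_fps_expansion F" using r by (rule eval_fps_has_fps_expansion)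
  have "(\<lambda>x. poly A x * deriv (deriv (eval_fps F)) x
    + poly B x * deriv (eval_fps F) x + poly C x * eval_fps F x) has_fps_expansion
      (fps_of_poly A * fps_deriv (fps_deriv F) + fps_of_poly B * fps_deriv F
           + fps_of_poly C * F)" (is "?h has_fps_expansion _")
    by (intro fps_expansion_intros P F)
  then have "?h has_fps_expansion 0"
    using hypergeometric_fps_solution[OF c, of a b] unfolding A_def B_def C_def F_def by simp
  then have h: "\<forall>\<^sub>F x in at 0. ?h x = 0"
    by (auto simp: has_fps_expansion_def eventually_at_filter elim: eventually_mono)
  have ne: "\<forall>\<^sub>F x in at 0. x \<noteq> 0 \<and> x \<noteq> (1::complex)"
    by (intro eventually_conj eventually_neq_at_within)
  have PA: "poly A x = x * (x - 1)" for x by (simp add: A_def algebra_simps)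
  have p: "\<forall>\<^sub>F x in at 0. poly A x * hyp_p a b c x = poly B x"
    using ne
  proof eventually_elim
    case (elim x)
    then have "x * (x - 1) * (c / x) = c * (x - 1)"
      "x * (x - 1) * ((a + b - c + 1) / (x - 1)) = (a + b - c + 1) * x" by simp_all
    then show ?case by (simp add: PA hyp_p_def B_def ring_distribs)
  qed
  have q: "\<forall>\<^sub>F x in at 0. poly A x * hyp_q a b x = poly C x"
    using ne by eventually_elim (simp add: PA C_def hyp_q_def)
  show sol: "\<forall>\<^sub>F x in at 0. deriv (deriv (eval_fps F)) x + hyp_p a b c x * deriv (eval_fps F) x
                + hyp_q a b x * eval_fps F x = 0"
    using h p q ne
  proof eventually_elim
    case (elim x)
    have "poly A x * (deriv (deriv (eval_fps F)) x + hyp_p a b c x * deriv (eval_fps F) x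
                + hyp_q a b x * eval_fps F x) = 0"
      using elim(1) unfolding elim(2,3)[symmetric] by (simp add: algebra_simps)
    moreover have "poly A x \<noteq> 0" using elim(4) by (simp add: A_def)
    ultimately show ?case by simp
  qed
  \<comment> \<open>z (z - 1) has linear coefficient -1 and the coefficient of the first derivative
    has value -c at 0, so the indicial parameter \<open>g\<close> is c.\<close>
  show "F21 a b c = eval_fps F"
    unfolding F21_def
    by (rule analytic_solution_eqI[OF _ _ _ _ c p q r _ sol, where a = "-1"])
       (simp_all add: A_def B_def F_def hypergeometric_fps_def)
qed

text \<open>The function F(R(t)) is analytic at 0 with value 1 because R(0) = 0, and by the chain
  rule it solves the pulled back equation, which is the Heun equation. Uniqueness at the regular
  singular point t = 0 identifies it with \<open>Hl\<close>.\<close>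

lemma Hl_eq_F21_comp:
  fixes R :: "complex poly"
  assumes d: "d \<noteq> 0" and \<gamma>: "\<gamma> \<notin> \<int>\<^sub>\<le>\<^sub>0" and c: "c \<notin> \<int>\<^sub>\<le>\<^sub>0"
    and R: "poly R 0 = 0" "degree R > 0"
    and red: "equation_reduction d q \<alpha> \<beta> \<gamma> \<delta> (\<alpha> + \<beta> - \<gamma> - \<delta> + 1) a b c (poly R)"
  shows "\<forall>\<^sub>F t in nhds 0. Hl d q \<alpha> \<beta> \<gamma> \<delta> t = F21 a b c (poly R t)"
proof -
  define \<epsilon> where "\<epsilon> = \<alpha> + \<beta> - \<gamma> - \<delta> + 1"
  define F where "F = hypergeometric_fps a b c"
  have F21: "F21 a b c = eval_fps F" unfolding F_def by (rule F21_eq(1)[OF c])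
  have r: "fps_conv_radius F > 0" unfolding F_def by (rule hypergeometric_fps_conv_radius[OF c])
  have sol: "\<forall>\<^sub>F x in at 0. deriv (deriv (eval_fps F)) x + hyp_p a b c x * deriv (eval_fps F) x
                + hyp_q a b x * eval_fps F x = 0"
    unfolding F_def by (rule F21_eq(2)[OF c])
  define u where "u = (\<lambda>t. eval_fps F (poly R t))"
  define G where "G = fps_compose F (fps_of_poly R)"
  have PR: "poly R has_fps_expansion fps_of_poly R"
    by (simp add: has_fps_expansion_def)
  have R0: "R \<noteq> 0" "pderiv R \<noteq> 0" using R(2) by (auto simp: pderiv_eq_0_iff)
  have G: "u has_fps_expansion G"
    unfolding u_def G_def
    using has_fps_expansion_compose[OF eval_fps_has_fps_expansion[OF r] PR] R(1)
    by (simp add: o_def poly_0_coeff_0)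
  have rG: "fps_conv_radius G > 0" and Gu: "\<forall>\<^sub>F t in nhds 0. eval_fps G t = u t"
    using G by (auto simp: has_fps_expansion_def)
  have inD: "\<forall>\<^sub>F t in nhds 0. poly R t \<in> eball 0 (fps_conv_radius F)"
  proof -
    have "isCont (poly R) 0" by simp
    then have "(poly R \<longlongrightarrow> 0) (nhds 0)"
      using R(1) by (simp add: continuous_at_imp_continuous_at_within isCont_def tendsto_nhds_iff)
    then show ?thesis using r by (intro topological_tendstoD) (auto simp: zero_ereal_def)
  qed
  have du: "\<forall>\<^sub>F t in nhds 0. deriv u t = eval_fps (fps_deriv F) (poly R t) * poly (pderiv R) t"
    using inD
  proof eventually_elim
    case (elim t)
    show ?case unfolding u_def
      by (rule DERIV_imp_deriv)
         (rule DERIV_chain2[OF has_field_derivative_eval_fps poly_DERIV], use elim in simp)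
  qed
  \<comment> \<open>Differentiating the formula \<open>du\<close> at t requires it on a whole
    neighborhood of t; \<open>eventually_eventually\<close> provides this.\<close>
  have ddu: "\<forall>\<^sub>F t in nhds 0. deriv (deriv u) t
     = eval_fps (fps_deriv (fps_deriv F)) (poly R t) * (poly (pderiv R) t)\<^sup>2
       + eval_fps (fps_deriv F) (poly R t) * poly (pderiv (pderiv R)) t"
    using inD du[THEN eventually_eventually[THEN iffD2]]
  proof eventually_elim
    case (elim t)
    have lt: "norm (poly R t) < fps_conv_radius (fps_deriv F)"
      using elim(1) fps_conv_radius_deriv[of F] by (auto intro: less_le_trans)
    have "deriv (deriv u) t
        = deriv (\<lambda>t. eval_fps (fps_deriv F) (poly R t) * poly (pderiv R) t) t"
      using elim(2) by (intro deriv_cong_ev) auto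
    also have "\<dots> = eval_fps (fps_deriv (fps_deriv F)) (poly R t) * (poly (pderiv R) t)\<^sup>2
       + eval_fps (fps_deriv F) (poly R t) * poly (pderiv (pderiv R)) t"
      by (rule DERIV_imp_deriv)
         (rule DERIV_cong[OF DERIV_mult[OF DERIV_chain2[OF has_field_derivative_eval_fps[OF lt]
            poly_DERIV] poly_DERIV]], simp add: power2_eq_square algebra_simps)
    finally show ?case .
  qed
  \<comment> \<open>The equation for \<open>F\<close> is available only off 0, so R(t) must stay
    away from 0 for t near 0 and different from 0.\<close>
  have Rlim: "filterlim (poly R) (at 0) (at 0)"
  proof -
    have "\<forall>\<^sub>F t in at 0. poly R t \<noteq> 0"
      by (intro cofinite_imp_at poly_nonzero_cofinite R0)
    moreover have "poly R \<midarrow>0\<rightarrow> 0" using R(1) isCont_def[of "0::complex" "poly R"] by simp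
    ultimately show ?thesis by (simp add: filterlim_at)
  qed
  have cof: "\<forall>\<^sub>F t in at 0. P t" if "\<forall>\<^sub>F t in cofinite. P t" for P :: "complex \<Rightarrow> bool"
    using that cofinite_imp_at by blast
  have R'ne: "\<forall>\<^sub>F t in at 0. poly (pderiv R) t \<noteq> 0"
    by (intro cofinite_imp_at poly_nonzero_cofinite R0)
  \<comment> \<open>The equation is restated with formal derivatives, which are what the chain rule
    for F(R(t)) produces.\<close>
  have sol': "\<forall>\<^sub>F x in at 0. norm x < fps_conv_radius F \<longrightarrow>
      eval_fps (fps_deriv (fps_deriv F)) x + hyp_p a b c x * eval_fps (fps_deriv F) x
        + hyp_q a b x * eval_fps F x = 0"
    using sol
  proof eventually_elim
    case (elim x)
    show ?case
    proof
      assume x: "norm x < fps_conv_radius F"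
      have lt: "norm x < fps_conv_radius (fps_deriv F)"
        using x fps_conv_radius_deriv[of F] by (auto intro: less_le_trans)
      have "\<forall>\<^sub>F w in nhds x. w \<in> eball 0 (fps_conv_radius F)"
        using x by (intro eventually_nhds_in_open) auto
      then have "\<forall>\<^sub>F w in nhds x. deriv (eval_fps F) w = eval_fps (fps_deriv F) w"
        by eventually_elim (simp add: eval_fps_deriv)
      then have "deriv (deriv (eval_fps F)) x = deriv (eval_fps (fps_deriv F)) x"
        by (intro deriv_cong_ev) auto
      then show "eval_fps (fps_deriv (fps_deriv F)) x + hyp_p a b c x * eval_fps (fps_deriv F) x
        + hyp_q a b x * eval_fps F x = 0"
        using elim by (simp add: eval_fps_deriv[OF lt] eval_fps_deriv[OF x])
    qed
  qed
  have nhds_at: "\<forall>\<^sub>F t in at 0. P t" if "\<forall>\<^sub>F t in nhds 0. P t" for P :: "complex \<Rightarrow> bool"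
    using that by (auto simp: eventually_at_filter elim: eventually_mono)
  have Gd: "\<forall>\<^sub>F t in nhds 0. deriv (eval_fps G) t = deriv u t"
    using Gu[THEN eventually_eventually[THEN iffD2]]
    by eventually_elim (auto intro: deriv_cong_ev)
  have Gdd: "\<forall>\<^sub>F t in nhds 0. deriv (deriv (eval_fps G)) t = deriv (deriv u) t"
    using Gd[THEN eventually_eventually[THEN iffD2]]
    by eventually_elim (auto intro: deriv_cong_ev)
  have Gsol: "\<forall>\<^sub>F t in at 0. deriv (deriv (eval_fps G)) t
      + heun_p d \<gamma> \<delta> \<epsilon> t * deriv (eval_fps G) t + heun_q d q \<alpha> \<beta> t * eval_fps G t = 0"
    using filterlim_iff[THEN iffD1, OF Rlim, rule_format, OF sol'] R'ne
      cof[OF red[unfolded equation_reduction_def deriv_poly]]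
      nhds_at[OF Gu] nhds_at[OF Gd] nhds_at[OF Gdd] nhds_at[OF inD] nhds_at[OF du] nhds_at[OF ddu]
  proof eventually_elim
    case (elim t)
    define y y1 y2 where "y = eval_fps F (poly R t)" and "y1 = eval_fps (fps_deriv F) (poly R t)"
      and "y2 = eval_fps (fps_deriv (fps_deriv F)) (poly R t)"
    define r1 r2 hp hq where "r1 = poly (pderiv R) t" and "r2 = poly (pderiv (pderiv R)) t"
      and "hp = hyp_p a b c (poly R t)" and "hq = hyp_q a b (poly R t)"
    have 1: "y2 = - hp * y1 - hq * y"
    proof -
      have "y2 + hp * y1 + hq * y = 0"
        using elim(1,7) by (simp add: y_def y1_def y2_def hp_def hq_def)
      then show ?thesis by algebra
    qed
    have 2: "heun_p d \<gamma> \<delta> \<epsilon> t = hp * r1 - r2 / r1" "heun_q d q \<alpha> \<beta> t = hq * r1\<^sup>2"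
      using elim(3) by (simp_all add: \<epsilon>_def hp_def hq_def r1_def r2_def)
    have "r1 \<noteq> 0" using elim(2) by (simp add: r1_def)
    have "deriv (deriv (eval_fps G)) t
      + heun_p d \<gamma> \<delta> \<epsilon> t * deriv (eval_fps G) t + heun_q d q \<alpha> \<beta> t * eval_fps G t
      = (y2 * r1\<^sup>2 + y1 * r2) + (hp * r1 - r2 / r1) * (y1 * r1) + hq * r1\<^sup>2 * y"
      unfolding 2 elim(4,5,6,8,9) by (simp add: y_def y1_def y2_def r1_def r2_def u_def)
    also have "(hp * r1 - r2 / r1) * (y1 * r1) = hp * y1 * r1\<^sup>2 - r2 * y1"
      using \<open>r1 \<noteq> 0\<close> by (simp add: left_diff_distrib power2_eq_square)
    also have "(y2 * r1\<^sup>2 + y1 * r2) + (hp * y1 * r1\<^sup>2 - r2 * y1) + hq * r1\<^sup>2 * y = 0"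
      unfolding 1 by algebra
    finally show ?case .
  qed
  have ne: "\<forall>\<^sub>F x in at 0. x \<noteq> 0 \<and> x \<noteq> 1 \<and> x \<noteq> d"
    by (intro eventually_conj eventually_neq_at_within)
  define A B C where "A = [:0, 1:] * [:-1, 1:] * [:-d, 1:]"
    and "B = smult \<gamma> ([:-1, 1:] * [:-d, 1:]) + smult \<delta> ([:0, 1:] * [:-d, 1:])
           + smult \<epsilon> ([:0, 1:] * [:-1, 1:])"
    and "C = [:-q, \<alpha> * \<beta>:]"
  have PA: "poly A x = x * (x - 1) * (x - d)" for x by (simp add: A_def algebra_simps)
  have p: "\<forall>\<^sub>F x in at 0. poly A x * heun_p d \<gamma> \<delta> \<epsilon> x = poly B x"
    using ne
  proof eventually_elim
    case (elim x)
    then have "x * (x - 1) * (x - d) * (\<gamma> / x) = \<gamma> * ((x - 1) * (x - d))"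
      "x * (x - 1) * (x - d) * (\<delta> / (x - 1)) = \<delta> * (x * (x - d))"
      "x * (x - 1) * (x - d) * (\<epsilon> / (x - d)) = \<epsilon> * (x * (x - 1))" by simp_all
    then have "poly A x * heun_p d \<gamma> \<delta> \<epsilon> x
        = \<gamma> * ((x - 1) * (x - d)) + \<delta> * (x * (x - d)) + \<epsilon> * (x * (x - 1))"
      by (simp only: PA heun_p_def distrib_left)
    also have "\<dots> = poly B x" by (simp add: B_def algebra_simps)
    finally show ?case .
  qed
  have q: "\<forall>\<^sub>F x in at 0. poly A x * heun_q d q \<alpha> \<beta> x = poly C x"
    using ne by eventually_elim (simp add: PA C_def heun_q_def mult.commute)
  have G0: "fps_nth G 0 = 1" by (simp add: G_def F_def hypergeometric_fps_def)
  \<comment> \<open>The linear coefficient of t (t - 1) (t - d) is d, and \<open>B\<close> has value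
    \<gamma> d at 0, so the indicial parameter is \<gamma>.\<close>
  have "Hl d q \<alpha> \<beta> \<gamma> \<delta> = eval_fps G"
    unfolding Hl_def \<epsilon>_def[symmetric]
    by (rule analytic_solution_eqI[OF _ _ _ _ \<gamma> p q rG G0 Gsol, where a = d])
       (use d in \<open>simp_all add: A_def B_def\<close>)
  then show ?thesis using Gu by (simp add: F21 u_def)
qed

section \<open>Orders and residues of a reduction\<close>

lemma order_linear: "order z [:-w, 1:] = (if z = w then 1 else 0)" for z w :: "'a::idom"
  using order_power_n_n[of w 1] by (auto intro!: order_0I)

text \<open>With p = (x - z)^k g and g(z) nonzero, (x - z) p'/p equals k + (x - z) g'/g near
  z.\<close>

lemma log_deriv_residue:
  fixes p :: "complex poly"
  assumes "p \<noteq> 0"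
  shows "((\<lambda>x. (x - z) * (poly (pderiv p) x / poly p x)) \<longlongrightarrow> of_nat (order z p)) (at z)"
proof -
  define k where "k = order z p"
  obtain g where p: "p = [:-z, 1:] ^ k * g" and "\<not> [:-z, 1:] dvd g"
    using order_decomp[OF assms, of z] unfolding k_def by blast
  then have g: "poly g z \<noteq> 0" by (simp add: poly_eq_0_iff_dvd)
  have "((\<lambda>x. of_nat k + (x - z) * (poly (pderiv g) x / poly g x)) \<longlongrightarrow>
      of_nat k + (z - z) * (poly (pderiv g) z / poly g z)) (at z)"
    by (intro tendsto_intros g)
  moreover have "\<forall>\<^sub>F x in at z. of_nat k + (x - z) * (poly (pderiv g) x / poly g x)
      = (x - z) * (poly (pderiv p) x / poly p x)"
  proof -
    have "g \<noteq> 0" using g by auto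
    then have "\<forall>\<^sub>F x in at z. poly g x \<noteq> 0"
      by (intro cofinite_imp_at poly_nonzero_cofinite)
    moreover have "\<forall>\<^sub>F x in at z. x \<noteq> z" by (simp add: eventually_at_filter)
    ultimately show ?thesis
    proof eventually_elim
      case (elim x)
      have px: "poly p x = (x - z) ^ k * poly g x" by (simp add: p)
      have "(x - z) * poly (pderiv p) x
          = (x - z) ^ k * (of_nat k * poly g x + (x - z) * poly (pderiv g) x)"
        unfolding p pderiv_mult pderiv_power
        by (cases k) (simp_all add: pderiv_pCons algebra_simps del: mult_pCons_left mult_pCons_right)
      moreover have "of_nat k + (x - z) * (poly (pderiv g) x / poly g x)
          = (of_nat k * poly g x + (x - z) * poly (pderiv g) x) / poly g x"
        using elim by (simp add: add_divide_distrib)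
      ultimately show ?case using elim by (simp add: px)
    qed
  qed
  ultimately show ?thesis by (simp add: k_def Lim_transform_eventually)
qed

lemma partial_fraction_residue:
  "((\<lambda>x. (x - z) * (g / (x - w))) \<longlongrightarrow> (if z = w then g else 0)) (at z)" for z w g :: complex
proof (cases "z = w")
  case True
  have "\<forall>\<^sub>F x in at z. (x - z) * (g / (x - w)) = g"
    by (simp add: eventually_at_filter True)
  then have "((\<lambda>x. (x - z) * (g / (x - w))) \<longlongrightarrow> g) (at z)" by (rule tendsto_eventually)
  then show ?thesis by (simp only: True if_True refl)
next
  case False
  have "((\<lambda>x. (x - z) * (g / (x - w))) \<longlongrightarrow> (z - z) * (g / (z - w))) (at z)"
    by (intro tendsto_intros) (use False in auto)
  then show ?thesis using False by simp
qed

text \<open>For polynomial R the pulled back coefficient of u' is a combination of the logarithmic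
  derivatives of R, R - 1 and R', so its residues are orders of vanishing weighted by the exponent
  parameters. The Heun coefficient is already in partial fractions; limits of (x - z) times both
  sides are equated.\<close>

lemma reduction_exponents:
  fixes R :: "complex poly"
  assumes deg: "degree R > 0"
    and red: "equation_reduction d q \<alpha> \<beta> \<gamma> \<delta> \<epsilon> a b c (poly R)"
  shows "c * of_nat (order z R) + (a + b - c + 1) * of_nat (order z (R - 1))
           - of_nat (order z (pderiv R))
         = (if z = 0 then \<gamma> else 0) + (if z = 1 then \<delta> else 0) + (if z = d then \<epsilon> else 0)"
proof -
  have ne: "R \<noteq> 0" "pderiv R \<noteq> 0" "R - 1 \<noteq> 0"
    using deg by (auto simp: pderiv_eq_0_iff)
  have R1: "pderiv (R - 1) = pderiv R" by (simp add: pderiv_diff)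
  let ?f = "\<lambda>x. (x - z) * (hyp_p a b c (poly R x) * deriv (poly R) x
     - deriv (deriv (poly R)) x / deriv (poly R) x)"
  have "((\<lambda>x. c * ((x - z) * (poly (pderiv R) x / poly R x))
     + (a + b - c + 1) * ((x - z) * (poly (pderiv (R - 1)) x / poly (R - 1) x))
     - (x - z) * (poly (pderiv (pderiv R)) x / poly (pderiv R) x)) \<longlongrightarrow>
     c * of_nat (order z R) + (a + b - c + 1) * of_nat (order z (R - 1))
           - of_nat (order z (pderiv R))) (at z)"
    by (intro tendsto_intros log_deriv_residue ne)
  also have "(\<lambda>x. c * ((x - z) * (poly (pderiv R) x / poly R x))
     + (a + b - c + 1) * ((x - z) * (poly (pderiv (R - 1)) x / poly (R - 1) x))
     - (x - z) * (poly (pderiv (pderiv R)) x / poly (pderiv R) x)) = ?f"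
    unfolding R1 by (intro ext) (simp add: hyp_p_def deriv_poly ring_distribs mult_ac)
  finally have 1: "(?f \<longlongrightarrow> c * of_nat (order z R) + (a + b - c + 1) * of_nat (order z (R - 1))
           - of_nat (order z (pderiv R))) (at z)" .
  have "((\<lambda>x. (x - z) * (\<gamma> / (x - 0)) + (x - z) * (\<delta> / (x - 1)) + (x - z) * (\<epsilon> / (x - d)))
     \<longlongrightarrow> (if z = 0 then \<gamma> else 0) + (if z = 1 then \<delta> else 0) + (if z = d then \<epsilon> else 0)) (at z)"
    by (intro tendsto_add partial_fraction_residue)
  moreover have "\<forall>\<^sub>F x in at z. (x - z) * (\<gamma> / (x - 0)) + (x - z) * (\<delta> / (x - 1))
      + (x - z) * (\<epsilon> / (x - d)) = ?f x"
    using cofinite_imp_at[OF red[unfolded equation_reduction_def]]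
    by eventually_elim (simp add: heun_p_def ring_distribs)
  ultimately have "(?f \<longlongrightarrow> (if z = 0 then \<gamma> else 0) + (if z = 1 then \<delta> else 0)
      + (if z = d then \<epsilon> else 0)) (at z)"
    by (rule Lim_transform_eventually)
  with 1 show ?thesis by (intro LIM_unique)
qed

section \<open>Comparison of the coefficients of u\<close>

definition singular_poly :: "complex \<Rightarrow> complex poly" where
  "singular_poly d = [:0, 1:] * [:-1, 1:] * [:-d, 1:]"

lemma poly_singular_poly [simp]: "poly (singular_poly d) t = t * (t - 1) * (t - d)"
  by (simp add: singular_poly_def algebra_simps)

lemma singular_poly_nonzero [simp]: "singular_poly d \<noteq> 0"
  by (simp add: singular_poly_def)

lemma degree_singular_poly: "degree (singular_poly d) = 3"
  by (simp add: singular_poly_def)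

lemma order_singular_poly:
  assumes "d \<notin> {0, 1}"
  shows "order z (singular_poly d) = (if z \<in> {0, 1, d} then 1 else 0)"
proof -
  have "singular_poly d = [:-0, 1:] * ([:-1, 1:] * [:-d, 1:])"
    by (simp add: singular_poly_def)
  then have "order z (singular_poly d) = order z [:-0, 1:] + (order z [:-1, 1:] + order z [:-d, 1:])"
    by (simp only:) (subst order_mult, simp, subst order_mult, simp, rule refl)
  then show ?thesis using assms unfolding order_linear by auto
qed

lemma poly_eq_if_eq_cofinite:
  fixes p q :: "'a :: {idom, ring_char_0} poly"
  assumes "\<forall>\<^sub>F t in cofinite. poly p t = poly q t"
  shows "p = q"
proof (rule ccontr)
  assume "p \<noteq> q"
  then have "finite {t. poly (p - q) t = 0}" by (intro poly_roots_finite) simp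
  moreover have "finite {t. poly (p - q) t \<noteq> 0}"
    using assms by (simp add: eventually_cofinite)
  ultimately have "finite ({t. poly (p - q) t = 0} \<union> {t. poly (p - q) t \<noteq> 0})" by blast
  moreover have "{t. poly (p - q) t = 0} \<union> {t. poly (p - q) t \<noteq> 0} = UNIV" by auto
  ultimately show False using infinite_UNIV_char_0[where 'a = 'a] by (simp only:)
qed

text \<open>With W = P' Q - P Q' the derivative of P/Q is W/Q^2, and the hypergeometric coefficient
  at P/Q is a b Q^2/(P (P - Q)). Clearing denominators gives an equality at all but finitely many
  points, hence one of polynomials.\<close>

lemma reduction_poly_identity:
  fixes P Q :: "complex poly"
  assumes cop: "coprime P Q" and deg: "degree P > 0 \<or> degree Q > 0"
    and red: "equation_reduction d q \<alpha> \<beta> \<gamma> \<delta> \<epsilon> a b c (\<lambda>t. poly P t / poly Q t)"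
  shows "smult (a * b) ((pderiv P * Q - P * pderiv Q)\<^sup>2) * singular_poly d
           = [:-q, \<alpha> * \<beta>:] * Q\<^sup>2 * P * (P - Q)"
    and "P \<noteq> 0" "Q \<noteq> 0" "P - Q \<noteq> 0"
proof -
  show ne: "P \<noteq> 0" "Q \<noteq> 0" "P - Q \<noteq> 0"
    using cop deg by (auto simp: is_unit_iff_degree)
      (metis is_unit_iff_degree less_numeral_extra(3) degree_0)+
  show "smult (a * b) ((pderiv P * Q - P * pderiv Q)\<^sup>2) * singular_poly d
           = [:-q, \<alpha> * \<beta>:] * Q\<^sup>2 * P * (P - Q)"
  proof (rule poly_eq_if_eq_cofinite)
    have fin: "\<forall>\<^sub>F t in cofinite. t \<noteq> w" for w :: complex
      by (simp add: eventually_cofinite)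
    show "\<forall>\<^sub>F t in cofinite. poly (smult (a * b) ((pderiv P * Q - P * pderiv Q)\<^sup>2) * singular_poly d) t
        = poly ([:-q, \<alpha> * \<beta>:] * Q\<^sup>2 * P * (P - Q)) t"
      using red[unfolded equation_reduction_def] fin[of 0] fin[of 1] fin[of d]
        poly_nonzero_cofinite[OF ne(1)] poly_nonzero_cofinite[OF ne(2)] poly_nonzero_cofinite[OF ne(3)]
    proof eventually_elim
      case (elim t)
      define p r w where "p = poly P t" and "r = poly Q t"
        and "w = poly (pderiv P) t * r - p * poly (pderiv Q) t"
      have nz: "p \<noteq> 0" "r \<noteq> 0" "p - r \<noteq> 0" using elim by (simp_all add: p_def r_def)
      have "deriv (\<lambda>t. poly P t / poly Q t) t = w / r\<^sup>2"
        using nz by (intro DERIV_imp_deriv)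
          (auto intro!: derivative_eq_intros simp: w_def p_def r_def power2_eq_square)
      then have "hyp_q a b (p / r) * (w / r\<^sup>2)\<^sup>2 = heun_q d q \<alpha> \<beta> t"
        using elim(1) by (simp add: p_def r_def)
      moreover have "hyp_q a b (p / r) = a * b * r\<^sup>2 / (p * (p - r))"
      proof -
        have "p / r * (p / r - 1) = p * (p - r) / r\<^sup>2"
          using nz by (simp add: field_simps power2_eq_square)
        then show ?thesis by (simp add: hyp_q_def)
      qed
      ultimately have "a * b * w\<^sup>2 / (p * (p - r) * r\<^sup>2) = heun_q d q \<alpha> \<beta> t"
        using nz by (simp add: power2_eq_square field_simps)
      moreover define x where "x = t * (t - 1) * (t - d)"
      ultimately have "a * b * w\<^sup>2 / (p * (p - r) * r\<^sup>2) = (\<alpha> * \<beta> * t - q) / x"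
        by (simp add: heun_q_def)
      moreover have "x \<noteq> 0" using elim by (simp add: x_def)
      ultimately have "a * b * w\<^sup>2 * x = (\<alpha> * \<beta> * t - q) * (p * (p - r) * r\<^sup>2)"
        using nz by (simp add: frac_eq_eq)
      then show ?case
        unfolding w_def p_def r_def x_def by (simp add: power2_eq_square algebra_simps)
    qed
  qed
qed

lemma heun_numerator_nonzero:
  "nontrivial q \<alpha> \<beta> \<Longrightarrow> [:-q, \<alpha> * \<beta>:] \<noteq> 0"
  by (auto simp: nontrivial_def)

text \<open>Let z be a pole of order k. In W = P' Q - P Q' the second product has order exactly k -
  1 and the first at least k, so W has order at most k - 1. The left side of the polynomial identity
  then has order at most 2 (k - 1) + 1, but Q^2 on the right contributes 2 k.\<close>

lemma rational_reduction_denominator: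
  fixes P Q :: "complex poly"
  assumes d: "d \<notin> {0, 1}" and nt: "nontrivial q \<alpha> \<beta>"
    and cop: "coprime P Q" and deg: "degree P > 0 \<or> degree Q > 0"
    and red: "equation_reduction d q \<alpha> \<beta> \<gamma> \<delta> \<epsilon> a b c (\<lambda>t. poly P t / poly Q t)"
  shows "degree Q = 0"
proof (rule ccontr)
  assume "degree Q \<noteq> 0"
  then obtain z where z: "poly Q z = 0"
    using alg_closed_imp_poly_has_root[of Q] by auto
  note id = reduction_poly_identity[OF cop deg red]
  have Pz: "poly P z \<noteq> 0"
    using cop z by (metis coprime_poly_0)
  then have ordP: "order z P = 0" "order z (P - Q) = 0" using z by (simp_all add: order_0I)
  define k where "k = order z Q"
  have k: "k = Suc (order z (pderiv Q))"
    unfolding k_def using id z by (intro order_pderiv)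
  define W where "W = pderiv P * Q - P * pderiv Q"
  have L: "[:-q, \<alpha> * \<beta>:] \<noteq> 0" using nt by (rule heun_numerator_nonzero)
  have ne: "[:-q, \<alpha> * \<beta>:] * Q\<^sup>2 * P * (P - Q) \<noteq> 0"
    using L id by (simp only: mult_eq_0_iff power_eq_0_iff) auto
  then have ab: "a * b \<noteq> 0" and W0: "W \<noteq> 0" using id(1) by (auto simp: W_def)
  have "order z W \<le> k - 1"
  proof (rule ccontr)
    assume "\<not> order z W \<le> k - 1"
    then have "[:-z, 1:] ^ k dvd W" unfolding order_divides by linarith
    moreover have "[:-z, 1:] ^ k dvd pderiv P * Q"
      by (intro dvd_mult) (simp add: order_divides k_def)
    ultimately have "[:-z, 1:] ^ k dvd pderiv P * Q - W" by (rule dvd_diff[rotated])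
    then have "[:-z, 1:] ^ k dvd P * pderiv Q" by (simp add: W_def)
    moreover have "P * pderiv Q \<noteq> 0"
      using id(2) \<open>degree Q \<noteq> 0\<close> by (simp add: pderiv_eq_0_iff)
    ultimately have "k \<le> order z P + order z (pderiv Q)"
      by (simp add: order_divides order_mult)
    then show False using k ordP by simp
  qed
  moreover have "2 * order z W + order z (singular_poly d) \<ge> 2 * k"
  proof -
    have "2 * order z W + order z (singular_poly d)
        = order z (smult (a * b) (W\<^sup>2) * singular_poly d)"
      using ab W0 by (simp add: order_mult order_smult power2_eq_square)
    also have "\<dots> = order z ([:-q, \<alpha> * \<beta>:] * Q\<^sup>2 * P * (P - Q))"
      using id(1) by (simp add: W_def)
    also have "\<dots> \<ge> 2 * k"
      using ne by (simp add: order_mult power2_eq_square k_def del: mult_pCons_left)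
    finally show ?thesis .
  qed
  ultimately show False using k order_singular_poly[OF d, of z] by (auto split: if_splits)
qed

text \<open>Both claims come from the polynomial identity with Q = 1. For n = deg R the degrees are
  2 (n - 1) + 3 on the left and 2 n plus that of \<alpha>\<beta> t - q on the right, so this factor
  is genuinely linear and its root \<tau> exists; the second claim equates orders at z.\<close>

lemma polynomial_reduction_orders:
  fixes R :: "complex poly"
  assumes d: "d \<notin> {0, 1}" and nt: "nontrivial q \<alpha> \<beta>" and deg: "degree R > 0"
    and red: "equation_reduction d q \<alpha> \<beta> \<gamma> \<delta> \<epsilon> a b c (poly R)"
  shows "\<alpha> * \<beta> \<noteq> 0"
    and "2 * order z (pderiv R) + (if z \<in> {0, 1, d} then 1 else 0)
           = (if z = q / (\<alpha> * \<beta>) then 1 else 0) + order z R + order z (R - 1)"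
proof -
  have id: "smult (a * b) ((pderiv R)\<^sup>2) * singular_poly d = [:-q, \<alpha> * \<beta>:] * R * (R - 1)"
    and ne0: "R \<noteq> 0" "R - 1 \<noteq> 0"
    using reduction_poly_identity[of R 1 d q \<alpha> \<beta> \<gamma> \<delta> \<epsilon> a b c] deg red by simp_all
  have dR1: "degree (R - 1) = degree R"
    using degree_add_eq_left[of "-1" R] deg by simp
  have ne: "[:-q, \<alpha> * \<beta>:] * R * (R - 1) \<noteq> 0"
    using heun_numerator_nonzero[OF nt] ne0 by (simp only: mult_eq_0_iff) auto
  then have ab: "a * b \<noteq> 0" and R': "pderiv R \<noteq> 0" using id by auto
  have "degree (smult (a * b) ((pderiv R)\<^sup>2) * singular_poly d) = 2 * (degree R - 1) + 3"
    using ab R' by (simp add: degree_mult_eq degree_power_eq degree_singular_poly degree_pderiv)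
  moreover have "degree ([:-q, \<alpha> * \<beta>:] * R * (R - 1)) = degree [:-q, \<alpha> * \<beta>:] + 2 * degree R"
    using heun_numerator_nonzero[OF nt] ne0 dR1 by (simp add: degree_mult_eq del: mult_pCons_left)
  ultimately have "degree [:-q, \<alpha> * \<beta>:] + 2 * degree R = 2 * (degree R - 1) + 3"
    unfolding id by (simp only:)
  then have "degree [:-q, \<alpha> * \<beta>:] = 1" using deg by linarith
  then show ab': "\<alpha> * \<beta> \<noteq> 0" by (auto split: if_splits)
  then have L: "[:-q, \<alpha> * \<beta>:] = smult (\<alpha> * \<beta>) [:-(q / (\<alpha> * \<beta>)), 1:]" by simp
  have "2 * order z (pderiv R) + order z (singular_poly d)
        = order z (smult (a * b) ((pderiv R)\<^sup>2) * singular_poly d)"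
    using ab R' by (simp add: order_mult order_smult power2_eq_square)
  also have "\<dots> = order z [:-q, \<alpha> * \<beta>:] + order z R + order z (R - 1)"
    unfolding id using ne by (simp add: order_mult del: mult_pCons_left)
  also have "order z [:-q, \<alpha> * \<beta>:] = (if z = q / (\<alpha> * \<beta>) then 1 else 0)"
    unfolding L using ab' by (subst order_smult) (auto simp only: order_linear mult_eq_0_iff)
  finally show "2 * order z (pderiv R) + (if z \<in> {0, 1, d} then 1 else 0)
           = (if z = q / (\<alpha> * \<beta>) then 1 else 0) + order z R + order z (R - 1)"
    unfolding order_singular_poly[OF d] .
qed

section \<open>Canonical forms\<close>

text \<open>The polynomial $S$ in the coordinate $y = l (t - \tau)$. The scale $l$ is normalized so that the
  coefficients are rational.\<close>

definition canonical_poly :: "nat \<Rightarrow> nat \<Rightarrow> complex poly" where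
  "canonical_poly m k =
     (if m = 2 then
        (if k = 0 then [:0, 0, 1:]
         else if k = 1 then [:0, 0, 3/4, 1/4:]
         else [:0, 0, 2, 0, -1:])
      else
        (if k = 0 then [:0, 0, 0, 1:]
         else if k = 1 then [:0, 0, 0, 4, -3:]
         else if k = 2 then [:0, 0, 0, 5/8, 15/64, 9/64:]
         else [:0, 0, 0, -2, 0, 0, -1:]))"

lemma poly_canonical_poly:
  "poly (canonical_poly 2 0) y = y ^ 2"
  "poly (canonical_poly 2 1) y = y ^ 2 * (y + 3) / 4"
  "poly (canonical_poly 2 2) y = y ^ 2 * (2 - y ^ 2)"
  "poly (canonical_poly 3 0) y = y ^ 3"
  "poly (canonical_poly 3 1) y = y ^ 3 * (4 - 3 * y)"
  "poly (canonical_poly 3 2) y = y ^ 3 * (40 + 15 * y + 9 * y ^ 2) / 64"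
  "poly (canonical_poly 3 3) y = - (y ^ 3 * (y ^ 3 + 2))"
  by (simp_all add: canonical_poly_def field_simps eval_nat_numeral)

lemma monic_pCons:
  fixes p :: "'a::comm_ring_1 poly"
  assumes "lead_coeff p = 1" "degree p = Suc n"
  obtains u r where "p = pCons u r" "lead_coeff r = 1" "degree r = n"
  using assms by (cases p) (auto split: if_splits)

lemma monic_0:
  fixes p :: "'a::comm_ring_1 poly"
  assumes "lead_coeff p = 1" "degree p = 0"
  shows "p = [:1:]"
  using assms by (auto elim!: degree_eq_zeroE)

lemma monic_1:
  fixes p :: "'a::comm_ring_1 poly"
  assumes "lead_coeff p = 1" "degree p = 1"
  obtains u where "p = [:u, 1:]"
  using assms by (metis monic_pCons monic_0 One_nat_def)

lemma monic_2:
  fixes p :: "'a::comm_ring_1 poly"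
  assumes "lead_coeff p = 1" "degree p = 2"
  obtains u w where "p = [:u, w, 1:]"
  using assms by (metis monic_pCons monic_1 numeral_2_eq_2 One_nat_def)

lemma monic_3:
  fixes p :: "'a::comm_ring_1 poly"
  assumes "lead_coeff p = 1" "degree p = 3"
  obtains u w x where "p = [:u, w, x, 1:]"
  using assms by (metis monic_pCons monic_2 numeral_3_eq_3 numeral_2_eq_2)

text \<open>The coordinate x has \<tau> at its origin. Comparing coefficients gives a polynomial
  system whose solutions form one orbit under scaling of x; \<open>l\<close> removes that
  freedom.\<close>

lemma canonical_form_2:
  fixes \<kappa> :: complex and a b v :: "complex poly"
  assumes \<kappa>: "\<kappa> \<noteq> 0" and monic: "lead_coeff a = 1" "lead_coeff b = 1" "lead_coeff v = 1"
    and deg: "degree a = k" "degree b + k = 2" "degree v = k"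
    and eq: "\<And>x. \<kappa> * (x ^ 2 * poly a x) - \<kappa> * (poly b x * (poly v x)\<^sup>2) = 1"
  shows "\<exists>l. l \<noteq> 0 \<and> (\<forall>x. \<kappa> * (x ^ 2 * poly a x) = poly (canonical_poly 2 k) (l * x))"
proof -
  have "k = 0 \<or> k = 1 \<or> k = 2" using deg(2) by auto
  then consider (0) "k = 0" | (1) "k = 1" | (2) "k = 2" by blast
  then show ?thesis
  proof cases
    case 0
    with monic deg have "a = [:1:]" by (intro monic_0) auto
    moreover have "csqrt \<kappa> \<noteq> 0" "(csqrt \<kappa>)\<^sup>2 = \<kappa>" using \<kappa> by simp_all
    ultimately show ?thesis
      unfolding 0 poly_canonical_poly
      by (intro exI[of _ "csqrt \<kappa>"]) (simp add: power_mult_distrib)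
  next
    case 1
    obtain p where a: "a = [:p, 1:]" using monic_1[of a] monic deg 1 by auto
    obtain r where b: "b = [:r, 1:]" using monic_1[of b] monic deg 1 by auto
    obtain w where v: "v = [:w, 1:]" using monic_1[of v] monic deg 1 by auto
    \<comment> \<open>The list holds the coefficients of the left side of \<open>eq\<close> minus 1.
      The top terms have cancelled because all three factors are monic.\<close>
    have "poly [:- \<kappa> * r * w\<^sup>2 - 1, - \<kappa> * (w\<^sup>2 + 2 * r * w), \<kappa> * (p - r - 2 * w):] x = poly 0 x" for x
      using eq[of x] unfolding a b v poly_pCons poly_0 by algebra
    then have "[:- \<kappa> * r * w\<^sup>2 - 1, - \<kappa> * (w\<^sup>2 + 2 * r * w), \<kappa> * (p - r - 2 * w):] = 0"
      by (intro poly_ext)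
    then have "- \<kappa> * r * w\<^sup>2 - 1 = 0" "- \<kappa> * (w\<^sup>2 + 2 * r * w) = 0" "\<kappa> * (p - r - 2 * w) = 0"
      by (simp_all only: pCons_eq_0_iff)
    then have e0: "- \<kappa> * r * w\<^sup>2 = 1" "w\<^sup>2 + 2 * r * w = 0" "p - r - 2 * w = 0"
      using \<kappa> by simp_all
    have e: "- \<kappa> * r * w\<^sup>2 = 1" "w * (w + 2 * r) = 0" "p = r + 2 * w"
      using e0 by algebra+
    then have "r \<noteq> 0" "w \<noteq> 0" by auto
    then have "w = -2 * r" using e(2) by (simp add: add_eq_0_iff2)
    then have p: "p = - 3 * r" and "\<kappa> * (4 * r ^ 3) = -1"
      using e by algebra+
    then have \<kappa>': "\<kappa> = -1 / (4 * r ^ 3)"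
      using \<open>r \<noteq> 0\<close> by (subst nonzero_eq_divide_eq) auto
    \<comment> \<open>The scale moves the simple root x = -r of S - 1 to y = 1; the double root x =
      2 r then lies at y = -2.\<close>
    show ?thesis using \<open>r \<noteq> 0\<close> unfolding 1 poly_canonical_poly
      by (intro exI[of _ "-1 / r"])
         (simp add: a p \<kappa>' field_simps power2_eq_square power3_eq_cube)
  next
    case 2
    obtain s p where a: "a = [:s, p, 1:]" using monic_2[of a] monic deg 2 by auto
    have b: "b = [:1:]" using monic_0[of b] monic deg 2 by auto
    obtain w u where v: "v = [:w, u, 1:]" using monic_2[of v] monic deg 2 by auto
    have "poly [:- \<kappa> * w\<^sup>2 - 1, - \<kappa> * 2 * u * w, \<kappa> * (s - u\<^sup>2 - 2 * w), \<kappa> * (p - 2 * u):] x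
        = poly 0 x" for x
      using eq[of x] unfolding a b v poly_pCons poly_0 by algebra
    then have "[:- \<kappa> * w\<^sup>2 - 1, - \<kappa> * 2 * u * w, \<kappa> * (s - u\<^sup>2 - 2 * w), \<kappa> * (p - 2 * u):] = 0"
      by (intro poly_ext)
    then have "- \<kappa> * w\<^sup>2 - 1 = 0" "- \<kappa> * 2 * u * w = 0" "\<kappa> * (s - u\<^sup>2 - 2 * w) = 0"
        "\<kappa> * (p - 2 * u) = 0"
      by (simp_all only: pCons_eq_0_iff)
    then have e0: "- \<kappa> * w\<^sup>2 = 1" "u * w = 0" "s - u\<^sup>2 - 2 * w = 0" "p - 2 * u = 0"
      using \<kappa> by simp_all
    have e: "- \<kappa> * w\<^sup>2 = 1" "u * w = 0" "s = u\<^sup>2 + 2 * w" "p = 2 * u"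
      using e0 by algebra+
    then have "w \<noteq> 0" by auto
    then have "u = 0" using e(2) by simp
    have "\<kappa> * w\<^sup>2 = - 1" using e(1) by algebra
    then have "\<kappa> = -1 / w\<^sup>2" using \<open>w \<noteq> 0\<close> by (subst nonzero_eq_divide_eq) auto
    then have e': "s = 2 * w" "p = 0" "\<kappa> = -1 / w\<^sup>2" using e \<open>u = 0\<close> by simp_all
    \<comment> \<open>S is even in x, so only the square of the scale is determined: it moves the
      double roots of S - 1, where x^2 = -w, to y^2 = 1.\<close>
    define l where "l = csqrt (-1 / w)"
    have l2: "l\<^sup>2 = -1 / w" by (simp add: l_def)
    have "l \<noteq> 0" using \<open>w \<noteq> 0\<close> by (simp add: l_def)
    moreover have "\<kappa> * (x\<^sup>2 * poly a x) = poly (canonical_poly 2 k) (l * x)" for x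
    proof -
      have "\<kappa> * (x\<^sup>2 * poly a x) = -1 / w * x\<^sup>2 * (2 - -1 / w * x\<^sup>2)"
        using \<open>w \<noteq> 0\<close> by (simp add: a e' field_simps power2_eq_square)
      also have "\<dots> = poly (canonical_poly 2 k) (l * x)"
        unfolding 2 poly_canonical_poly l2[symmetric] by (simp add: power_mult_distrib)
      finally show ?thesis .
    qed
    ultimately show ?thesis by blast
  qed
qed

lemma canonical_form_3:
  fixes \<kappa> :: complex and a b v :: "complex poly"
  assumes \<kappa>: "\<kappa> \<noteq> 0" and monic: "lead_coeff a = 1" "lead_coeff b = 1" "lead_coeff v = 1"
    and deg: "degree a = k" "degree b + k = 3" "degree v = k"
    and eq: "\<And>x. \<kappa> * (x ^ 3 * poly a x) - \<kappa> * (poly b x * (poly v x)\<^sup>2) = 1"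
  shows "\<exists>l. l \<noteq> 0 \<and> (\<forall>x. \<kappa> * (x ^ 3 * poly a x) = poly (canonical_poly 3 k) (l * x))"
proof -
  \<comment> \<open>For k = 0 and k = 3 the polynomial S depends on x^3 only, so the scale is known
    through its cube.\<close>
  have cube_root: "\<exists>l. l ^ 3 = w" for w :: complex by (rule nth_root_exists) simp
  have "k = 0 \<or> k = 1 \<or> k = 2 \<or> k = 3" using deg(2) by auto
  then consider (0) "k = 0" | (1) "k = 1" | (2) "k = 2" | (3) "k = 3" by blast
  then show ?thesis
  proof cases
    case 0
    with monic deg have a: "a = [:1:]" by (intro monic_0) auto
    obtain l where l: "l ^ 3 = \<kappa>" using cube_root by blast
    then have "l \<noteq> 0" using \<kappa> by auto
    moreover have "poly (canonical_poly 3 k) (l * x) = l ^ 3 * x ^ 3" for x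
      unfolding 0 poly_canonical_poly by algebra
    ultimately show ?thesis by (intro exI[of _ l]) (simp add: a l)
  next
    case 1
    obtain p where a: "a = [:p, 1:]" using monic_1[of a] monic deg 1 by auto
    obtain s u where b: "b = [:s, u, 1:]" using monic_2[of b] monic deg 1 by auto
    obtain w where v: "v = [:w, 1:]" using monic_1[of v] monic deg 1 by auto
    let ?e = "[:- \<kappa> * s * w\<^sup>2 - 1, - \<kappa> * (2 * s * w + u * w\<^sup>2), - \<kappa> * (s + 2 * u * w + w\<^sup>2),
      \<kappa> * (p - u - 2 * w):]"
    have "poly ?e x = poly 0 x" for x
      using eq[of x] unfolding a b v poly_pCons poly_0 by algebra
    then have "?e = 0" by (intro poly_ext)
    then have "- \<kappa> * s * w\<^sup>2 - 1 = 0" "- \<kappa> * (2 * s * w + u * w\<^sup>2) = 0"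
        "- \<kappa> * (s + 2 * u * w + w\<^sup>2) = 0" "\<kappa> * (p - u - 2 * w) = 0"
      by (simp_all only: pCons_eq_0_iff)
    then have e0: "- \<kappa> * s * w\<^sup>2 = 1" "2 * s * w + u * w\<^sup>2 = 0" "s + 2 * u * w + w\<^sup>2 = 0"
        "p - u - 2 * w = 0"
      using \<kappa> by simp_all
    have e: "- \<kappa> * s * w\<^sup>2 = 1" "w * (2 * s + u * w) = 0" "s + 2 * u * w + w\<^sup>2 = 0"
        "p = u + 2 * w"
      using e0 by algebra+
    then have "w \<noteq> 0" by auto
    then have s: "2 * s + u * w = 0" using e(2) by simp
    then have "w * (3 * u + 2 * w) = 0" using e(3) by algebra
    then have "3 * u + 2 * w = 0" using \<open>w \<noteq> 0\<close> by simp
    then have u: "u = - 2 * w / 3" by (simp add: field_simps add_eq_0_iff2)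
    have "3 * s = w\<^sup>2" using s \<open>3 * u + 2 * w = 0\<close> by algebra
    then have s': "s = w\<^sup>2 / 3" by (simp add: field_simps)
    have p: "p = 4 * w / 3" using e(4) u by (simp add: field_simps)
    have "\<kappa> * w ^ 4 = - 3" using e(1) \<open>3 * s = w\<^sup>2\<close> by algebra
    then have \<kappa>': "\<kappa> = - 3 / w ^ 4" using \<open>w \<noteq> 0\<close> by (subst nonzero_eq_divide_eq) auto
    \<comment> \<open>The scale moves the double root x = -w of S - 1 to y = 1.\<close>
    show ?thesis using \<open>w \<noteq> 0\<close> unfolding 1 poly_canonical_poly
      by (intro exI[of _ "- 1 / w"]) (simp add: a p \<kappa>' field_simps power4_eq_xxxx power3_eq_cube)
  next
    case 2
    obtain s p where a: "a = [:s, p, 1:]" using monic_2[of a] monic deg 2 by auto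
    obtain r where b: "b = [:r, 1:]" using monic_1[of b] monic deg 2 by auto
    obtain w u where v: "v = [:w, u, 1:]" using monic_2[of v] monic deg 2 by auto
    let ?e = "[:- \<kappa> * r * w\<^sup>2 - 1, - \<kappa> * (w\<^sup>2 + 2 * u * w * r), - \<kappa> * (2 * u * w + r * (u\<^sup>2 + 2 * w)),
      \<kappa> * (s - u\<^sup>2 - 2 * w - 2 * u * r), \<kappa> * (p - 2 * u - r):]"
    have "poly ?e x = poly 0 x" for x
      using eq[of x] unfolding a b v poly_pCons poly_0 by algebra
    then have "?e = 0" by (intro poly_ext)
    then have "- \<kappa> * r * w\<^sup>2 - 1 = 0" "- \<kappa> * (w\<^sup>2 + 2 * u * w * r) = 0"
       "- \<kappa> * (2 * u * w + r * (u\<^sup>2 + 2 * w)) = 0" "\<kappa> * (s - u\<^sup>2 - 2 * w - 2 * u * r) = 0"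
       "\<kappa> * (p - 2 * u - r) = 0"
      by (simp_all only: pCons_eq_0_iff)
    then have e: "- \<kappa> * r * w\<^sup>2 = 1" "w\<^sup>2 + 2 * u * w * r = 0" "2 * u * w + r * (u\<^sup>2 + 2 * w) = 0"
        "s - u\<^sup>2 - 2 * w - 2 * u * r = 0" "p - 2 * u - r = 0"
      using \<kappa> by simp_all
    then have "w \<noteq> 0" "r \<noteq> 0" by auto
    have "w * (w + 2 * u * r) = 0" using e(2) by algebra
    then have w: "w + 2 * u * r = 0" using \<open>w \<noteq> 0\<close> by simp
    then have "u \<noteq> 0" using \<open>w \<noteq> 0\<close> by auto
    have "u * r * (3 * u + 4 * r) = 0" using e(3) w by algebra
    then have "3 * u + 4 * r = 0" using \<open>u \<noteq> 0\<close> \<open>r \<noteq> 0\<close> by simp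
    then have u: "u = - 4 * r / 3" by (simp add: field_simps add_eq_0_iff2)
    have w2: "w = - 2 * u * r" using w by (simp add: add_eq_0_iff2)
    have w': "w = 8 * r\<^sup>2 / 3"
      unfolding w2 u by (simp add: power2_eq_square)
    have "p = 2 * u + r" using e(5) by (simp add: algebra_simps)
    then have p: "p = - 5 * r / 3" unfolding u by simp
    have "s = u\<^sup>2 + 2 * w + 2 * u * r" using e(4) by (simp add: algebra_simps)
    also note w2
    finally have "9 * s = 40 * r\<^sup>2" unfolding u by (simp add: power2_eq_square algebra_simps)
    then have s: "s = 40 * r\<^sup>2 / 9" by (simp add: mult.commute)
    have "\<kappa> * (64 * r ^ 5) = 9 * (\<kappa> * r * w\<^sup>2)"
      unfolding w' by (simp add: power2_eq_square eval_nat_numeral)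
    also have "\<dots> = - 9" using e(1) by algebra
    finally have "\<kappa> * (64 * r ^ 5) = - 9" .
    then have \<kappa>': "\<kappa> = - 9 / (64 * r ^ 5)"
      using \<open>r \<noteq> 0\<close> by (subst nonzero_eq_divide_eq) auto
    \<comment> \<open>The scale moves the simple root x = -r of S - 1 to y = 1.\<close>
    show ?thesis using \<open>r \<noteq> 0\<close> unfolding 2 poly_canonical_poly
      by (intro exI[of _ "- 1 / r"]) (simp add: a p s \<kappa>' field_simps eval_nat_numeral)
  next
    case 3
    obtain o' s p where a: "a = [:o', s, p, 1:]" using monic_3[of a] monic deg 3 by auto
    have b: "b = [:1:]" using monic_0[of b] monic deg 3 by auto
    obtain w v1 u where v: "v = [:w, v1, u, 1:]" using monic_3[of v] monic deg 3 by auto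
    let ?e = "[:- \<kappa> * w\<^sup>2 - 1, - \<kappa> * (2 * v1 * w), - \<kappa> * (v1\<^sup>2 + 2 * u * w),
      \<kappa> * (o' - 2 * w - 2 * u * v1), \<kappa> * (s - u\<^sup>2 - 2 * v1), \<kappa> * (p - 2 * u):]"
    have "poly ?e x = poly 0 x" for x
      using eq[of x] unfolding a b v poly_pCons poly_0 by algebra
    then have "?e = 0" by (intro poly_ext)
    then have "- \<kappa> * w\<^sup>2 - 1 = 0" "- \<kappa> * (2 * v1 * w) = 0" "- \<kappa> * (v1\<^sup>2 + 2 * u * w) = 0"
      "\<kappa> * (o' - 2 * w - 2 * u * v1) = 0" "\<kappa> * (s - u\<^sup>2 - 2 * v1) = 0" "\<kappa> * (p - 2 * u) = 0"
      by (simp_all only: pCons_eq_0_iff)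
    then have e: "- \<kappa> * w\<^sup>2 = 1" "v1 * w = 0" "v1\<^sup>2 + 2 * u * w = 0"
      "o' - 2 * w - 2 * u * v1 = 0" "s - u\<^sup>2 - 2 * v1 = 0" "p - 2 * u = 0"
      using \<kappa> by simp_all
    then have "w \<noteq> 0" by auto
    then have "v1 = 0" using e by simp
    then have "u = 0" using e \<open>w \<noteq> 0\<close> by simp
    have a': "o' = 2 * w" "s = 0" "p = 0" using e \<open>v1 = 0\<close> \<open>u = 0\<close> by simp_all
    have "\<kappa> * w\<^sup>2 = - 1" using e(1) by algebra
    then have \<kappa>': "\<kappa> = -1 / w\<^sup>2" using \<open>w \<noteq> 0\<close> by (subst nonzero_eq_divide_eq) auto
    \<comment> \<open>The double roots of S - 1, where x^3 = -w, are moved to y^3 = -1.\<close>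
    obtain l where l: "l ^ 3 = 1 / w" using cube_root by blast
    then have "l \<noteq> 0" using \<open>w \<noteq> 0\<close> by auto
    moreover have "\<kappa> * (x ^ 3 * poly a x) = poly (canonical_poly 3 k) (l * x)" for x
    proof -
      have "\<kappa> * (x ^ 3 * poly a x) = - (1 / w * x ^ 3 * (1 / w * x ^ 3 + 2))"
        using \<open>w \<noteq> 0\<close> by (simp add: a a' \<kappa>' field_simps power2_eq_square power3_eq_cube)
      also have "\<dots> = poly (canonical_poly 3 k) (l * x)"
        unfolding 3 poly_canonical_poly l[symmetric] by (simp add: power_mult_distrib)
      finally show ?thesis .
    qed
    ultimately show ?thesis by blast
  qed
qed

section \<open>From orders of vanishing to factorizations\<close>

lemma prod_linear_monic:
  fixes A :: "'a::idom set"
  shows "lead_coeff (\<Prod>z\<in>A. [:-z, 1:]) = 1" and "degree (\<Prod>z\<in>A. [:-z, 1:]) = card A"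
  by (subst lead_coeff_prod, simp) (simp add: degree_prod_eq_sum_degree)

lemma lead_coeff_pcompose_shift:
  fixes p :: "'a::idom poly"
  shows "lead_coeff (p \<circ>\<^sub>p [:w, 1:]) = lead_coeff p" "degree (p \<circ>\<^sub>p [:w, 1:]) = degree p"
  by (subst lead_coeff_comp) (simp_all add: degree_pcompose)

text \<open>The last conjunct describes $\{0,1,d\}$ in terms of $S$ and $\tau$ only, so that an affine
  map that transforms one such $S$ into another also matches the singular points.\<close>

definition canonical_reduction :: "nat \<Rightarrow> nat \<Rightarrow> complex \<Rightarrow> complex poly \<Rightarrow> bool" where
  "canonical_reduction m k d R \<longleftrightarrow>
     m \<in> {2, 3} \<and> k \<le> m \<and> degree R = m + k \<and>
     (\<exists>S l \<tau>. (S = R \<or> S = 1 - R) \<and> l \<noteq> 0 \<and>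
        S = canonical_poly m k \<circ>\<^sub>p [:- l * \<tau>, l:] \<and>
        (\<forall>z. z \<in> {0, 1, d} \<longleftrightarrow>
           (m = 2 \<and> z = \<tau>) \<or> (poly S z \<in> {0, 1} \<and> poly (pderiv S) z \<noteq> 0)))"

text \<open>The exponent parameters \<open>e\<close> over S = 0 and \<open>e'\<close> over S = 1 are
  kept abstract, so that the argument serves S = R and, with the two parameters exchanged, S = 1 -
  R.\<close>

lemma reduction_canonical_form:
  fixes S :: "complex poly" and T :: "complex set" and e e' :: complex
  assumes deg: "degree S > 0" and \<tau>: "poly S \<tau> = 0" and T: "finite T" "card T = 3"
    and orders: "\<And>z. 2 * order z (pderiv S) + (if z \<in> T then 1 else 0)
           = (if z = \<tau> then 1 else 0) + order z S + order z (S - 1)"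
    and exps: "\<And>z. e * of_nat (order z S) + e' * of_nat (order z (S - 1))
           - of_nat (order z (pderiv S)) = \<rho> z"
    and \<rho>: "\<And>z. z \<notin> T \<Longrightarrow> \<rho> z = 0" "\<tau> \<in> T \<Longrightarrow> \<rho> \<tau> \<noteq> 0"
    and m: "m = (if \<tau> \<in> T then 2 else 3)"
  obtains k l where "k \<le> m" "degree S = m + k" "l \<noteq> 0"
    "S = canonical_poly m k \<circ>\<^sub>p [:- l * \<tau>, l:]"
    "\<And>z. z \<in> T \<longleftrightarrow> (m = 2 \<and> z = \<tau>) \<or> (poly S z \<in> {0, 1} \<and> poly (pderiv S) z \<noteq> 0)"
proof -
  have ne: "S \<noteq> 0" "pderiv S \<noteq> 0" "S - 1 \<noteq> 0"
    using deg by (auto simp: pderiv_eq_0_iff)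
  have S1': "pderiv (S - 1) = pderiv S" by (simp add: pderiv_diff)
  have root0: "order z S = Suc (order z (pderiv S))" "order z (S - 1) = 0" if "poly S z = 0" for z
    using that ne order_pderiv[of S z] by (auto intro: order_0I)
  have root1: "order z (S - 1) = Suc (order z (pderiv S))" "order z S = 0" if "poly S z = 1" for z
    using that ne order_pderiv[of "S - 1" z] by (auto simp: S1' intro: order_0I)
  have noroot: "order z S = 0" "order z (S - 1) = 0" if "poly S z \<noteq> 0" "poly S z \<noteq> 1" for z
    using that by (auto intro: order_0I)
  \<comment> \<open>If n is the order of S at \<tau>, the order relation reads 2 (n - 1) +
    [\<tau> in T] = 1 + n.\<close>
  have ord\<tau>: "order \<tau> S = m"
    using orders[of \<tau>] root0[OF \<tau>] by (simp add: m split: if_splits)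
  have ord\<tau>': "order \<tau> (pderiv S) = m - 1" using root0(1)[OF \<tau>] ord\<tau> by simp
  \<comment> \<open>The residue at \<tau> is 2 e - 1 if \<tau> is singular, and nonzero by
    assumption; otherwise it is 3 e - 2 and vanishes, so e = 2/3.\<close>
  have e: "2 * e \<noteq> 1"
  proof (cases "\<tau> \<in> T")
    case True
    then have "e * 2 - 1 = \<rho> \<tau>"
      using exps[of \<tau>] root0(2)[OF \<tau>] ord\<tau> ord\<tau>' by (simp add: m)
    then show ?thesis using \<rho>(2)[OF True] by (auto simp: mult.commute)
  next
    case False
    then have "e * 3 - 2 = 0"
      using exps[of \<tau>] root0(2)[OF \<tau>] ord\<tau> ord\<tau>' \<rho>(1)[OF False] by (simp add: m)
    show ?thesis
    proof
      assume "2 * e = 1"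
      with \<open>e * 3 - 2 = 0\<close> have "(0 :: complex) = 1" by algebra
      then show False by simp
    qed
  qed
  \<comment> \<open>For a root of order n the relation is 2 (n - 1) + [z in T] = n. A root outside T
    is therefore double, and its vanishing residue 2 e - 1 contradicts \<open>e\<close>.\<close>
  have S0: "z \<in> T \<and> order z S = 1" if "poly S z = 0" "z \<noteq> \<tau>" for z
  proof (cases "z \<in> T")
    case True
    then show ?thesis using orders[of z] root0[OF that(1)] that(2) by simp
  next
    case False
    then have "order z S = 2" "order z (pderiv S) = 1"
      using orders[of z] root0[OF that(1)] that(2) by simp_all
    then have "e * 2 - 1 = 0"
      using exps[of z] root0(2)[OF that(1)] \<rho>(1)[OF False] by simp
    then show ?thesis using e by (simp add: mult.commute)
  qed
  have S1: "order z (S - 1) = (if z \<in> T then 1 else 2)" if "poly S z = 1" for z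
  proof -
    have "z \<noteq> \<tau>" using that \<tau> by auto
    then show ?thesis using orders[of z] root1[OF that] by (simp split: if_splits)
  qed
  \<comment> \<open>At any other value of S the right side of the order relation is 0, while the
    left side is at least 1.\<close>
  have ST: "poly S z = 0 \<or> poly S z = 1" if "z \<in> T" "z \<noteq> \<tau>" for z
  proof (rule ccontr)
    assume "\<not> (poly S z = 0 \<or> poly S z = 1)"
    then show False using orders[of z] noroot[of z] that by simp
  qed
  define A where "A = {z \<in> T - {\<tau>}. poly S z = 0}"
  define B where "B = {z \<in> T - {\<tau>}. poly S z = 1}"
  define Z where "Z = {z. poly S z = 1} - T"
  have finR: "finite {z. poly (S - 1) z = 0}" using ne by (intro poly_roots_finite)
  have fin: "finite A" "finite B" "finite Z"
    using T(1) finR unfolding A_def B_def Z_def by auto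
  have rootsS: "{z. poly S z = 0} = insert \<tau> A" and "\<tau> \<notin> A"
    using S0 \<tau> by (auto simp: A_def)
  have rootsS1: "{z. poly (S - 1) z = 0} = B \<union> Z" and BZ: "B \<inter> Z = {}"
    using \<tau> by (auto simp: B_def Z_def)
  \<comment> \<open>Removing \<tau> from the three singular points leaves two of them if \<tau> is
    singular and three otherwise, which is \<open>m\<close> in both cases.\<close>
  have cardAB: "card A + card B = m"
  proof -
    have "A \<union> B = T - {\<tau>}" "A \<inter> B = {}" using ST by (auto simp: A_def B_def)
    then have "card A + card B = card (T - {\<tau>})" using fin by (metis card_Un_disjoint)
    also have "\<dots> = m" using T by (auto simp: m card_Diff_singleton_if)
    finally show ?thesis .
  qed
  define \<kappa> where "\<kappa> = lead_coeff S"
  have \<kappa>: "\<kappa> \<noteq> 0" using ne by (simp add: \<kappa>_def)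
  define a b v where "a = (\<Prod>z\<in>A. [:-z, 1:])" and "b = (\<Prod>z\<in>B. [:-z, 1:])"
    and "v = (\<Prod>z\<in>Z. [:-z, 1:])"
  have S_eq: "S = smult \<kappa> ([:-\<tau>, 1:] ^ m * a)"
  proof -
    have "S = smult \<kappa> (\<Prod>z\<in>insert \<tau> A. [:-z, 1:] ^ order z S)"
      using complex_poly_decompose[of S] unfolding rootsS \<kappa>_def by simp
    also have "(\<Prod>z\<in>insert \<tau> A. [:-z, 1:] ^ order z S) = [:-\<tau>, 1:] ^ m * a"
      using fin(1) \<open>\<tau> \<notin> A\<close> S0 unfolding a_def
      by (subst prod.insert) (auto simp: ord\<tau> A_def intro!: prod.cong)
    finally show ?thesis .
  qed
  have deg1: "degree (S - 1) = degree S"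
    using degree_add_eq_left[of "-1" S] deg by simp
  have lead1: "lead_coeff (S - 1) = \<kappa>"
    unfolding deg1 using deg by (simp add: \<kappa>_def coeff_diff)
  have S1_eq: "S - 1 = smult \<kappa> (b * v\<^sup>2)"
  proof -
    have "S - 1 = smult \<kappa> (\<Prod>z\<in>B \<union> Z. [:-z, 1:] ^ order z (S - 1))"
      using complex_poly_decompose[of "S - 1"] unfolding rootsS1 lead1 by simp
    also have "(\<Prod>z\<in>B \<union> Z. [:-z, 1:] ^ order z (S - 1))
        = (\<Prod>z\<in>B. [:-z, 1:] ^ order z (S - 1)) * (\<Prod>z\<in>Z. [:-z, 1:] ^ order z (S - 1))"
      using fin BZ by (intro prod.union_disjoint)
    also have "(\<Prod>z\<in>B. [:-z, 1:] ^ order z (S - 1)) = b"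
      unfolding b_def by (intro prod.cong refl) (auto simp: B_def S1)
    also have "(\<Prod>z\<in>Z. [:-z, 1:] ^ order z (S - 1)) = v\<^sup>2"
      unfolding v_def prod_power_distrib by (intro prod.cong refl) (auto simp: Z_def S1)
    finally show ?thesis .
  qed
  note monic = prod_linear_monic[of A, folded a_def] prod_linear_monic[of B, folded b_def]
    prod_linear_monic[of Z, folded v_def]
  have nz: "a \<noteq> 0" "b \<noteq> 0" "v \<noteq> 0" using monic by auto
  define k where "k = card A"
  have degS: "degree S = m + k"
  proof -
    have "degree S = degree ([:-\<tau>, 1:] ^ m) + degree a"
      unfolding S_eq using \<kappa> nz by (simp add: degree_mult_eq)
    also have "degree ([:-\<tau>, 1:] ^ m) = m" by (simp add: degree_power_eq)
    finally show ?thesis using monic by (simp add: k_def)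
  qed
  have "degree S = card B + 2 * card Z"
    using deg1 \<kappa> nz monic unfolding S1_eq by (simp add: degree_mult_eq degree_power_eq)
  \<comment> \<open>The two degree counts give m + k = (m - k) + 2 \<open>card Z\<close>.\<close>
  then have degv: "card Z = k" using degS cardAB by (simp add: k_def)
  let ?c = "\<lambda>p. p \<circ>\<^sub>p [:\<tau>, 1:]"
  have eq: "\<kappa> * (x ^ m * poly (?c a) x) - \<kappa> * (poly (?c b) x * (poly (?c v) x)\<^sup>2) = 1" for x
  proof -
    have "poly S (\<tau> + x) - poly (S - 1) (\<tau> + x) = 1" by simp
    moreover have "poly S (\<tau> + x) = \<kappa> * (x ^ m * poly (?c a) x)"
      unfolding S_eq by (simp add: poly_pcompose)
    moreover have "poly (S - 1) (\<tau> + x) = \<kappa> * (poly (?c b) x * (poly (?c v) x)\<^sup>2)"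
      unfolding S1_eq by (simp add: poly_pcompose)
    ultimately show ?thesis by (simp only:)
  qed
  have m23: "m = 2 \<or> m = 3" by (simp add: m)
  have "\<exists>l. l \<noteq> 0 \<and> (\<forall>x. \<kappa> * (x ^ m * poly (?c a) x) = poly (canonical_poly m k) (l * x))"
  proof -
    have lc: "lead_coeff (?c a) = 1" "lead_coeff (?c b) = 1" "lead_coeff (?c v) = 1"
      unfolding lead_coeff_pcompose_shift(1) by (rule monic)+
    have dg: "degree (?c a) = k" "degree (?c b) + k = m" "degree (?c v) = k"
      unfolding lead_coeff_pcompose_shift(2) using monic degv cardAB by (simp_all add: k_def)
    from m23 show ?thesis
    proof
      assume m2: "m = 2"
      show ?thesis using canonical_form_2[OF \<kappa> lc dg[unfolded m2] eq[unfolded m2]] unfolding m2 .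
    next
      assume m3: "m = 3"
      show ?thesis using canonical_form_3[OF \<kappa> lc dg[unfolded m3] eq[unfolded m3]] unfolding m3 .
    qed
  qed
  then obtain l where l: "l \<noteq> 0"
    "\<And>x. \<kappa> * (x ^ m * poly (?c a) x) = poly (canonical_poly m k) (l * x)" by blast
  have S_can: "S = canonical_poly m k \<circ>\<^sub>p [:- l * \<tau>, l:]"
  proof (rule poly_ext)
    fix t
    have "poly S t = \<kappa> * ((t - \<tau>) ^ m * poly (?c a) (t - \<tau>))"
      unfolding S_eq by (simp add: poly_pcompose)
    also have "\<dots> = poly (canonical_poly m k) (l * (t - \<tau>))" by (rule l(2))
    also have "\<dots> = poly (canonical_poly m k \<circ>\<^sub>p [:- l * \<tau>, l:]) t"
      by (simp add: poly_pcompose algebra_simps)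
    finally show "poly S t = poly (canonical_poly m k \<circ>\<^sub>p [:- l * \<tau>, l:]) t" .
  qed
  \<comment> \<open>\<tau> is a multiple root of S, so only the first alternative can apply there.
    Elsewhere a point over 0 or 1 is simple exactly if it lies in T.\<close>
  have char: "z \<in> T \<longleftrightarrow> (m = 2 \<and> z = \<tau>) \<or> (poly S z \<in> {0, 1} \<and> poly (pderiv S) z \<noteq> 0)" for z
  proof (cases "z = \<tau>")
    case True
    have "order \<tau> (pderiv S) > 0" using root0[OF \<tau>] ord\<tau> m23 by auto
    then have "poly (pderiv S) \<tau> = 0" using order_root by blast
    then show ?thesis using True by (simp add: m)
  next
    case False
    have "order z (pderiv S) = 0 \<longleftrightarrow> z \<in> T" if "poly S z \<in> {0, 1}"
      using that orders[of z] root0[of z] root1[of z] S0[of z] S1[of z] False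
      by (auto split: if_splits)
    then show ?thesis using False ST[of z] ne(2) by (auto simp: order_root)
  qed
  show ?thesis
    using that[OF _ degS l(1) S_can char] cardAB k_def by simp
qed

lemma order_uminus_poly: "order z (- p) = order z (p :: 'a::idom poly)"
  using order_smult[of "-1" z p] by simp

lemma polynomial_reduction_canonical:
  fixes R :: "complex poly"
  assumes d: "d \<notin> {0, 1}" and nt: "nontrivial q \<alpha> \<beta>" and deg: "degree R > 0"
    and four: "four_singular_points d q \<alpha> \<beta> \<gamma> \<delta> \<epsilon>"
    and red: "equation_reduction d q \<alpha> \<beta> \<gamma> \<delta> \<epsilon> a b c (poly R)"
  obtains k where
    "canonical_reduction (if q / (\<alpha> * \<beta>) \<in> {0, 1, d} then 2 else 3) k d R"
proof -
  define \<tau> where "\<tau> = q / (\<alpha> * \<beta>)"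
  define \<rho> where "\<rho> z = (if z = 0 then \<gamma> else 0) + (if z = 1 then \<delta> else 0) + (if z = d then \<epsilon> else 0)" for z
  define m :: nat where "m = (if \<tau> \<in> {0, 1, d} then 2 else 3)"
  note ord = polynomial_reduction_orders[OF d nt deg red]
  note exps = reduction_exponents[OF deg red, folded \<rho>_def]
  have q: "q = \<alpha> * \<beta> * \<tau>" using ord(1) by (simp add: \<tau>_def)
  have \<rho>0: "\<rho> z = 0" if "z \<notin> {0, 1, d}" for z using that by (simp add: \<rho>_def)
  \<comment> \<open>Since q = \<alpha>\<beta>\<tau>, a vanishing exponent at a singular point equal
    to \<tau> would be one of the degenerations excluded by
    \<open>four_singular_points\<close>.\<close>
  have \<rho>\<tau>: "\<rho> \<tau> \<noteq> 0" if "\<tau> \<in> {0, 1, d}"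
    using that four d by (auto simp: \<rho>_def four_singular_points_def q)
  have "card {0, 1, d} = 3" using d by (auto simp: card_insert_if)
  have or: "2 * order z (pderiv R) + (if z \<in> {0, 1, d} then 1 else 0)
           = (if z = \<tau> then 1 else 0) + order z R + order z (R - 1)" for z
    using ord(2)[of z] by (simp add: \<tau>_def)
  \<comment> \<open>Otherwise the order relation leaves only the case that \<tau> is singular and
    not critical. The residue there would be 0, contrary to the nonzero exponent.\<close>
  have "poly R \<tau> = 0 \<or> poly R \<tau> = 1"
  proof (rule ccontr)
    assume "\<not> (poly R \<tau> = 0 \<or> poly R \<tau> = 1)"
    then have o: "order \<tau> R = 0" "order \<tau> (R - 1) = 0" by (auto intro: order_0I)
    then have "order \<tau> (pderiv R) = 0 \<and> \<tau> \<in> {0, 1, d}"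
      using or[of \<tau>] by (auto split: if_splits)
    then show False using exps[of \<tau>] \<rho>\<tau> o by simp
  qed
  then show ?thesis
  proof
    assume R0: "poly R \<tau> = 0"
    show ?thesis
    proof (rule reduction_canonical_form[OF deg R0 _ \<open>card {0, 1, d} = 3\<close> or exps \<rho>0 \<rho>\<tau> m_def])
      fix k l
      assume *: "k \<le> m" "degree R = m + k" "l \<noteq> 0" "R = canonical_poly m k \<circ>\<^sub>p [:- l * \<tau>, l:]"
       "\<And>z. z \<in> {0, 1, d} \<longleftrightarrow> (m = 2 \<and> z = \<tau>) \<or> (poly R z \<in> {0, 1} \<and> poly (pderiv R) z \<noteq> 0)"
      have "m \<in> {2, 3}" "R = R \<or> R = 1 - R" by (simp_all add: m_def)
      then have "canonical_reduction m k d R"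
        unfolding canonical_reduction_def
        by (intro conjI exI[of _ R] exI[of _ l] exI[of _ \<tau>] allI *)
      then show ?thesis using that unfolding m_def \<tau>_def by blast
    qed auto
  next
    assume R1: "poly R \<tau> = 1"
    \<comment> \<open>The substitution z -> 1 - z exchanges the singular points 0 and 1 of the
      hypergeometric equation, hence also the two exponent parameters.\<close>
    define S where "S = 1 - R"
    have S1: "S - 1 = - R" "S = - (R - 1)" "pderiv S = - pderiv R"
      by (simp_all add: S_def pderiv_diff)
    have deg': "degree S = degree R"
      using degree_add_eq_right[of 1 "-R"] deg by (simp add: S_def)
    show ?thesis
    proof (rule reduction_canonical_form[of S \<tau> "{0, 1, d}" "a + b - c + 1" c \<rho> m])
      show "2 * order z (pderiv S) + (if z \<in> {0, 1, d} then 1 else 0) =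
         (if z = \<tau> then 1 else 0) + order z S + order z (S - 1)" for z
        using or[of z] unfolding S1(1,3) by (subst S1(2)) (simp only: order_uminus_poly ac_simps)
      show "(a + b - c + 1) * of_nat (order z S) + c * of_nat (order z (S - 1))
           - of_nat (order z (pderiv S)) = \<rho> z" for z
        using exps[of z] unfolding S1(1,3) by (subst S1(2)) (simp only: order_uminus_poly add.commute)
    next
      fix k l
      assume *: "k \<le> m" "degree S = m + k" "l \<noteq> 0" "S = canonical_poly m k \<circ>\<^sub>p [:- l * \<tau>, l:]"
       "\<And>z. z \<in> {0, 1, d} \<longleftrightarrow> (m = 2 \<and> z = \<tau>) \<or> (poly S z \<in> {0, 1} \<and> poly (pderiv S) z \<noteq> 0)"
      have "m \<in> {2, 3}" "S = R \<or> S = 1 - R" "degree R = m + k"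
        using *(2) by (simp_all add: m_def S_def deg'[symmetric])
      then have "canonical_reduction m k d R"
        unfolding canonical_reduction_def
        by (intro conjI exI[of _ S] exI[of _ l] exI[of _ \<tau>] allI *)
      then show ?thesis using that unfolding m_def \<tau>_def by blast
    qed (use deg deg' R1 \<rho>0 \<rho>\<tau> m_def \<open>card {0, 1, d} = 3\<close> in \<open>auto simp: S_def\<close>)
  qed
qed

section \<open>Affine equivalence\<close>

lemma three_distinct_members:
  assumes "x \<in> {a, b, c}" "y \<in> {a, b, c}" "z \<in> {a, b, c}" "x \<noteq> y" "x \<noteq> z" "y \<noteq> z"
  shows "x = a \<and> y = b \<and> z = c \<or> x = a \<and> y = c \<and> z = b \<or> x = b \<and> y = a \<and> z = c
    \<or> x = b \<and> y = c \<and> z = a \<or> x = c \<and> y = a \<and> z = b \<or> x = c \<and> y = b \<and> z = a"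
  using assms by blast

text \<open>The six bijections between the two triples correspond to the six members of the orbit: d
  is the ratio in which the preimages of 0, 1, D are placed, which an affine map preserves.\<close>

lemma affine_image_cross_ratio_orbit:
  fixes m n d D :: complex
  assumes m: "m \<noteq> 0" and d: "d \<notin> {0, 1}" and D: "D \<notin> {0, 1}"
    and img: "(\<lambda>z. m * z + n) ` {0, 1, d} = {0, 1, D}"
  shows "d \<in> cross_ratio_orbit D"
proof -
  have in3: "n \<in> {0, 1, D}" "m + n \<in> {0, 1, D}" "m * d + n \<in> {0, 1, D}"
    using img by auto
  have ne: "n \<noteq> m + n" "n \<noteq> m * d + n" "m + n \<noteq> m * d + n"
    using m d by auto
  have D': "D \<noteq> 0" "D \<noteq> 1" "D - 1 \<noteq> 0" "1 - D \<noteq> 0" using D by auto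
  consider "n = 0" "m + n = 1" "m * d + n = D" | "n = 0" "m + n = D" "m * d + n = 1"
    | "n = 1" "m + n = 0" "m * d + n = D" | "n = 1" "m + n = D" "m * d + n = 0"
    | "n = D" "m + n = 0" "m * d + n = 1" | "n = D" "m + n = 1" "m * d + n = 0"
    using three_distinct_members[OF in3 ne] by blast
  then show ?thesis
  proof cases
    case 1
    then have "d = D" by simp
    then show ?thesis by (simp add: cross_ratio_orbit_def)
  next
    case 2
    then have "d = 1 / D" using D' by (simp add: nonzero_eq_divide_eq mult.commute)
    then show ?thesis by (simp add: cross_ratio_orbit_def)
  next
    case 3
    then have "m = -1" by (simp add: add_eq_0_iff2)
    then have "d = 1 - D" using 3 by (simp add: algebra_simps)
    then show ?thesis by (simp add: cross_ratio_orbit_def)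
  next
    case 4
    then have "d * (1 - D) = 1" using 4 by algebra
    then have "d = 1 / (1 - D)" using D' by (simp add: nonzero_eq_divide_eq)
    then show ?thesis by (simp add: cross_ratio_orbit_def)
  next
    case 5
    have "d * n = n - 1" using 5(2,3) by algebra
    then have "d * D = D - 1" unfolding 5(1) .
    then have "d = (D - 1) / D" using D' by (simp add: nonzero_eq_divide_eq)
    then show ?thesis by (simp add: cross_ratio_orbit_def)
  next
    case 6
    have "d * (n - 1) = n" using 6(2,3) by algebra
    then have "d * (D - 1) = D" unfolding 6(1) .
    then have "d = D / (D - 1)" using D' by (simp add: nonzero_eq_divide_eq)
    then show ?thesis by (simp add: cross_ratio_orbit_def)
  qed
qed

text \<open>Both polynomials become the same canonical one in suitable affine coordinates, and A1 is
  the change between these coordinates. It matches the singular points because they are described by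
  S and \<tau> alone. A2 accounts for the choices between R and 1 - R.\<close>

lemma canonical_reductions_same_type:
  assumes can: "canonical_reduction m k d R" and can0: "canonical_reduction m k D R0"
    and d: "d \<notin> {0, 1}" and D: "D \<notin> {0, 1}" and R0: "poly R 0 = 0"
  shows "same_type D (poly R0) d (poly R)"
proof -
  from can obtain S l \<tau> where S: "S = R \<or> S = 1 - R" "l \<noteq> 0"
    "S = canonical_poly m k \<circ>\<^sub>p [:- l * \<tau>, l:]"
    and charS: "\<And>z. z \<in> {0, 1, d} \<longleftrightarrow>
           (m = 2 \<and> z = \<tau>) \<or> (poly S z \<in> {0, 1} \<and> poly (pderiv S) z \<noteq> 0)"
    unfolding canonical_reduction_def by blast
  from can0 obtain S0 l0 \<tau>0 where S0: "S0 = R0 \<or> S0 = 1 - R0" "l0 \<noteq> 0"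
    "S0 = canonical_poly m k \<circ>\<^sub>p [:- l0 * \<tau>0, l0:]"
    and charS0: "\<And>z. z \<in> {0, 1, D} \<longleftrightarrow>
           (m = 2 \<and> z = \<tau>0) \<or> (poly S0 z \<in> {0, 1} \<and> poly (pderiv S0) z \<noteq> 0)"
    unfolding canonical_reduction_def by blast
  \<comment> \<open>This is the solution of l0 (A1(z) - \<tau>0) = l (z - \<tau>).\<close>
  define A1 where "A1 = (\<lambda>z. l / l0 * z + (\<tau>0 - l / l0 * \<tau>))"
  have aff: "complex_affine A1"
    unfolding complex_affine_def A1_def using S(2) S0(2)
    by (intro exI[of _ "l / l0"] exI[of _ "\<tau>0 - l / l0 * \<tau>"]) simp
  have arg: "- l0 * \<tau>0 + l0 * A1 z = - l * \<tau> + l * z" for z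
    using S0(2) by (simp add: A1_def algebra_simps)
  have val: "poly S z = poly S0 (A1 z)" for z
    using arg[of z] by (simp add: S(3) S0(3) poly_pcompose mult.commute)
  have der: "poly (pderiv S) z \<noteq> 0 \<longleftrightarrow> poly (pderiv S0) (A1 z) \<noteq> 0" for z
    using arg[of z] S(2) S0(2)
    by (simp add: S(3) S0(3) pderiv_pcompose poly_pcompose pderiv_pCons mult.commute)
  have "A1 z - \<tau>0 = l / l0 * (z - \<tau>)" for z
    unfolding A1_def right_diff_distrib by simp
  then have "A1 z = \<tau>0 \<longleftrightarrow> l / l0 * (z - \<tau>) = 0" for z
    by (metis right_minus_eq)
  then have pt: "A1 z = \<tau>0 \<longleftrightarrow> z = \<tau>" for z using S(2) S0(2) by simp
  have mem: "z \<in> {0, 1, d} \<longleftrightarrow> A1 z \<in> {0, 1, D}" for z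
    unfolding charS charS0 pt val der ..
  have img: "A1 ` {0, 1, d} = {0, 1, D}"
  proof (intro equalityI subsetI)
    fix w assume "w \<in> {0, 1, D}"
    moreover define z where "z = l0 / l * (w - \<tau>0) + \<tau>"
    have "A1 z = w" using S(2) S0(2) by (simp add: A1_def z_def field_simps)
    ultimately show "w \<in> A1 ` {0, 1, d}" using mem[of z] by auto
  qed (use mem in auto)
  have "d \<in> cross_ratio_orbit D"
    using affine_image_cross_ratio_orbit[OF _ d D img[unfolded A1_def]] S(2) S0(2) by simp
  moreover have "\<exists>A2. (A2 = (\<lambda>z. z) \<or> A2 = (\<lambda>z. 1 - z)) \<and> poly R = A2 \<circ> poly R0 \<circ> A1"
  proof -
    consider "R = S" "R0 = S0" | "R = S" "R0 = 1 - S0" | "R = 1 - S" "R0 = S0"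
      | "R = 1 - S" "R0 = 1 - S0"
      using S(1) S0(1) by force
    then show ?thesis
    proof cases
      case 1
      then show ?thesis by (intro exI[of _ "\<lambda>z. z"]) (auto simp: val)
    next
      case 2
      then show ?thesis by (intro exI[of _ "\<lambda>z. 1 - z"]) (auto simp: val)
    next
      case 3
      then show ?thesis by (intro exI[of _ "\<lambda>z. 1 - z"]) (auto simp: val)
    next
      case 4
      then show ?thesis by (intro exI[of _ "\<lambda>z. z"]) (auto simp: val)
    qed
  qed
  ultimately show ?thesis
    unfolding same_type_def using R0 aff img by blast
qed

text \<open>The orbit maps and their inverses are fractional linear with rational coefficients.
  Reality of d thus becomes an invariant that separates types of equal degree.\<close>

lemma cross_ratio_orbit_real:
  assumes "d \<in> cross_ratio_orbit D" "D \<notin> {0, 1}"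
  shows "d \<in> \<real> \<longleftrightarrow> D \<in> \<real>"
proof
  have D: "D \<noteq> 0" "D - 1 \<noteq> 0" using assms(2) by auto
  assume "D \<in> \<real>"
  then show "d \<in> \<real>" using assms by (auto simp: cross_ratio_orbit_def)
next
  have D: "D \<noteq> 0" "D - 1 \<noteq> 0" "1 - D \<noteq> 0" using assms(2) by auto
  assume d: "d \<in> \<real>"
  from assms(1) consider "d = D" | "d = 1 - D" | "d = 1 / D" | "d = 1 / (1 - D)"
    | "d = D / (D - 1)" | "d = (D - 1) / D"
    by (auto simp: cross_ratio_orbit_def)
  then have "D = d \<or> D = 1 - d \<or> D = 1 / d \<or> D = 1 - 1 / d \<or> D = d / (d - 1) \<or> D = 1 / (1 - d)"
  proof cases
    case 5
    then have "d - 1 = 1 / (D - 1)" using D by (simp add: field_simps)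
    then have "D = d / (d - 1)" using 5 D by simp
    then show ?thesis by blast
  next
    case 6
    then have "1 - d = 1 / D" using D by (simp add: field_simps)
    then show ?thesis by simp
  qed simp_all
  then show "D \<in> \<real>" using d by auto
qed

lemma same_type_degree:
  fixes R R0 :: "complex poly"
  assumes "same_type D (poly R0) d (poly R)"
  shows "degree R = degree R0"
proof -
  from assms obtain m n A2 where m: "m \<noteq> 0" and A2: "A2 = (\<lambda>z. z) \<or> A2 = (\<lambda>z. 1 - z)"
    and R: "poly R = A2 \<circ> poly R0 \<circ> (\<lambda>z. m * z + n)"
    unfolding same_type_def complex_affine_def by blast
  have "R = R0 \<circ>\<^sub>p [:n, m:] \<or> R = 1 - R0 \<circ>\<^sub>p [:n, m:]"
    using A2
  proof
    assume "A2 = (\<lambda>z. z)"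
    then have "R = R0 \<circ>\<^sub>p [:n, m:]"
      by (intro poly_ext) (simp add: R poly_pcompose add.commute mult.commute)
    then show ?thesis ..
  next
    assume "A2 = (\<lambda>z. 1 - z)"
    then have "R = 1 - R0 \<circ>\<^sub>p [:n, m:]"
      by (intro poly_ext) (simp add: R poly_pcompose add.commute mult.commute)
    then show ?thesis ..
  qed
  moreover have "degree (R0 \<circ>\<^sub>p [:n, m:]) = degree R0" using m by (simp add: degree_pcompose)
  moreover have "degree (1 - p) = degree p" for p :: "complex poly"
    using degree_add_eq_right[of 1 "-p"] degree_diff_le[of 1 0 p]
    by (cases "degree p = 0") auto
  ultimately show ?thesis by auto
qed

section \<open>Reductions with canonical polynomial\<close>

text \<open>The monic cubic whose roots are the values of $y$ at the singular points $0$, $1$, $d$.\<close>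

definition canonical_cubic :: "nat \<Rightarrow> nat \<Rightarrow> complex \<Rightarrow> complex" where
  "canonical_cubic m k y =
     (if m = 2 then
        (if k = 0 then y * (y\<^sup>2 - 1)
         else if k = 1 then y * (y + 3) * (y - 1)
         else y * (y\<^sup>2 - 2))
      else
        (if k = 0 then y ^ 3 - 1
         else if k = 1 then (y - 4/3) * (y\<^sup>2 + 2/3 * y + 1/3)
         else if k = 2 then (y\<^sup>2 + 5/3 * y + 40/9) * (y - 1)
         else y ^ 3 + 2))"

lemma degree_canonical_poly:
  assumes "m \<in> {2, 3}" "k \<le> m"
  shows "degree (canonical_poly m k) = m + k"
proof -
  have "(m = 2 \<and> (k = 0 \<or> k = 1 \<or> k = 2)) \<or> (m = 3 \<and> (k = 0 \<or> k = 1 \<or> k = 2 \<or> k = 3))"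
    using assms by auto
  then show ?thesis by (elim disjE conjE) (simp_all add: canonical_poly_def)
qed

text \<open>This is the comparison of the coefficients of u in the coordinate y, with \<tau> at y =
  0 and the cubic in place of t (t - 1) (t - d). The factor (m + k)^2 comes from the leading
  coefficients.\<close>

lemma canonical_poly_ode:
  assumes "m \<in> {2, 3}" "k \<le> m"
  shows "(poly (pderiv (canonical_poly m k)) y)\<^sup>2 * canonical_cubic m k y
    = (of_nat (m + k))\<^sup>2 * y * (poly (canonical_poly m k) y * (poly (canonical_poly m k) y - 1))"
proof -
  have "(m = 2 \<and> (k = 0 \<or> k = 1 \<or> k = 2)) \<or> (m = 3 \<and> (k = 0 \<or> k = 1 \<or> k = 2 \<or> k = 3))"
    using assms by auto
  then show ?thesis
    by (elim disjE conjE)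
      (simp_all add: canonical_poly_def canonical_cubic_def pderiv_pCons field_simps eval_nat_numeral)
qed

lemma log_deriv_mult:
  fixes p q :: "complex poly"
  assumes "poly p t \<noteq> 0" "poly q t \<noteq> 0"
  shows "poly (pderiv (p * q)) t / poly (p * q) t
    = poly (pderiv p) t / poly p t + poly (pderiv q) t / poly q t"
  using assms by (simp add: pderiv_mult field_simps)

lemma log_deriv_linear_power:
  fixes t w :: complex
  assumes "t \<noteq> w"
  shows "poly (pderiv ([:-w, 1:] ^ n)) t / poly ([:-w, 1:] ^ n) t = of_nat n / (t - w)"
  using assms by (cases n) (simp_all add: pderiv_power pderiv_pCons del: mult_pCons_left mult_pCons_right
      power_Suc, simp add: divide_simps)

text \<open>Exponents may be 0, so one statement with the points \<tau>, 0, 1, d covers the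
  factorizations of all types.\<close>

lemma log_deriv_factors:
  fixes t \<kappa> w1 w2 w3 w4 :: complex
  assumes "\<kappa> \<noteq> 0" "t \<noteq> w1" "t \<noteq> w2" "t \<noteq> w3" "t \<noteq> w4"
    and p: "\<And>t. poly p t = \<kappa> * ((t - w1) ^ n1 * (t - w2) ^ n2 * (t - w3) ^ n3 * (t - w4) ^ n4)"
  shows "poly (pderiv p) t / poly p t
    = of_nat n1 / (t - w1) + of_nat n2 / (t - w2) + of_nat n3 / (t - w3) + of_nat n4 / (t - w4)"
proof -
  let ?q = "[:-w1, 1:] ^ n1 * [:-w2, 1:] ^ n2 * [:-w3, 1:] ^ n3 * [:-w4, 1:] ^ n4"
  have "p = smult \<kappa> ?q" by (intro poly_ext) (simp add: p)
  then have "poly (pderiv p) t / poly p t = poly (pderiv ?q) t / poly ?q t"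
    using assms(1) by (simp add: pderiv_smult)
  also have "\<dots> = of_nat n1 / (t - w1) + of_nat n2 / (t - w2) + of_nat n3 / (t - w3) + of_nat n4 / (t - w4)"
    using assms(2-5) by (subst log_deriv_mult, simp, simp)+ (simp only: log_deriv_linear_power)
  finally show ?thesis .
qed

text \<open>\<open>eS\<close> and \<open>eO\<close> are the exponent parameters of the hypergeometric equation over $S = 0$ and
  over $S = 1$. If \<open>eO = 1/2\<close>, then the double points over $S = 1$ contribute no residue, and the
  factorization of $S - 1$ is not required.\<close>

lemma canonical_equation_reduction:
  fixes d q \<alpha> \<beta> \<gamma> \<delta> \<epsilon> a b c l \<tau> \<kappa> \<kappa>' eS eO :: complex and R :: "complex \<Rightarrow> complex"
  defines "S \<equiv> \<lambda>m k t. poly (canonical_poly m k) (l * (t - \<tau>))"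
  assumes mk: "m \<in> {2, 3}" "k \<le> m" and l: "l \<noteq> 0"
    and cubic: "\<And>t. canonical_cubic m k (l * (t - \<tau>)) = l ^ 3 * (t * (t - 1) * (t - d))"
    and R: "R = S m k \<and> eS = c \<and> eO = a + b - c + 1 \<or>
            R = (\<lambda>t. 1 - S m k t) \<and> eS = a + b - c + 1 \<and> eO = c"
    and S: "\<kappa> \<noteq> 0" "\<And>t. S m k t = \<kappa> * ((t - \<tau>) ^ m * (t - 0) ^ na * (t - 1) ^ nb * (t - d) ^ nc)"
    and S1: "eO = 1/2 \<or> \<kappa>' \<noteq> 0 \<and>
      (\<forall>t. S m k t - 1 = \<kappa>' * ((t - \<tau>) ^ 0 * (t - 0) ^ ma * (t - 1) ^ mb * (t - d) ^ mc))"
    and exps: "\<And>t. t \<noteq> \<tau> \<Longrightarrow> t \<noteq> 0 \<Longrightarrow> t \<noteq> 1 \<Longrightarrow> t \<noteq> d \<Longrightarrow>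
      (eS - 1/2) * (of_nat m / (t - \<tau>) + of_nat na / (t - 0) + of_nat nb / (t - 1) + of_nat nc / (t - d))
      + (eO - 1/2) * (of_nat ma / (t - 0) + of_nat mb / (t - 1) + of_nat mc / (t - d))
      = (\<gamma> - 1/2) / (t - 0) + (\<delta> - 1/2) / (t - 1) + (\<epsilon> - 1/2) / (t - d) + (1/2) / (t - \<tau>)"
    and ab: "\<alpha> * \<beta> = (of_nat (m + k))\<^sup>2 * (a * b)" and q: "q = \<alpha> * \<beta> * \<tau>"
  shows "equation_reduction d q \<alpha> \<beta> \<gamma> \<delta> \<epsilon> a b c R \<and> (\<exists>P. degree P = m + k \<and> poly P = R)"
proof -
  define N where "N = (of_nat (m + k) :: complex)"
  have N: "N \<noteq> 0" using mk by (auto simp: N_def simp flip: of_nat_add)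
  define Sp where "Sp = canonical_poly m k \<circ>\<^sub>p [:- l * \<tau>, l:]"
  have Sp: "poly Sp = S m k"
    by (intro ext) (simp add: Sp_def S_def poly_pcompose algebra_simps)
  have degSp: "degree Sp = m + k"
    using degree_canonical_poly[OF mk] l by (simp add: Sp_def degree_pcompose)
  have deg1: "degree (1 - Sp) = m + k"
    using degree_add_eq_right[of 1 "- Sp"] degSp mk by auto
  define P where "P = (if R = S m k then Sp else 1 - Sp)"
  have P: "poly P = R" "P = Sp \<or> P = 1 - Sp" "degree P = m + k"
    using R Sp degSp deg1 by (auto simp: P_def fun_eq_iff)
  have dSp: "poly (pderiv Sp) t = l * poly (pderiv (canonical_poly m k)) (l * (t - \<tau>))" for t
    by (simp add: Sp_def pderiv_pcompose poly_pcompose pderiv_pCons algebra_simps)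
  have odeS: "(poly (pderiv Sp) t)\<^sup>2 * (t * (t - 1) * (t - d))
      = N\<^sup>2 * (t - \<tau>) * (poly Sp t * (poly Sp t - 1))" for t
  proof -
    let ?D = "poly (pderiv (canonical_poly m k)) (l * (t - \<tau>))"
    have "l * ((poly (pderiv Sp) t)\<^sup>2 * (t * (t - 1) * (t - d)))
        = ?D\<^sup>2 * canonical_cubic m k (l * (t - \<tau>))"
      unfolding cubic dSp by algebra
    also have "\<dots> = N\<^sup>2 * (l * (t - \<tau>)) * (poly Sp t * (poly Sp t - 1))"
      unfolding canonical_poly_ode[OF mk] Sp by (simp add: S_def N_def)
    finally have "l * ((poly (pderiv Sp) t)\<^sup>2 * (t * (t - 1) * (t - d)))
        = l * (N\<^sup>2 * (t - \<tau>) * (poly Sp t * (poly Sp t - 1)))" by (simp only: mult_ac)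
    then show ?thesis using l by simp
  qed
  \<comment> \<open>The identity is invariant under S -> 1 - S, so it holds for either choice of
    \<open>P\<close>.\<close>
  have ode: "(pderiv P)\<^sup>2 * singular_poly d = smult (N\<^sup>2) ([:-\<tau>, 1:] * (P * (P - 1)))"
  proof (rule poly_ext)
    fix t
    have "poly (pderiv P) t = poly (pderiv Sp) t \<and> poly P t = poly Sp t \<or>
        poly (pderiv P) t = - poly (pderiv Sp) t \<and> poly P t = 1 - poly Sp t"
      using P(2) by (auto simp: pderiv_diff)
    then have "(poly (pderiv P) t)\<^sup>2 * (t * (t - 1) * (t - d))
      = N\<^sup>2 * (t - \<tau>) * (poly P t * (poly P t - 1))"
      using odeS[of t] by (elim disjE conjE) (simp, algebra)
    then show "poly ((pderiv P)\<^sup>2 * singular_poly d) t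
        = poly (smult (N\<^sup>2) ([:-\<tau>, 1:] * (P * (P - 1)))) t"
      by (simp add: algebra_simps)
  qed
  have neP: "P \<noteq> 0" "P - 1 \<noteq> 0" "pderiv P \<noteq> 0"
    using P(3) mk by (auto simp: pderiv_eq_0_iff)
  have neS: "Sp \<noteq> 0" "Sp - 1 \<noteq> 0"
    using degSp mk by auto
  have fin: "\<forall>\<^sub>F t in cofinite. t \<noteq> w" for w :: complex
    by (simp add: eventually_cofinite)
  have "\<forall>\<^sub>F t in cofinite. hyp_p a b c (poly P t) * deriv (poly P) t
        - deriv (deriv (poly P)) t / deriv (poly P) t = heun_p d \<gamma> \<delta> \<epsilon> t \<and>
      hyp_q a b (poly P t) * (deriv (poly P) t)\<^sup>2 = heun_q d q \<alpha> \<beta> t"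
    using fin[of 0] fin[of 1] fin[of d] fin[of \<tau>] poly_nonzero_cofinite[OF neP(1)]
      poly_nonzero_cofinite[OF neP(2)] poly_nonzero_cofinite[OF neP(3)]
  proof eventually_elim
    case (elim t)
    define p p1 p2 x where "p = poly P t" and "p1 = poly (pderiv P) t"
      and "p2 = poly (pderiv (pderiv P)) t" and "x = t * (t - 1) * (t - d)"
    have nz: "p \<noteq> 0" "p - 1 \<noteq> 0" "p1 \<noteq> 0" "x \<noteq> 0" "t - \<tau> \<noteq> 0" "t - 1 \<noteq> 0" "t - d \<noteq> 0" "t \<noteq> 0"
      using elim by (simp_all add: p_def p1_def x_def)
    have ode_t: "p1\<^sup>2 * x = N\<^sup>2 * (t - \<tau>) * (p * (p - 1))"
      using arg_cong[OF ode, of "\<lambda>f. poly f t"]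
      by (simp add: p_def p1_def x_def algebra_simps)
    have q_eq: "hyp_q a b p * p1\<^sup>2 = heun_q d q \<alpha> \<beta> t"
    proof -
      have "p1\<^sup>2 / (p * (p - 1)) = N\<^sup>2 * (t - \<tau>) / x"
        using ode_t nz by (simp add: frac_eq_eq mult.commute)
      moreover have "hyp_q a b p * p1\<^sup>2 = a * b * (p1\<^sup>2 / (p * (p - 1)))"
        by (simp add: hyp_q_def)
      ultimately have "hyp_q a b p * p1\<^sup>2 = a * b * (N\<^sup>2 * (t - \<tau>) / x)"
        by (simp only:)
      also have "\<dots> = (\<alpha> * \<beta> * t - q) / x"
        unfolding q ab N_def by (simp add: algebra_simps)
      finally show ?thesis by (simp add: heun_q_def x_def)
    qed
    \<comment> \<open>Logarithmic differentiation of \<open>ode\<close> expresses 2 P''/P' by P'/P,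
      P'/(P - 1) and simple fractions; this removes the second derivative from the coefficient of
      u'.\<close>
    define x1 where "x1 = (t - 1) * (t - d) + t * (t - d) + t * (t - 1)"
    have "poly (pderiv (singular_poly d)) t = x1"
      unfolding singular_poly_def x1_def pderiv_mult
      by (simp add: pderiv_pCons algebra_simps)
    then have "poly (pderiv ((pderiv P)\<^sup>2 * singular_poly d)) t = 2 * p1 * p2 * x + p1\<^sup>2 * x1"
      unfolding pderiv_mult power2_eq_square p1_def p2_def x_def
      by simp
    moreover have "poly (pderiv (smult (N\<^sup>2) ([:-\<tau>, 1:] * (P * (P - 1))))) t
        = N\<^sup>2 * (p * (p - 1) + (t - \<tau>) * (p1 * (2 * p - 1)))"
      unfolding pderiv_smult pderiv_mult pderiv_diff p_def p1_def
      by (simp add: pderiv_pCons) algebra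
    ultimately have "2 * p1 * p2 * x + p1\<^sup>2 * x1 = N\<^sup>2 * (p * (p - 1) + (t - \<tau>) * (p1 * (2 * p - 1)))"
      using ode by simp
    then have "(2 * p1 * p2 * x + p1\<^sup>2 * x1) / (p1\<^sup>2 * x)
        = N\<^sup>2 * (p * (p - 1) + (t - \<tau>) * (p1 * (2 * p - 1))) / (N\<^sup>2 * (t - \<tau>) * (p * (p - 1)))"
      by (simp only: ode_t)
    moreover have "(2 * p1 * p2 * x + p1\<^sup>2 * x1) / (p1\<^sup>2 * x) = 2 * (p2 / p1) + x1 / x"
      using nz by (simp add: add_divide_distrib power2_eq_square)
    moreover have "x1 / x = 1 / t + 1 / (t - 1) + 1 / (t - d)"
      using nz by (simp add: x1_def x_def add_divide_distrib)
    moreover have "N\<^sup>2 * (p * (p - 1) + (t - \<tau>) * (p1 * (2 * p - 1))) / (N\<^sup>2 * (t - \<tau>) * (p * (p - 1)))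
        = 1 / (t - \<tau>) + p1 * (2 * p - 1) / (p * (p - 1))"
      using nz N by (simp add: add_divide_distrib distrib_left)
    moreover have "p1 * (2 * p - 1) / (p * (p - 1)) = p1 / p + p1 / (p - 1)"
      using nz by (simp add: add_frac_eq) (simp add: algebra_simps)
    ultimately have p2: "2 * (p2 / p1) = 1 / (t - \<tau>) + (p1 / p + p1 / (p - 1))
        - (1 / t + 1 / (t - 1) + 1 / (t - d))"
      by (simp add: algebra_simps)
    define s s1 where "s = poly Sp t" and "s1 = poly (pderiv Sp) t"
    have LS: "s1 / s = of_nat m / (t - \<tau>) + of_nat na / (t - 0) + of_nat nb / (t - 1) + of_nat nc / (t - d)"
      unfolding s_def s1_def by (rule log_deriv_factors[OF S(1)]) (use elim S(2) Sp in auto)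
    have LS1: "(eO - 1/2) * (s1 / (s - 1))
       = (eO - 1/2) * (of_nat ma / (t - 0) + of_nat mb / (t - 1) + of_nat mc / (t - d))"
    proof (cases "eO = 1/2")
      case False
      with S1 have k': "\<kappa>' \<noteq> 0" and
        e: "\<And>t. S m k t - 1 = \<kappa>' * ((t - \<tau>) ^ 0 * (t - 0) ^ ma * (t - 1) ^ mb * (t - d) ^ mc)"
        by blast+
      have "poly (pderiv (Sp - 1)) t / poly (Sp - 1) t
         = of_nat 0 / (t - \<tau>) + of_nat ma / (t - 0) + of_nat mb / (t - 1) + of_nat mc / (t - d)"
        by (rule log_deriv_factors[OF k']) (use elim e Sp in auto)
      then show ?thesis by (simp add: s_def s1_def pderiv_diff)
    qed (simp only: diff_self mult_zero_left)
    \<comment> \<open>Inserting that expression for P''/P' lowers every exponent parameter by 1/2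
      and adds the term at \<tau>; this is the origin of the halves in \<open>exps\<close>.\<close>
    have "(c - 1/2) * (p1 / p) + (a + b - c + 1 - 1/2) * (p1 / (p - 1))
        = (eS - 1/2) * (s1 / s) + (eO - 1/2) * (s1 / (s - 1))"
    proof -
      have "(p = s \<and> p1 = s1 \<and> eS = c \<and> eO = a + b - c + 1) \<or>
          (p = 1 - s \<and> p1 = - s1 \<and> eS = a + b - c + 1 \<and> eO = c)"
      proof (cases "R = S m k \<and> eS = c \<and> eO = a + b - c + 1")
        case True
        then show ?thesis by (simp add: P_def p_def p1_def s_def s1_def)
      next
        case False
        then have R': "R = (\<lambda>t. 1 - S m k t)" "eS = a + b - c + 1" "eO = c" using R by blast+
        have "P = 1 - Sp" by (intro poly_ext) (simp add: P(1) R' Sp)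
        then show ?thesis using R' by (simp add: p_def p1_def s_def s1_def pderiv_diff)
      qed
      then show ?thesis
      proof (elim disjE conjE)
        assume *: "p = 1 - s" "p1 = - s1" "eS = a + b - c + 1" "eO = c"
        have "- s1 / (1 - s) = s1 / (s - 1)" by (metis minus_diff_eq minus_divide_divide minus_minus)
        moreover have "1 - s - 1 = - s" by simp
        ultimately show ?thesis unfolding * by simp
      qed simp
    qed
    also have "\<dots> = (\<gamma> - 1/2) / (t - 0) + (\<delta> - 1/2) / (t - 1) + (\<epsilon> - 1/2) / (t - d) + (1/2) / (t - \<tau>)"
      unfolding LS LS1 using elim by (intro exps) auto
    finally have main: "(c - 1/2) * (p1 / p) + (a + b - c + 1 - 1/2) * (p1 / (p - 1))
      = (\<gamma> - 1/2) / (t - 0) + (\<delta> - 1/2) / (t - 1) + (\<epsilon> - 1/2) / (t - d) + (1/2) / (t - \<tau>)" .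
    define y0 y1 y2 y3 z0 z1 z2 where y: "y0 = 1 / t" "y1 = 1 / (t - 1)" "y2 = 1 / (t - d)" "y3 = 1 / (t - \<tau>)"
       "z0 = p1 / p" "z1 = p1 / (p - 1)" "z2 = p2 / p1"
    define u w where "u = c * z0 + (a + b - c + 1) * z1" and "w = \<gamma> * y0 + \<delta> * y1 + \<epsilon> * y2"
    have z2: "2 * z2 = y3 + (z0 + z1) - (y0 + y1 + y2)"
      using p2 unfolding y .
    have "2 * u - (z0 + z1) = 2 * w - (y0 + y1 + y2) + y3"
    proof -
      have "2 * u - (z0 + z1) = 2 * ((c - 1/2) * z0 + (a + b - c + 1 - 1/2) * z1)"
        by (simp add: u_def algebra_simps)
      also have "(c - 1/2) * z0 + (a + b - c + 1 - 1/2) * z1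
          = (\<gamma> - 1/2) * y0 + (\<delta> - 1/2) * y1 + (\<epsilon> - 1/2) * y2 + (1/2) * y3"
        using main unfolding y by simp
      also have "2 * \<dots> = 2 * w - (y0 + y1 + y2) + y3"
        unfolding w_def by (simp add: left_diff_distrib distrib_left right_diff_distrib mult.assoc)
      finally show ?thesis .
    qed
    then have "2 * u = 2 * w + (y3 + (z0 + z1) - (y0 + y1 + y2))"
      by (simp add: algebra_simps)
    then have "2 * u - 2 * z2 = 2 * w" unfolding z2[symmetric] by simp
    then have "2 * (u - z2) = 2 * w" by (simp only: right_diff_distrib)
    then have "u - z2 = w" by (subst (asm) mult_cancel_left) simp
    then have "c * z0 + (a + b - c + 1) * z1 - z2 = \<gamma> * y0 + \<delta> * y1 + \<epsilon> * y2"
      unfolding u_def w_def .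
    then have "hyp_p a b c p * p1 - p2 / p1 = heun_p d \<gamma> \<delta> \<epsilon> t"
      unfolding y hyp_p_def heun_p_def by (simp add: distrib_right)
    with q_eq show ?case by (simp add: deriv_poly p_def p1_def p2_def)
  qed
  then have "equation_reduction d q \<alpha> \<beta> \<gamma> \<delta> \<epsilon> a b c R"
    unfolding equation_reduction_def P(1) .
  with P show ?thesis by blast
qed

section \<open>Explicit reductions for the seven representatives\<close>

lemma Real2_reduction:
  "equation_reduction 2 (\<alpha> * \<beta>) \<alpha> \<beta> \<gamma> (\<alpha> + \<beta> - 2 * \<gamma> + 1) (\<alpha> + \<beta> - \<gamma> - (\<alpha> + \<beta> - 2 * \<gamma> + 1) + 1)
     (\<alpha> / 2) (\<beta> / 2) \<gamma> (\<lambda>t. t * (2 - t)) \<and>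
   (\<exists>P. degree P = 2 + 0 \<and> poly P = (\<lambda>t::complex. t * (2 - t)))"
\<comment> \<open>Here S = (t - 1)^2, R = 1 - S and S - 1 = t (t - 2). Without double points over S
  = 1 the parameter \<open>eO\<close> need not be 1/2, and \<gamma> remains free.\<close>
proof (rule canonical_equation_reduction[where l = 1 and \<tau> = 1 and \<kappa> = 1 and \<kappa>' = 1
      and na = 0 and nb = 0 and nc = 0 and ma = 1 and mb = 0 and mc = 1
      and eS = "\<alpha> / 2 + \<beta> / 2 - \<gamma> + 1" and eO = \<gamma>])
  show "canonical_cubic 2 0 (1 * (t - 1)) = 1 ^ 3 * (t * (t - 1) * (t - 2))" for t
    by (simp add: canonical_cubic_def power2_eq_square algebra_simps)
  show "(\<lambda>t. t * (2 - t)) = (\<lambda>t. poly (canonical_poly 2 0) (1 * (t - 1))) \<and>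
      \<alpha> / 2 + \<beta> / 2 - \<gamma> + 1 = \<gamma> \<and> \<gamma> = \<alpha> / 2 + \<beta> / 2 - \<gamma> + 1 \<or>
      (\<lambda>t. t * (2 - t)) = (\<lambda>t. 1 - poly (canonical_poly 2 0) (1 * (t - 1))) \<and>
      \<alpha> / 2 + \<beta> / 2 - \<gamma> + 1 = \<alpha> / 2 + \<beta> / 2 - \<gamma> + 1 \<and> \<gamma> = \<gamma>"
    by (simp add: poly_canonical_poly fun_eq_iff power2_eq_square algebra_simps)
qed (simp_all add: poly_canonical_poly divide_inverse[of _ "_ - _"] power2_eq_square
    algebra_simps add_divide_distrib diff_divide_distrib)

lemma Real3_reduction:
  "equation_reduction 4 (\<alpha> * \<beta>) \<alpha> \<beta> (1/2) (2 * (\<alpha> + \<beta>) / 3) (\<alpha> + \<beta> - 1/2 - 2 * (\<alpha> + \<beta>) / 3 + 1)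
     (\<alpha> / 3) (\<beta> / 3) (1/2) (\<lambda>t. 1 - (t - 1)^2 * (1 - t/4)) \<and>
   (\<exists>P. degree P = 2 + 1 \<and> poly P = (\<lambda>t::complex. 1 - (t - 1)^2 * (1 - t/4)))"
proof -
  have C: "poly (canonical_poly 2 1) (- 1 * (t - 1)) = (t - 1)\<^sup>2 * (1 - t / 4)" for t
    unfolding poly_canonical_poly by (simp add: power2_eq_square field_simps)
  show ?thesis
  \<comment> \<open>The coordinate y = 1 - t sends 0, 1, 4 to the roots 1, 0, -3 of the canonical
    cubic.\<close>
  proof (rule canonical_equation_reduction[where l = "-1" and \<tau> = 1 and \<kappa> = "-1/4"
        and na = 0 and nb = 0 and nc = 1
        and eS = "\<alpha> / 3 + \<beta> / 3 - 1/2 + 1" and eO = "1/2"])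
    show "canonical_cubic 2 1 (- 1 * (t - 1)) = (- 1) ^ 3 * (t * (t - 1) * (t - 4))" for t
      by (simp add: canonical_cubic_def power2_eq_square algebra_simps)
    show "poly (canonical_poly 2 1) (- 1 * (t - 1))
        = - 1 / 4 * ((t - 1) ^ 2 * (t - 0) ^ 0 * (t - 1) ^ 0 * (t - 4) ^ 1)" for t
      unfolding C by (simp add: field_simps)
    show "(\<lambda>t. 1 - (t - 1)\<^sup>2 * (1 - t / 4)) = (\<lambda>t. poly (canonical_poly 2 1) (- 1 * (t - 1))) \<and>
        \<alpha> / 3 + \<beta> / 3 - 1 / 2 + 1 = 1 / 2 \<and> 1 / 2 = \<alpha> / 3 + \<beta> / 3 - 1 / 2 + 1 \<or>
      (\<lambda>t. 1 - (t - 1)\<^sup>2 * (1 - t / 4)) = (\<lambda>t. 1 - poly (canonical_poly 2 1) (- 1 * (t - 1))) \<and>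
        \<alpha> / 3 + \<beta> / 3 - 1 / 2 + 1 = \<alpha> / 3 + \<beta> / 3 - 1 / 2 + 1 \<and> 1 / 2 = (1 / 2 :: complex)"
      unfolding C by simp
  qed (simp_all add: divide_inverse[of _ "_ - _"] algebra_simps add_divide_distrib)
qed

lemma Real4_reduction:
  "equation_reduction 2 (\<alpha> * \<beta>) \<alpha> \<beta> ((\<alpha> + \<beta> + 2) / 4) ((\<alpha> + \<beta>) / 2)
     (\<alpha> + \<beta> - (\<alpha> + \<beta> + 2) / 4 - (\<alpha> + \<beta>) / 2 + 1)
     (\<alpha> / 4) (\<beta> / 4) ((\<alpha> + \<beta> + 2) / 4) (\<lambda>t. 1 - 4 * (t * (2 - t) - 1/2)^2) \<and>
   (\<exists>P. degree P = 2 + 2 \<and> poly P = (\<lambda>t::complex. 1 - 4 * (t * (2 - t) - 1/2)^2))"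
proof -
  \<comment> \<open>The roots of the canonical cubic with y^2 = 2 have to be the images of t = 0 and
    t = 2, at distance 1 from \<tau> = 1.\<close>
  obtain l :: complex where l: "l\<^sup>2 = 2" using nth_root_exists[of 2 2] by auto
  then have l2: "l\<^sup>2 = 2" "l \<noteq> 0" by auto
  have C: "poly (canonical_poly 2 2) (l * (t - 1)) = 2 * (t - 1)\<^sup>2 * (2 - 2 * (t - 1)\<^sup>2)" for t
    by (simp only: poly_canonical_poly power_mult_distrib l2)
  show ?thesis
  proof (rule canonical_equation_reduction[where l = l and \<tau> = 1 and \<kappa> = "-4"
      and na = 1 and nb = 0 and nc = 1
      and eS = "(\<alpha> + \<beta> + 2) / 4" and eO = "1/2"])
    show "canonical_cubic 2 2 (l * (t - 1)) = l ^ 3 * (t * (t - 1) * (t - 2))" for t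
    proof -
      have "canonical_cubic 2 2 (l * (t - 1)) = l * (t - 1) * (l\<^sup>2 * (t - 1)\<^sup>2 - 2)"
        by (simp add: canonical_cubic_def power_mult_distrib)
      also have "\<dots> = l * (l\<^sup>2 * (t * (t - 1) * (t - 2)))"
        unfolding l by (simp add: power2_eq_square algebra_simps)
      also have "\<dots> = l ^ 3 * (t * (t - 1) * (t - 2))"
        by (simp add: power2_eq_square power3_eq_cube)
      finally show ?thesis .
    qed
    show "poly (canonical_poly 2 2) (l * (t - 1))
        = - 4 * ((t - 1) ^ 2 * (t - 0) ^ 1 * (t - 1) ^ 0 * (t - 2) ^ 1)" for t
      unfolding C by (simp add: power2_eq_square algebra_simps)
    have "1 - 4 * (t * (2 - t) - 1 / 2)\<^sup>2 = poly (canonical_poly 2 2) (l * (t - 1))" for t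
      unfolding C by (simp add: power2_eq_square field_simps)
    then show "(\<lambda>t. 1 - 4 * (t * (2 - t) - 1 / 2)\<^sup>2) = (\<lambda>t. poly (canonical_poly 2 2) (l * (t - 1))) \<and>
        (\<alpha> + \<beta> + 2) / 4 = (\<alpha> + \<beta> + 2) / 4 \<and> 1 / 2 = \<alpha> / 4 + \<beta> / 4 - (\<alpha> + \<beta> + 2) / 4 + 1 \<or>
      (\<lambda>t. 1 - 4 * (t * (2 - t) - 1 / 2)\<^sup>2) = (\<lambda>t. 1 - poly (canonical_poly 2 2) (l * (t - 1))) \<and>
        (\<alpha> + \<beta> + 2) / 4 = \<alpha> / 4 + \<beta> / 4 - (\<alpha> + \<beta> + 2) / 4 + 1 \<and> 1 / 2 = (\<alpha> + \<beta> + 2) / 4"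
      by (simp add: add_divide_distrib)
  qed (simp_all add: l2 divide_inverse[of _ "_ - _"] power2_eq_square algebra_simps add_divide_distrib)
qed

text \<open>The two equations for d say that \<tau>^3 - (\<tau> - t)^3 = t (t - 1) (t - d), i.e.
  that 0, 1, d are the vertices of an equilateral triangle with center \<tau>. All three exponents
  agree because 3 c = \<alpha> + \<beta> + 1.\<close>

lemma Nonreal3_reduction:
  assumes d: "d = 3 * \<tau> - 1" "d = 3 * \<tau>\<^sup>2" and \<tau>: "\<tau> \<noteq> 0" and c: "c = (\<alpha> + \<beta> + 1) / 3"
  shows "equation_reduction d (\<alpha> * \<beta> * \<tau>) \<alpha> \<beta> c c (\<alpha> + \<beta> - c - c + 1)
     (\<alpha> / 3) (\<beta> / 3) c (\<lambda>t. 1 - (1 - t / \<tau>) ^ 3) \<and>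
   (\<exists>P. degree P = 3 + 0 \<and> poly P = (\<lambda>t::complex. 1 - (1 - t / \<tau>) ^ 3))"
proof -
  have C: "poly (canonical_poly 3 0) (- 1 / \<tau> * (t - \<tau>)) = (1 - t / \<tau>) ^ 3" for t
    unfolding poly_canonical_poly using \<tau> by (intro arg_cong[of _ _ "\<lambda>x. x ^ 3"]) (simp add: field_simps)
  have C': "(1 - t / \<tau>) ^ 3 = - 1 / \<tau> ^ 3 * (t - \<tau>) ^ 3" for t
    using \<tau> by (simp add: field_simps power3_eq_cube)
  have cubic: "(1 - t / \<tau>) ^ 3 - 1 = (- 1 / \<tau>) ^ 3 * (t * (t - 1) * (t - d))" for t
  proof -
    have "\<tau> ^ 3 - (\<tau> - t) ^ 3 = t * (t - 1) * (t - d)" using d by algebra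
    then show ?thesis using \<tau> unfolding C' by (simp add: field_simps) algebra
  qed
  have "3 * c = \<alpha> + \<beta> + 1" unfolding c by simp
  then have e: "\<alpha> + \<beta> = 3 * c - 1" by algebra
  show ?thesis
  proof (rule canonical_equation_reduction[where l = "- 1 / \<tau>" and \<tau> = \<tau> and \<kappa> = "- 1 / \<tau> ^ 3" and \<kappa>' = "(- 1 / \<tau>) ^ 3"
      and na = 0 and nb = 0 and nc = 0 and ma = 1 and mb = 1 and mc = 1
      and eS = "2/3" and eO = c])
    show "canonical_cubic 3 0 (- 1 / \<tau> * (t - \<tau>)) = (- 1 / \<tau>) ^ 3 * (t * (t - 1) * (t - d))" for t
      using cubic[of t] C[of t] by (simp add: canonical_cubic_def poly_canonical_poly)
    show "poly (canonical_poly 3 0) (- 1 / \<tau> * (t - \<tau>))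
        = - 1 / \<tau> ^ 3 * ((t - \<tau>) ^ 3 * (t - 0) ^ 0 * (t - 1) ^ 0 * (t - d) ^ 0)" for t
      unfolding C C' by simp
    show "c = 1 / 2 \<or> (- 1 / \<tau>) ^ 3 \<noteq> 0 \<and> (\<forall>t. poly (canonical_poly 3 0) (- 1 / \<tau> * (t - \<tau>)) - 1
        = (- 1 / \<tau>) ^ 3 * ((t - \<tau>) ^ 0 * (t - 0) ^ 1 * (t - 1) ^ 1 * (t - d) ^ 1))"
      unfolding C cubic using \<tau> by simp
    have "\<alpha> / 3 + \<beta> / 3 = c - 1/3" using c by (simp add: add_divide_distrib)
    then show "(\<lambda>t. 1 - (1 - t / \<tau>) ^ 3) = (\<lambda>t. poly (canonical_poly 3 0) (- 1 / \<tau> * (t - \<tau>))) \<and>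
        2 / 3 = c \<and> c = \<alpha> / 3 + \<beta> / 3 - c + 1 \<or>
      (\<lambda>t. 1 - (1 - t / \<tau>) ^ 3) = (\<lambda>t. 1 - poly (canonical_poly 3 0) (- 1 / \<tau> * (t - \<tau>))) \<and>
        2 / 3 = \<alpha> / 3 + \<beta> / 3 - c + 1 \<and> c = c"
      unfolding C by simp
  qed (use \<tau> e in \<open>simp_all add: divide_inverse[of _ "_ - _"] power2_eq_square algebra_simps
      add_divide_distrib diff_divide_distrib\<close>)
qed

lemma Nonreal6_reduction:
  assumes d: "d = 3 * \<tau> - 1" "d = 3 * \<tau>\<^sup>2" and \<tau>: "\<tau> \<noteq> 0"
  shows "equation_reduction d (\<alpha> * (1 - \<alpha>) * \<tau>) \<alpha> (1 - \<alpha>) (2/3) (2/3) (\<alpha> + (1 - \<alpha>) - 2/3 - 2/3 + 1)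
     (\<alpha> / 6) (1/6 - \<alpha> / 6) (2/3) (\<lambda>t. 1 - 4 * ((1 - t / \<tau>) ^ 3 - 1/2)\<^sup>2) \<and>
   (\<exists>P. degree P = 3 + 3 \<and> poly P = (\<lambda>t::complex. 1 - 4 * ((1 - t / \<tau>) ^ 3 - 1/2)\<^sup>2))"
proof -
  \<comment> \<open>This scale gives y^3 = -2 at t = 0, a root of the canonical cubic y^3 +
    2.\<close>
  obtain l where l: "l ^ 3 = 2 / \<tau> ^ 3" using nth_root_exists[of 3 "2 / \<tau> ^ 3"] by auto
  then have l0: "l \<noteq> 0" using \<tau> by auto
  have C': "(1 - t / \<tau>) ^ 3 = - 1 / \<tau> ^ 3 * (t - \<tau>) ^ 3" for t
    using \<tau> by (simp add: field_simps power3_eq_cube)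
  have cubic: "(1 - t / \<tau>) ^ 3 - 1 = - 1 / \<tau> ^ 3 * (t * (t - 1) * (t - d))" for t
  proof -
    have "\<tau> ^ 3 - (\<tau> - t) ^ 3 = t * (t - 1) * (t - d)" using d by algebra
    then show ?thesis using \<tau> unfolding C' by (simp add: field_simps) algebra
  qed
  have y: "(l * (t - \<tau>)) ^ 3 = - 2 * (1 - t / \<tau>) ^ 3" for t
    unfolding C' power_mult_distrib l by simp
  have C: "poly (canonical_poly 3 3) (l * (t - \<tau>)) = 1 - 4 * ((1 - t / \<tau>) ^ 3 - 1/2)\<^sup>2" for t
    unfolding poly_canonical_poly y by (simp add: power2_eq_square algebra_simps)
  show ?thesis
  proof (rule canonical_equation_reduction[where l = l and \<tau> = \<tau> and \<kappa> = "- 4 / \<tau> ^ 6"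
      and na = 1 and nb = 1 and nc = 1 and eS = "2/3" and eO = "1/2"])
    show "canonical_cubic 3 3 (l * (t - \<tau>)) = l ^ 3 * (t * (t - 1) * (t - d))" for t
    proof -
      have "canonical_cubic 3 3 (l * (t - \<tau>)) = - 2 * ((1 - t / \<tau>) ^ 3 - 1)"
        by (simp add: canonical_cubic_def y)
      then show ?thesis unfolding cubic l by simp
    qed
    show "poly (canonical_poly 3 3) (l * (t - \<tau>))
        = - 4 / \<tau> ^ 6 * ((t - \<tau>) ^ 3 * (t - 0) ^ 1 * (t - 1) ^ 1 * (t - d) ^ 1)" for t
    proof -
      have "poly (canonical_poly 3 3) (l * (t - \<tau>)) = - 4 * ((1 - t / \<tau>) ^ 3 * ((1 - t / \<tau>) ^ 3 - 1))"
        unfolding poly_canonical_poly y by (simp add: algebra_simps)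
      also have "\<dots> = - 4 * ((- 1 / \<tau> ^ 3 * (t - \<tau>) ^ 3) * (- 1 / \<tau> ^ 3 * (t * (t - 1) * (t - d))))"
        unfolding cubic unfolding C' ..
      also have "\<dots> = - 4 / \<tau> ^ 6 * ((t - \<tau>) ^ 3 * (t - 0) ^ 1 * (t - 1) ^ 1 * (t - d) ^ 1)"
        by (simp add: power_numeral_reduce mult.assoc)
      finally show ?thesis .
    qed
    show "(\<lambda>t. 1 - 4 * ((1 - t / \<tau>) ^ 3 - 1 / 2)\<^sup>2) = (\<lambda>t. poly (canonical_poly 3 3) (l * (t - \<tau>))) \<and>
        2 / 3 = (2 / 3 :: complex) \<and> 1 / 2 = \<alpha> / 6 + (1 / 6 - \<alpha> / 6) - 2 / 3 + 1 \<or>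
      (\<lambda>t. 1 - 4 * ((1 - t / \<tau>) ^ 3 - 1 / 2)\<^sup>2) = (\<lambda>t. 1 - poly (canonical_poly 3 3) (l * (t - \<tau>))) \<and>
        2 / 3 = \<alpha> / 6 + (1 / 6 - \<alpha> / 6) - 2 / 3 + 1 \<and> 1 / 2 = (2 / 3 :: complex)"
      unfolding C by simp
  qed (use \<tau> l0 in \<open>auto simp: power2_eq_square algebra_simps
      add_divide_distrib diff_divide_distrib\<close>)
qed

lemma Nonreal4_reduction:
  assumes j: "j\<^sup>2 = - 2" and d: "d = 1/2 + 5 * j / 4" and \<tau>: "\<tau> = 1/2 + j / 4"
  shows "equation_reduction d (\<alpha> * (2/3 - \<alpha>) * \<tau>) \<alpha> (2/3 - \<alpha>) (1/2) (1/2) (\<alpha> + (2/3 - \<alpha>) - 1/2 - 1/2 + 1)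
     (\<alpha> / 4) (1/6 - \<alpha> / 4) (1/2) (\<lambda>t. 1 - (1 - t / d) * (1 - t / \<tau>) ^ 3) \<and>
   (\<exists>P. degree P = 3 + 1 \<and> poly P = (\<lambda>t::complex. 1 - (1 - t / d) * (1 - t / \<tau>) ^ 3))"
proof -
  have jj: "j * j = - 2" "j * (j * x) = - 2 * x" for x
    using j by (simp_all add: power2_eq_square flip: mult.assoc)
  \<comment> \<open>Since d - \<tau> = j and j^2 = -2, this scale sends d to y = 4/3, the root of
    the linear factor of the canonical cubic; 0 and 1 go to the roots of the quadratic
    factor.\<close>
  define l where "l = - 2 * j / 3"
  have "j \<noteq> 0" using j by auto
  then have l0: "l \<noteq> 0" by (simp add: l_def)
  have lj: "3 * l = - 2 * j" and dj: "4 * d = 2 + 5 * j" and \<tau>j: "4 * \<tau> = 2 + j"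
    by (simp_all add: l_def d \<tau> field_simps)
  \<comment> \<open>The leading coefficient of (1 - t/d) (1 - t/\<tau>)^3 is 1/(d \<tau>^3).\<close>
  have d\<tau>: "64 * (d * \<tau> ^ 3) = - 27"
  proof -
    have "256 * (d * \<tau> ^ 3) = (4 * d) * (4 * \<tau>) ^ 3" by (simp add: power_mult_distrib)
    also have "\<dots> = (2 + 5 * j) * (2 + j) ^ 3" unfolding dj \<tau>j ..
    also have "\<dots> = - 108" using j by algebra
    finally show ?thesis by simp
  qed
  then have nz: "d \<noteq> 0" "\<tau> \<noteq> 0" by auto
  have \<kappa>: "(1 - t / d) * (1 - t / \<tau>) ^ 3 = - 64 / 27 * ((t - \<tau>) ^ 3 * (t - d))" for t
  proof -
    have "(1 - t / d) * (1 - t / \<tau>) ^ 3 = ((t - \<tau>) ^ 3 * (t - d)) / (d * \<tau> ^ 3)"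
      using nz by (simp add: field_simps power3_eq_cube)
    also have "d * \<tau> ^ 3 = - 27 / 64" using d\<tau> by (simp add: field_simps)
    finally show ?thesis by simp
  qed
  have l43: "l * (t - \<tau>) - 4/3 = l * (t - d)" for t
    unfolding l_def d \<tau> by (simp add: field_simps jj)
  have quad: "(l * (t - \<tau>))\<^sup>2 + 2/3 * (l * (t - \<tau>)) + 1/3 = l\<^sup>2 * (t * (t - 1))" for t
    unfolding l_def d \<tau> by (simp add: field_simps power2_eq_square jj)
  have C: "poly (canonical_poly 3 1) (l * (t - \<tau>)) = (1 - t / d) * (1 - t / \<tau>) ^ 3" for t
  proof -
    have "4 - 3 * (l * (t - \<tau>)) = - 3 * (l * (t - d))" unfolding l43[symmetric] by simp
    then have "poly (canonical_poly 3 1) (l * (t - \<tau>)) = - 3 * l ^ 4 * ((t - \<tau>) ^ 3 * (t - d))"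
      unfolding poly_canonical_poly by (simp add: power_mult_distrib eval_nat_numeral)
    also have "l ^ 4 = 64 / 81"
      unfolding l_def by (simp add: eval_nat_numeral jj)
    finally show ?thesis unfolding \<kappa> by simp
  qed
  show ?thesis
  proof (rule canonical_equation_reduction[where l = l and \<tau> = \<tau> and \<kappa> = "- 64 / 27"
      and na = 0 and nb = 0 and nc = 1 and eS = "2/3" and eO = "1/2"])
    show "canonical_cubic 3 1 (l * (t - \<tau>)) = l ^ 3 * (t * (t - 1) * (t - d))" for t
    proof -
      have e: "canonical_cubic 3 1 y = (y - 4/3) * (y\<^sup>2 + 2/3 * y + 1/3)" for y
        by (simp add: canonical_cubic_def)
      show ?thesis unfolding e l43 quad by (simp add: eval_nat_numeral)
    qed
    show "poly (canonical_poly 3 1) (l * (t - \<tau>))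
        = - 64 / 27 * ((t - \<tau>) ^ 3 * (t - 0) ^ 0 * (t - 1) ^ 0 * (t - d) ^ 1)" for t
      unfolding C \<kappa> by simp
    show "(\<lambda>t. 1 - (1 - t / d) * (1 - t / \<tau>) ^ 3) = (\<lambda>t. poly (canonical_poly 3 1) (l * (t - \<tau>))) \<and>
        2 / 3 = (1 / 2 :: complex) \<and> 1 / 2 = \<alpha> / 4 + (1 / 6 - \<alpha> / 4) - 1 / 2 + 1 \<or>
      (\<lambda>t. 1 - (1 - t / d) * (1 - t / \<tau>) ^ 3) = (\<lambda>t. 1 - poly (canonical_poly 3 1) (l * (t - \<tau>))) \<and>
        2 / 3 = \<alpha> / 4 + (1 / 6 - \<alpha> / 4) - 1 / 2 + 1 \<and> 1 / 2 = (1 / 2 :: complex)"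
      unfolding C by simp
  qed (use l0 in \<open>auto simp: power2_eq_square algebra_simps
      add_divide_distrib diff_divide_distrib\<close>)
qed

lemma Nonreal5_reduction:
  assumes j: "j\<^sup>2 = - 15" and d: "d = 1/2 + 11 * j / 90" and \<tau>: "\<tau> = 1/2 + j / 18"
  shows "equation_reduction d (\<alpha> * (5/6 - \<alpha>) * \<tau>) \<alpha> (5/6 - \<alpha>) (2/3) (2/3) (\<alpha> + (5/6 - \<alpha>) - 2/3 - 2/3 + 1)
     (\<alpha> / 5) (1/6 - \<alpha> / 5) (2/3) (\<lambda>t. (- 2025 * j / 64) * t * (t - 1) * (t - \<tau>) ^ 3) \<and>
   (\<exists>P. degree P = 3 + 2 \<and> poly P = (\<lambda>t::complex. (- 2025 * j / 64) * t * (t - 1) * (t - \<tau>) ^ 3))"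
proof -
  have jj: "j * j = - 15" "j * (j * x) = - 15 * x" for x
    using j by (simp_all add: power2_eq_square flip: mult.assoc)
  \<comment> \<open>Since d - \<tau> = j/15 and j^2 = -15, this scale sends d to y = 1, the simple
    root of S - 1; the leading coefficient of S becomes 9/64 \<open>l ^ 5\<close>.\<close>
  define l where "l = - j"
  have j0: "j \<noteq> 0" using j by auto
  then have l0: "l \<noteq> 0" by (simp add: l_def)
  have l1: "l * (t - \<tau>) - 1 = l * (t - d)" for t
    unfolding l_def d \<tau> by (simp add: field_simps jj)
  have quad: "(l * (t - \<tau>))\<^sup>2 + 5/3 * (l * (t - \<tau>)) + 40/9 = l\<^sup>2 * (t * (t - 1))" for t
    unfolding l_def d \<tau> by (simp add: field_simps power2_eq_square jj)
  have C: "poly (canonical_poly 3 2) (l * (t - \<tau>)) = (- 2025 * j / 64) * t * (t - 1) * (t - \<tau>) ^ 3" for t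
  proof -
    have "poly (canonical_poly 3 2) (l * (t - \<tau>))
        = 9 / 64 * (l * (t - \<tau>)) ^ 3 * ((l * (t - \<tau>))\<^sup>2 + 5/3 * (l * (t - \<tau>)) + 40/9)"
      unfolding poly_canonical_poly by (simp add: field_simps)
    also have "\<dots> = 9 / 64 * l ^ 5 * t * (t - 1) * (t - \<tau>) ^ 3"
      unfolding quad by (simp add: power_mult_distrib eval_nat_numeral)
    also have "l ^ 5 = - 225 * j"
      unfolding l_def by (simp add: eval_nat_numeral jj)
    finally show ?thesis by simp
  qed
  show ?thesis
  proof (rule canonical_equation_reduction[where l = l and \<tau> = \<tau> and \<kappa> = "- 2025 * j / 64"
      and na = 1 and nb = 1 and nc = 0 and eS = "2/3" and eO = "1/2"])
    show "canonical_cubic 3 2 (l * (t - \<tau>)) = l ^ 3 * (t * (t - 1) * (t - d))" for t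
    proof -
      have e: "canonical_cubic 3 2 y = (y\<^sup>2 + 5/3 * y + 40/9) * (y - 1)" for y
        by (simp add: canonical_cubic_def)
      show ?thesis unfolding e l1 quad by (simp add: eval_nat_numeral)
    qed
    show "poly (canonical_poly 3 2) (l * (t - \<tau>))
        = (- 2025 * j / 64) * ((t - \<tau>) ^ 3 * (t - 0) ^ 1 * (t - 1) ^ 1 * (t - d) ^ 0)" for t
      unfolding C by simp
    show "(\<lambda>t. (- 2025 * j / 64) * t * (t - 1) * (t - \<tau>) ^ 3) = (\<lambda>t. poly (canonical_poly 3 2) (l * (t - \<tau>))) \<and>
        2 / 3 = (2 / 3 :: complex) \<and> 1 / 2 = \<alpha> / 5 + (1 / 6 - \<alpha> / 5) - 2 / 3 + 1 \<or>
      (\<lambda>t. (- 2025 * j / 64) * t * (t - 1) * (t - \<tau>) ^ 3) = (\<lambda>t. 1 - poly (canonical_poly 3 2) (l * (t - \<tau>))) \<and>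
        2 / 3 = \<alpha> / 5 + (1 / 6 - \<alpha> / 5) - 2 / 3 + 1 \<and> 1 / 2 = (2 / 3 :: complex)"
      unfolding C by simp
  qed (use l0 j0 in \<open>auto simp: power2_eq_square algebra_simps
      add_divide_distrib diff_divide_distrib\<close>)
qed

section \<open>The seven types\<close>

text \<open>The order $m$ of $S$ at $\tau$; the other index is $k$ = \<open>type_degree - type_order\<close>.\<close>

fun type_order :: "reduction_type \<Rightarrow> nat" where
  "type_order Real2 = 2"
| "type_order Real3 = 2"
| "type_order Real4 = 2"
| "type_order Nonreal3 = 3"
| "type_order Nonreal4 = 3"
| "type_order Nonreal5 = 3"
| "type_order Nonreal6 = 3"

lemma type_unique:
  "type_order k = type_order k' \<Longrightarrow> type_degree k = type_degree k' \<Longrightarrow> k = k'"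
  by (cases k; cases k') simp_all

lemma type_exists:
  assumes "m \<in> {2, 3}" "k \<le> m"
  obtains K where "type_order K = m" "type_degree K = m + k"
proof -
  have "(m = 2 \<and> (k = 0 \<or> k = 1 \<or> k = 2)) \<or> (m = 3 \<and> (k = 0 \<or> k = 1 \<or> k = 2 \<or> k = 3))"
    using assms by auto
  then show ?thesis
    using that[of Real2] that[of Real3] that[of Real4] that[of Nonreal3] that[of Nonreal4]
      that[of Nonreal5] that[of Nonreal6] by auto
qed

lemma rep_d_real:
  assumes "s \<in> {1, -1}"
  shows "rep_d K s \<in> \<real> \<longleftrightarrow> type_order K = 2"
  using assms by (cases K) (auto simp: complex_is_Real_iff)

lemma rep_d_nondegenerate:
  assumes "s \<in> {1, -1}"
  shows "rep_d K s \<notin> {0, 1}"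
  using assms by (cases K) (auto simp: complex_eq_iff)

lemma sqrt_multiple_square:
  assumes "s \<in> {1, -1}" "r \<ge> 0"
  shows "(s * \<i> * of_real (sqrt r))\<^sup>2 = - of_real r"
proof -
  have "s\<^sup>2 = 1" using assms(1) by auto
  moreover have "(of_real (sqrt r) :: complex)\<^sup>2 = of_real r"
    using assms(2) by (simp flip: of_real_power)
  ultimately show ?thesis by (simp add: power_mult_distrib)
qed

text \<open>Both signs are treated at once: with j r the signed multiple of the square root of r,
  the computations use only that its square is -r.\<close>

lemma representative_reductions:
  assumes s: "s \<in> {1, -1 :: complex}"
  shows "equation_reduction (1/2 + s * \<i> * of_real (sqrt 3 / 2))
         (\<alpha> * \<beta> * (1/2 + s * \<i> * of_real (sqrt 3 / 6))) \<alpha> \<beta> ((\<alpha> + \<beta> + 1) / 3) ((\<alpha> + \<beta> + 1) / 3)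
         (\<alpha> + \<beta> - (\<alpha> + \<beta> + 1) / 3 - (\<alpha> + \<beta> + 1) / 3 + 1)
         (\<alpha> / 3) (\<beta> / 3) ((\<alpha> + \<beta> + 1) / 3)
         (\<lambda>t. 1 - (1 - t / (1/2 + s * \<i> * of_real (sqrt 3 / 6)))^3)
     \<and> (\<exists>P. degree P = 3 + 0 \<and> poly P = (\<lambda>t. 1 - (1 - t / (1/2 + s * \<i> * of_real (sqrt 3 / 6)))^3))"
      (is "?N3")
    and "equation_reduction (1/2 + s * \<i> * of_real (5 * sqrt 2 / 4))
         (\<alpha> * (2/3 - \<alpha>) * (1/2 + s * \<i> * of_real (sqrt 2 / 4))) \<alpha> (2/3 - \<alpha>) (1/2) (1/2)
         (\<alpha> + (2/3 - \<alpha>) - 1/2 - 1/2 + 1)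
         (\<alpha> / 4) (1/6 - \<alpha> / 4) (1/2)
         (\<lambda>t. 1 - (1 - t / (1/2 + s * \<i> * of_real (5 * sqrt 2 / 4)))
                   * (1 - t / (1/2 + s * \<i> * of_real (sqrt 2 / 4)))^3)
     \<and> (\<exists>P. degree P = 3 + 1 \<and> poly P = (\<lambda>t. 1 - (1 - t / (1/2 + s * \<i> * of_real (5 * sqrt 2 / 4)))
                   * (1 - t / (1/2 + s * \<i> * of_real (sqrt 2 / 4)))^3))"
      (is "?N4")
    and "equation_reduction (1/2 + s * \<i> * of_real (11 * sqrt 15 / 90))
         (\<alpha> * (5/6 - \<alpha>) * (1/2 + s * \<i> * of_real (sqrt 15 / 18))) \<alpha> (5/6 - \<alpha>) (2/3) (2/3)
         (\<alpha> + (5/6 - \<alpha>) - 2/3 - 2/3 + 1)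
         (\<alpha> / 5) (1/6 - \<alpha> / 5) (2/3)
         (\<lambda>t. (- s * \<i> * of_real (2025 * sqrt 15 / 64)) * t * (t - 1)
                   * (t - (1/2 + s * \<i> * of_real (sqrt 15 / 18)))^3)
     \<and> (\<exists>P. degree P = 3 + 2 \<and> poly P = (\<lambda>t. (- s * \<i> * of_real (2025 * sqrt 15 / 64)) * t * (t - 1)
                   * (t - (1/2 + s * \<i> * of_real (sqrt 15 / 18)))^3))"
      (is "?N5")
    and "equation_reduction (1/2 + s * \<i> * of_real (sqrt 3 / 2))
         (\<alpha> * (1 - \<alpha>) * (1/2 + s * \<i> * of_real (sqrt 3 / 6))) \<alpha> (1 - \<alpha>) (2/3) (2/3)
         (\<alpha> + (1 - \<alpha>) - 2/3 - 2/3 + 1)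
         (\<alpha> / 6) (1/6 - \<alpha> / 6) (2/3)
         (\<lambda>t. 1 - 4 * ((1 - t / (1/2 + s * \<i> * of_real (sqrt 3 / 6)))^3 - 1/2)^2)
     \<and> (\<exists>P. degree P = 3 + 3 \<and>
          poly P = (\<lambda>t. 1 - 4 * ((1 - t / (1/2 + s * \<i> * of_real (sqrt 3 / 6)))^3 - 1/2)^2))"
      (is "?N6")
proof -
  define j where "j r = s * \<i> * of_real (sqrt r)" for r
  have j: "j r * j r = - of_real r" if "r \<ge> 0" for r
    using sqrt_multiple_square[OF s that] by (simp add: j_def power2_eq_square)
  have scale: "s * \<i> * of_real (sqrt r / x) = j r / of_real x"
    "s * \<i> * of_real (y * sqrt r / x) = of_real y * j r / of_real x"
    "- s * \<i> * of_real (y * sqrt r / x) = - of_real y * j r / of_real x" for r x y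
    by (simp_all add: j_def)
  define \<tau> where "\<tau> = 1/2 + s * \<i> * of_real (sqrt 3 / 6)"
  define d where "d = 1/2 + s * \<i> * of_real (sqrt 3 / 2)"
  have \<tau>: "\<tau> = 1/2 + j 3 / 6" and d: "d = 1/2 + j 3 / 2"
    unfolding \<tau>_def d_def scale by simp_all
  have d1: "d = 3 * \<tau> - 1" unfolding \<tau> d by simp
  have d2: "d = 3 * \<tau>\<^sup>2" unfolding \<tau> d using j[of 3] by (simp add: power2_eq_square field_simps)
  have "d \<noteq> 0" using rep_d_nondegenerate[OF s, of Nonreal3] by (simp add: d_def)
  then have \<tau>0: "\<tau> \<noteq> 0" using d2 by auto
  show ?N3 using Nonreal3_reduction[OF d1 d2 \<tau>0 refl] unfolding \<tau>_def d_def .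
  show ?N6 using Nonreal6_reduction[OF d1 d2 \<tau>0] unfolding \<tau>_def d_def .
  have "(j 2)\<^sup>2 = - 2" "(j 15)\<^sup>2 = - 15" using j by (simp_all add: power2_eq_square)
  from Nonreal4_reduction[OF this(1) refl refl] Nonreal5_reduction[OF this(2) refl refl]
  show ?N4 ?N5 unfolding scale by simp_all
qed

lemma representativeI:
  assumes "d = rep_d K s" "\<And>t. R t = rep_R K s t" "R 0 = 0" "d \<noteq> 0" "n > 0"
    and red: "equation_reduction d q \<alpha> \<beta> \<gamma> \<delta> (\<alpha> + \<beta> - \<gamma> - \<delta> + 1) a b c R \<and>
      (\<exists>P. degree P = n \<and> poly P = R)"
  shows "representative K s d q \<alpha> \<beta> \<gamma> \<delta> a b c R"
proof -
  obtain P where P: "degree P = n" "poly P = R" using red by blast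
  have "\<forall>\<^sub>F t in nhds 0. Hl d q \<alpha> \<beta> \<gamma> \<delta> t = F21 a b c (R t)"
    if "\<gamma> \<notin> \<int>\<^sub>\<le>\<^sub>0" "c \<notin> \<int>\<^sub>\<le>\<^sub>0"
    using Hl_eq_F21_comp[OF assms(4) that, of P q \<alpha> \<beta> \<delta> a b] P red assms(3,5) by simp
  then show ?thesis
    using assms(1-3) red by (auto simp: representative_def)
qed

section \<open>Occurrence of every type\<close>

lemma Re_pos_not_nonpos_Int: "Re z > 0 \<Longrightarrow> z \<notin> \<int>\<^sub>\<le>\<^sub>0"
  by (auto elim!: nonpos_Ints_cases)

text \<open>Nonzero \<alpha>\<beta>, \<gamma>, \<delta> and \<epsilon> exclude all four
  degenerations. The last conjunct records whether \<tau> is singular, which determines m for the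
  representative.\<close>

lemma type_occursI:
  assumes d: "d = rep_d K s" "d \<notin> {0, 1}" and R: "\<And>t. R t = rep_R K s t" "R 0 = 0"
    and n: "n = type_degree K"
    and ne: "\<alpha> * \<beta> \<noteq> 0" "\<delta> \<noteq> 0" "\<alpha> + \<beta> - \<gamma> - \<delta> + 1 \<noteq> 0" "Re \<gamma> > 0"
    and \<tau>: "\<tau> \<in> {0, 1, d} \<longleftrightarrow> type_order K = 2"
    and q: "q = \<alpha> * \<beta> * \<tau>"
    and red: "equation_reduction d q \<alpha> \<beta> \<gamma> \<delta> (\<alpha> + \<beta> - \<gamma> - \<delta> + 1) a b c R \<and>
      (\<exists>P. degree P = n \<and> poly P = R)"
  shows "\<exists>q \<alpha> \<beta> \<gamma> \<delta> \<epsilon> a b c R.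
       heun_parameters (rep_d K s) \<alpha> \<beta> \<gamma> \<delta> \<epsilon> \<and>
       four_singular_points (rep_d K s) q \<alpha> \<beta> \<gamma> \<delta> \<epsilon> \<and> nontrivial q \<alpha> \<beta> \<and>
       Hl_rational_reduction (rep_d K s) q \<alpha> \<beta> \<gamma> \<delta> \<epsilon> a b c R 1 \<and>
       degree R = type_degree K \<and> poly R = rep_R K s \<and>
       (q / (\<alpha> * \<beta>) \<in> {0, 1, rep_d K s} \<longleftrightarrow> type_order K = 2)"
proof -
  obtain P where P: "degree P = n" "poly P = R" using red by blast
  have "n > 0" unfolding n by (cases K) simp_all
  have "\<gamma> \<noteq> 0" using ne by auto
  have R': "R = rep_R K s" using R(1) by (intro ext)
  show ?thesis
  proof (intro exI conjI)
    show "heun_parameters (rep_d K s) \<alpha> \<beta> \<gamma> \<delta> (\<alpha> + \<beta> - \<gamma> - \<delta> + 1)"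
      using d by (simp add: heun_parameters_def)
    show "four_singular_points (rep_d K s) (\<alpha> * \<beta> * \<tau>) \<alpha> \<beta> \<gamma> \<delta> (\<alpha> + \<beta> - \<gamma> - \<delta> + 1)"
      using ne \<open>\<gamma> \<noteq> 0\<close> unfolding four_singular_points_def by blast
    show "nontrivial (\<alpha> * \<beta> * \<tau>) \<alpha> \<beta>" using ne by (simp add: nontrivial_def)
    show "Hl_rational_reduction (rep_d K s) (\<alpha> * \<beta> * \<tau>) \<alpha> \<beta> \<gamma> \<delta> (\<alpha> + \<beta> - \<gamma> - \<delta> + 1) a b c P 1"
      using red q P R(2) \<open>n > 0\<close> Re_pos_not_nonpos_Int[OF ne(4)] d(1)
      by (simp add: Hl_rational_reduction_def)
    show "\<alpha> * \<beta> * \<tau> / (\<alpha> * \<beta>) \<in> {0, 1, rep_d K s} \<longleftrightarrow> type_order K = 2"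
      using \<tau> ne(1) d(1) by simp
  qed (use P n R' in simp_all)
qed

lemma type_occurs:
  assumes s: "s \<in> {1, -1 :: complex}"
  shows "\<exists>q \<alpha> \<beta> \<gamma> \<delta> \<epsilon> a b c R.
       heun_parameters (rep_d K s) \<alpha> \<beta> \<gamma> \<delta> \<epsilon> \<and>
       four_singular_points (rep_d K s) q \<alpha> \<beta> \<gamma> \<delta> \<epsilon> \<and> nontrivial q \<alpha> \<beta> \<and>
       Hl_rational_reduction (rep_d K s) q \<alpha> \<beta> \<gamma> \<delta> \<epsilon> a b c R 1 \<and>
       degree R = type_degree K \<and> poly R = rep_R K s \<and>
       (q / (\<alpha> * \<beta>) \<in> {0, 1, rep_d K s} \<longleftrightarrow> type_order K = 2)"
proof -
  note d = rep_d_nondegenerate[OF s, of K]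
  note N = representative_reductions[OF s]
  show ?thesis
  \<comment> \<open>The sample values of the free parameters make all exponents and \<alpha>\<beta>
    nonzero and give \<gamma> positive real part.\<close>
  proof (cases K)
    case Real2
    show ?thesis
      by (rule type_occursI[where \<tau> = 1, OF _ _ _ _ _ _ _ _ _ _ _ Real2_reduction[of 1 1 1]])
        (simp_all add: Real2)
  next
    case Real3
    show ?thesis
      by (rule type_occursI[where \<tau> = 1, OF _ _ _ _ _ _ _ _ _ _ _ Real3_reduction[of 1 1]])
        (simp_all add: Real3)
  next
    case Real4
    show ?thesis
      by (rule type_occursI[where \<tau> = 1, OF _ _ _ _ _ _ _ _ _ _ _ Real4_reduction[of 1 1]])
        (simp_all add: Real4 power2_eq_square)
  next
    case Nonreal3
    show ?thesis
      by (rule type_occursI[where \<tau> = "1/2 + s * \<i> * of_real (sqrt 3 / 6)",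
            OF _ _ _ _ _ _ _ _ _ _ _ N(1)[of 1 1]])
        (use s d in \<open>auto simp: Nonreal3 complex_eq_iff\<close>)
  next
    case Nonreal4
    show ?thesis
      by (rule type_occursI[where \<tau> = "1/2 + s * \<i> * of_real (sqrt 2 / 4)",
            OF _ _ _ _ _ _ _ _ _ _ _ N(2)[of "1/3"]])
        (use s d in \<open>auto simp: Nonreal4 complex_eq_iff\<close>)
  next
    case Nonreal5
    show ?thesis
      by (rule type_occursI[where \<tau> = "1/2 + s * \<i> * of_real (sqrt 15 / 18)",
            OF _ _ _ _ _ _ _ _ _ _ _ N(3)[of "1/3"]])
        (use s d in \<open>auto simp: Nonreal5 complex_eq_iff\<close>)
  next
    case Nonreal6
    show ?thesis
      by (rule type_occursI[where \<tau> = "1/2 + s * \<i> * of_real (sqrt 3 / 6)",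
            OF _ _ _ _ _ _ _ _ _ _ _ N(4)[of "1/2"]])
        (use s d in \<open>auto simp: Nonreal6 complex_eq_iff power2_eq_square\<close>)
  qed
qed

text \<open>A representative is brought to canonical form by the classification itself, applied to a
  reduction that it induces. Whether \<tau> is singular yields m, and the degree then fixes
  k.\<close>

lemma rep_canonical:
  assumes s: "s \<in> {1, -1 :: complex}"
  obtains P k where "poly P = rep_R K s" "canonical_reduction (type_order K) k (rep_d K s) P"
    "degree P = type_degree K"
proof -
  obtain q \<alpha> \<beta> \<gamma> \<delta> \<epsilon> a b c P where *:
       "heun_parameters (rep_d K s) \<alpha> \<beta> \<gamma> \<delta> \<epsilon>"
       "four_singular_points (rep_d K s) q \<alpha> \<beta> \<gamma> \<delta> \<epsilon>" "nontrivial q \<alpha> \<beta>"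
       "Hl_rational_reduction (rep_d K s) q \<alpha> \<beta> \<gamma> \<delta> \<epsilon> a b c P 1"
       "degree P = type_degree K" "poly P = rep_R K s"
       "q / (\<alpha> * \<beta>) \<in> {0, 1, rep_d K s} \<longleftrightarrow> type_order K = 2"
    using type_occurs[OF s, of K] by blast
  have "degree P > 0" unfolding *(5) by (cases K) simp_all
  moreover have "equation_reduction (rep_d K s) q \<alpha> \<beta> \<gamma> \<delta> \<epsilon> a b c (poly P)"
    using *(4) by (simp add: Hl_rational_reduction_def)
  ultimately obtain k where
    "canonical_reduction (if q / (\<alpha> * \<beta>) \<in> {0, 1, rep_d K s} then 2 else 3) k (rep_d K s) P"
    using polynomial_reduction_canonical[OF rep_d_nondegenerate[OF s] *(3) _ *(2)] by blast
  moreover have "(if q / (\<alpha> * \<beta>) \<in> {0, 1, rep_d K s} then 2 else 3) = type_order K"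
    using *(7) by (cases K) auto
  ultimately show ?thesis using that *(5,6) by metis
qed

section \<open>Classification of the rational reductions\<close>

lemma rational_reduction_classification:
  assumes hp: "heun_parameters d \<alpha> \<beta> \<gamma> \<delta> \<epsilon>" and four: "four_singular_points d q \<alpha> \<beta> \<gamma> \<delta> \<epsilon>"
    and nt: "nontrivial q \<alpha> \<beta>" and hl: "Hl_rational_reduction d q \<alpha> \<beta> \<gamma> \<delta> \<epsilon> a b c P Q"
  shows "c \<notin> \<int>\<^sub>\<le>\<^sub>0 \<and>
       (\<exists>R :: complex poly. P = R * Q \<and> degree R \<in> {2, 3, 4, 5, 6} \<and>
          (\<forall>\<^sub>F t in nhds 0. Hl d q \<alpha> \<beta> \<gamma> \<delta> t = F21 a b c (poly R t)) \<and>
          (\<exists>k. degree R = type_degree k \<and>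
               (\<forall>s \<in> {1, -1}. same_type (rep_d k s) (rep_R k s) d (poly R)) \<and>
               (\<forall>k'. k' \<noteq> k \<longrightarrow>
                  (\<forall>s \<in> {1, -1}. \<not> same_type (rep_d k' s) (rep_R k' s) d (poly R)))))"
proof -
  have d: "d \<notin> {0, 1}" and \<epsilon>: "\<alpha> + \<beta> - \<gamma> - \<delta> + 1 = \<epsilon>"
    using hp by (auto simp: heun_parameters_def algebra_simps)
  have \<gamma>: "\<gamma> \<notin> \<int>\<^sub>\<le>\<^sub>0" and cop: "coprime P Q" and degPQ: "degree P > 0 \<or> degree Q > 0"
    and redPQ: "equation_reduction d q \<alpha> \<beta> \<gamma> \<delta> \<epsilon> a b c (\<lambda>t. poly P t / poly Q t)"
    and P0: "poly P 0 = 0"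
    using hl by (auto simp: Hl_rational_reduction_def)
  have degQ: "degree Q = 0" using rational_reduction_denominator[OF d nt cop degPQ redPQ] .
  then obtain w where Q: "Q = [:w:]" by (auto elim: degree_eq_zeroE)
  have w: "w \<noteq> 0" using reduction_poly_identity(3)[OF cop degPQ redPQ] Q by simp
  define R where "R = smult (1 / w) P"
  have PR: "P = R * Q" using w by (simp add: R_def Q)
  have R: "poly R = (\<lambda>t. poly P t / poly Q t)" by (auto simp: R_def Q)
  have red: "equation_reduction d q \<alpha> \<beta> \<gamma> \<delta> \<epsilon> a b c (poly R)" using redPQ unfolding R .
  have degR: "degree R > 0" using degPQ degQ w by (simp add: R_def)
  have R0: "poly R 0 = 0" using P0 by (simp add: R)
  \<comment> \<open>If R vanishes to order n at 0, the residue there gives \<gamma> = c n - (n - 1);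
    a nonpositive integer c would make \<gamma> one too.\<close>
  have c: "c \<notin> \<int>\<^sub>\<le>\<^sub>0"
  proof
    assume "c \<in> \<int>\<^sub>\<le>\<^sub>0"
    then obtain n :: nat where n: "c = - of_nat n" by (auto elim: nonpos_Ints_cases')
    have "R \<noteq> 0" using degR by auto
    then have k: "order 0 R = Suc (order 0 (pderiv R))" using R0 by (intro order_pderiv)
    have "order 0 (R - 1) = 0" using R0 by (intro order_0I) simp
    then have "c * of_nat (order 0 R) - of_nat (order 0 (pderiv R)) = \<gamma>"
      using reduction_exponents[OF degR red, of 0] d by simp
    then have "\<gamma> = - of_nat (n * order 0 R + order 0 (pderiv R))"
      unfolding n by simp
    then show False using \<gamma> by (metis minus_of_nat_in_nonpos_Ints)
  qed
  have Hl: "\<forall>\<^sub>F t in nhds 0. Hl d q \<alpha> \<beta> \<gamma> \<delta> t = F21 a b c (poly R t)"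
    by (rule Hl_eq_F21_comp[OF _ \<gamma> c R0 degR]) (use d red \<epsilon> in auto)
  obtain m k where can: "canonical_reduction m k d R"
    using polynomial_reduction_canonical[OF d nt degR four red] by blast
  then have mk: "m \<in> {2, 3}" "k \<le> m" "degree R = m + k" by (auto simp: canonical_reduction_def)
  obtain K where K: "type_order K = m" "type_degree K = m + k" using type_exists[OF mk(1,2)] .
  have same: "same_type (rep_d K s) (rep_R K s) d (poly R)" if s: "s \<in> {1, -1}" for s
  proof -
    obtain P0 k0 where P0: "poly P0 = rep_R K s" "canonical_reduction (type_order K) k0 (rep_d K s) P0"
      "degree P0 = type_degree K" by (rule rep_canonical[OF s])
    \<comment> \<open>Equal m and equal degree m + k leave no choice for the second index.\<close>
    have "k0 = k" using P0(2,3) K by (simp add: canonical_reduction_def)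
    then have "canonical_reduction m k (rep_d K s) P0" using P0(2) K by simp
    then show ?thesis
      using canonical_reductions_same_type[OF can _ d rep_d_nondegenerate[OF s] R0] P0(1) by metis
  qed
  \<comment> \<open>Types of different degree are separated by the degree of R. Equal degrees are
    shared only by a type with real d and one with non-real d, and the orbit of d decides between
    them.\<close>
  have other: "K' = K" if s: "s \<in> {1, -1}" and st: "same_type (rep_d K' s) (rep_R K' s) d (poly R)" for K' s
  proof (rule type_unique)
    obtain P0 where "poly P0 = rep_R K' s" "degree P0 = type_degree K'"
      using rep_canonical[OF s] by metis
    then show "type_degree K' = type_degree K"
      using st same_type_degree[of "rep_d K' s" P0 d R] mk(3) K(2) by simp
    have "d \<in> cross_ratio_orbit (rep_d K' s)" "d \<in> cross_ratio_orbit (rep_d K 1)"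
      using st same[of 1] by (simp_all add: same_type_def)
    then have "d \<in> \<real> \<longleftrightarrow> rep_d K' s \<in> \<real>" "d \<in> \<real> \<longleftrightarrow> rep_d K 1 \<in> \<real>"
      using cross_ratio_orbit_real[OF _ rep_d_nondegenerate[OF s]]
        cross_ratio_orbit_real[OF _ rep_d_nondegenerate[of 1]] by blast+
    then have "type_order K' = 2 \<longleftrightarrow> type_order K = 2"
      using rep_d_real[OF s, of K'] rep_d_real[of 1 K] by simp
    then show "type_order K' = type_order K" by (cases K; cases K') simp_all
  qed
  have "degree R \<in> {2, 3, 4, 5, 6}" unfolding mk(3) K(2)[symmetric] by (cases K) simp_all
  then show ?thesis
    using c PR Hl mk(3) K(2) same other by (intro conjI exI[of _ R] exI[of _ K]) auto
qed

theorem theorem3p8: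
  shows
    \<comment> \<open>every reduction is polynomial, of degree 2 to 6, and of exactly one of the seven types\<close>
   "(\<forall>d q \<alpha> \<beta> \<gamma> \<delta> \<epsilon> a b c P Q.
       heun_parameters d \<alpha> \<beta> \<gamma> \<delta> \<epsilon> \<and> four_singular_points d q \<alpha> \<beta> \<gamma> \<delta> \<epsilon> \<and> nontrivial q \<alpha> \<beta> \<and>
       Hl_rational_reduction d q \<alpha> \<beta> \<gamma> \<delta> \<epsilon> a b c P Q \<longrightarrow>
       c \<notin> \<int>\<^sub>\<le>\<^sub>0 \<and>
       (\<exists>R :: complex poly. P = R * Q \<and> degree R \<in> {2, 3, 4, 5, 6} \<and>
          (\<forall>\<^sub>F t in nhds 0. Hl d q \<alpha> \<beta> \<gamma> \<delta> t = F21 a b c (poly R t)) \<and>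
          (\<exists>k. degree R = type_degree k \<and>
               (\<forall>s \<in> {1, -1}. same_type (rep_d k s) (rep_R k s) d (poly R)) \<and>
               (\<forall>k'. k' \<noteq> k \<longrightarrow>
                  (\<forall>s \<in> {1, -1}. \<not> same_type (rep_d k' s) (rep_R k' s) d (poly R)))))) \<and>
    \<comment> \<open>all seven types occur\<close>
    (\<forall>k. \<forall>s \<in> {1, -1}. \<exists>q \<alpha> \<beta> \<gamma> \<delta> \<epsilon> a b c R.
       heun_parameters (rep_d k s) \<alpha> \<beta> \<gamma> \<delta> \<epsilon> \<and>
       four_singular_points (rep_d k s) q \<alpha> \<beta> \<gamma> \<delta> \<epsilon> \<and> nontrivial q \<alpha> \<beta> \<and>
       Hl_rational_reduction (rep_d k s) q \<alpha> \<beta> \<gamma> \<delta> \<epsilon> a b c R 1 \<and>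
       degree R = type_degree k \<and> poly R = rep_R k s) \<and>
    \<comment> \<open>the representatives\<close>
    (\<forall>s \<in> {1, -1 :: complex}. \<forall>\<alpha> \<beta> \<gamma> :: complex.
       representative Real2 s 2 (\<alpha> * \<beta>) \<alpha> \<beta> \<gamma> (\<alpha> + \<beta> - 2 * \<gamma> + 1)
         (\<alpha> / 2) (\<beta> / 2) \<gamma>
         (\<lambda>t. t * (2 - t)) \<and>
       representative Real3 s 4 (\<alpha> * \<beta>) \<alpha> \<beta> (1/2) (2 * (\<alpha> + \<beta>) / 3)
         (\<alpha> / 3) (\<beta> / 3) (1/2)
         (\<lambda>t. 1 - (t - 1)^2 * (1 - t/4)) \<and>
       representative Real4 s 2 (\<alpha> * \<beta>) \<alpha> \<beta> ((\<alpha> + \<beta> + 2) / 4) ((\<alpha> + \<beta>) / 2)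
         (\<alpha> / 4) (\<beta> / 4) ((\<alpha> + \<beta> + 2) / 4)
         (\<lambda>t. 1 - 4 * (t * (2 - t) - 1/2)^2) \<and>
       representative Nonreal3 s (1/2 + s * \<i> * of_real (sqrt 3 / 2))
         (\<alpha> * \<beta> * (1/2 + s * \<i> * of_real (sqrt 3 / 6))) \<alpha> \<beta> ((\<alpha> + \<beta> + 1) / 3) ((\<alpha> + \<beta> + 1) / 3)
         (\<alpha> / 3) (\<beta> / 3) ((\<alpha> + \<beta> + 1) / 3)
         (\<lambda>t. 1 - (1 - t / (1/2 + s * \<i> * of_real (sqrt 3 / 6)))^3) \<and>
       representative Nonreal4 s (1/2 + s * \<i> * of_real (5 * sqrt 2 / 4))
         (\<alpha> * (2/3 - \<alpha>) * (1/2 + s * \<i> * of_real (sqrt 2 / 4))) \<alpha> (2/3 - \<alpha>) (1/2) (1/2)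
         (\<alpha> / 4) (1/6 - \<alpha> / 4) (1/2)
         (\<lambda>t. 1 - (1 - t / (1/2 + s * \<i> * of_real (5 * sqrt 2 / 4)))
                   * (1 - t / (1/2 + s * \<i> * of_real (sqrt 2 / 4)))^3) \<and>
       representative Nonreal5 s (1/2 + s * \<i> * of_real (11 * sqrt 15 / 90))
         (\<alpha> * (5/6 - \<alpha>) * (1/2 + s * \<i> * of_real (sqrt 15 / 18))) \<alpha> (5/6 - \<alpha>) (2/3) (2/3)
         (\<alpha> / 5) (1/6 - \<alpha> / 5) (2/3)
         (\<lambda>t. (- s * \<i> * of_real (2025 * sqrt 15 / 64)) * t * (t - 1)
                   * (t - (1/2 + s * \<i> * of_real (sqrt 15 / 18)))^3) \<and>
       representative Nonreal6 s (1/2 + s * \<i> * of_real (sqrt 3 / 2))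
         (\<alpha> * (1 - \<alpha>) * (1/2 + s * \<i> * of_real (sqrt 3 / 6))) \<alpha> (1 - \<alpha>) (2/3) (2/3)
         (\<alpha> / 6) (1/6 - \<alpha> / 6) (2/3)
         (\<lambda>t. 1 - 4 * ((1 - t / (1/2 + s * \<i> * of_real (sqrt 3 / 6)))^3 - 1/2)^2))"
proof (rule conjI[OF _ conjI], goal_cases)
  case 1
  show ?case by (intro allI impI, elim conjE) (rule rational_reduction_classification)
next
  case 2
  show ?case using type_occurs by meson
next
  case 3
  show ?case
  proof (intro ballI allI conjI, goal_cases)
    case (1 s \<alpha> \<beta> \<gamma>)
    show ?case by (rule representativeI[OF _ _ _ _ _ Real2_reduction]) simp_all
  next
    case (2 s \<alpha> \<beta> \<gamma>)
    show ?case
      by (rule representativeI[OF _ _ _ _ _ Real3_reduction]) (simp_all add: power2_eq_square)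
  next
    case (3 s \<alpha> \<beta> \<gamma>)
    show ?case
      by (rule representativeI[OF _ _ _ _ _ Real4_reduction]) (simp_all add: power2_eq_square)
  next
    case (4 s \<alpha> \<beta> \<gamma>)
    show ?case
      by (rule representativeI[OF _ _ _ _ _ representative_reductions(1)[OF 4]])
        (use rep_d_nondegenerate[OF 4, of Nonreal3] in \<open>simp_all add: power2_eq_square\<close>)
  next
    case (5 s \<alpha> \<beta> \<gamma>)
    show ?case
      by (rule representativeI[OF _ _ _ _ _ representative_reductions(2)[OF 5]])
        (use rep_d_nondegenerate[OF 5, of Nonreal4] in \<open>simp_all add: power2_eq_square\<close>)
  next
    case (6 s \<alpha> \<beta> \<gamma>)
    show ?case
      by (rule representativeI[OF _ _ _ _ _ representative_reductions(3)[OF 6]])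
        (use rep_d_nondegenerate[OF 6, of Nonreal5] in \<open>simp_all add: power2_eq_square\<close>)
  next
    case (7 s \<alpha> \<beta> \<gamma>)
    show ?case
      by (rule representativeI[OF _ _ _ _ _ representative_reductions(4)[OF 7]])
        (use rep_d_nondegenerate[OF 7, of Nonreal6] in \<open>simp_all add: power2_eq_square\<close>)
  qed
qed

end
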